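(* Let $\Lambda$ be a countable discrete non-amenable group, and let $\Lambda$ act on $([0,1]^{\Lambda},\mu)$ by the Bernoulli shift. Then there is a measurable, measure-preserving, ergodic, essentially free action of the free group $\mathbf{F}_2$ on $([0,1]^{\Lambda},\mu)$ such that for $\mu$-almost every $x$, the $\mathbf{F}_2$-orbit of $x$ is contained in the $\Lambda$-orbit of $x$; i.e., the orbit equivalence relation of the $\mathbf{F}_2$-action is contained (up to a null set) in that of the Bernoulli shift action of $\Lambda$, so that almost every $\Lambda$-orbit decomposes into $\mathbf{F}_2$-orbits.
   Context: For a finite or countable set $M$, $\mu$ denotes the product $\otimes_M \mathrm{Leb}$ of Lebesgue measures on $[0,1]^M$. The Bernoulli shift action of a group $\Lambda$ on $[0,1]^{\Lambda}$ is $(\lambda\cdot x)(g)=x(\lambda^{-1}g)$; it preserves $\mu$. An action is essentially free if almost every point has trivial stabilizer. *)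

theory Defs
  imports "HOL-Probability.Probability"
begin

definition amenable_group :: "'g::group_add itself \<Rightarrow> bool" where
  "amenable_group _ \<longleftrightarrow> (\<exists>\<nu> :: 'g set \<Rightarrow> real.
      (\<forall>A. \<nu> A \<ge> 0) \<and> \<nu> UNIV = 1 \<and>
      (\<forall>A B. A \<inter> B = {} \<longrightarrow> \<nu> (A \<union> B) = \<nu> A + \<nu> B) \<and>
      (\<forall>g A. \<nu> ((\<lambda>h. g + h) ` A) = \<nu> A))"

definition bern_space :: "'g itself \<Rightarrow> ('g \<Rightarrow> real) measure" where
  "bern_space _ = (\<Pi>\<^sub>M g\<in>(UNIV::'g set). restrict_space lborel {0..1::real})"

definition bshift :: "'g::group_add \<Rightarrow> ('g \<Rightarrow> 'a) \<Rightarrow> ('g \<Rightarrow> 'a)" where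
  "bshift l x = (\<lambda>g. x (- l + g))"

text \<open>Elements of the free group F2 on generators a (True) and b (False) are reduced
  words in letters (generator, sign); sign True = generator, False = its inverse.\<close>
type_synonym f2_letter = "bool \<times> bool"

fun reduced_word :: "f2_letter list \<Rightarrow> bool" where
  "reduced_word [] = True"
| "reduced_word [l] = True"
| "reduced_word (l1 # l2 # w) =
     (\<not> (fst l1 = fst l2 \<and> snd l1 \<noteq> snd l2) \<and> reduced_word (l2 # w))"

definition letter_act :: "'x set \<Rightarrow> ('x \<Rightarrow> 'x) \<Rightarrow> ('x \<Rightarrow> 'x) \<Rightarrow> f2_letter \<Rightarrow> 'x \<Rightarrow> 'x" where
  "letter_act X a b l = (let f = (if fst l then a else b) in if snd l then f else inv_into X f)"

fun word_act :: "'x set \<Rightarrow> ('x \<Rightarrow> 'x) \<Rightarrow> ('x \<Rightarrow> 'x) \<Rightarrow> f2_letter list \<Rightarrow> 'x \<Rightarrow> 'x" where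
  "word_act X a b [] = id"
| "word_act X a b (l # w) = letter_act X a b l \<circ> word_act X a b w"

definition mp_map :: "'x measure \<Rightarrow> ('x \<Rightarrow> 'x) \<Rightarrow> bool" where
  "mp_map M f \<longleftrightarrow> f \<in> M \<rightarrow>\<^sub>M M \<and> distr M M f = M"

text \<open>A measurable measure-preserving action of F2 on M, given by the images of
  the two free generators (universal property of F2).\<close>
definition f2_mp_action :: "'x measure \<Rightarrow> ('x \<Rightarrow> 'x) \<Rightarrow> ('x \<Rightarrow> 'x) \<Rightarrow> bool" where
  "f2_mp_action M a b \<longleftrightarrow>
     (\<forall>f\<in>{a, b}. bij_betw f (space M) (space M) \<and>
        mp_map M f \<and> mp_map M (inv_into (space M) f))"

definition f2_ergodic :: "'x measure \<Rightarrow> ('x \<Rightarrow> 'x) \<Rightarrow> ('x \<Rightarrow> 'x) \<Rightarrow> bool" where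
  "f2_ergodic M a b \<longleftrightarrow>
     (\<forall>A\<in>sets M. (\<forall>w. word_act (space M) a b w ` A = A) \<longrightarrow>
        measure M A = 0 \<or> measure M A = 1)"

definition f2_ess_free :: "'x measure \<Rightarrow> ('x \<Rightarrow> 'x) \<Rightarrow> ('x \<Rightarrow> 'x) \<Rightarrow> bool" where
  "f2_ess_free M a b \<longleftrightarrow>
     (AE x in M. \<forall>w. reduced_word w \<and> w \<noteq> [] \<longrightarrow> word_act (space M) a b w x \<noteq> x)"

end

theory Submission
  imports Defs
begin

text \<open>
  Non-amenability of the group yields, by compactness of the space of means, a spectral gap: a
  finitely supported symmetric random walk whose \<open>k\<close>-step return probabilities decay like \<open>\<rho>^k\<close>.

  Let every vertex \<open>v\<close> of the group propose random edges \<open>v \<rightarrow> v + g\<close>, with \<open>g\<close> distributed like \<open>K + j\<close>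
  steps of the walk in the \<open>j\<close>-th block of proposals. The expected number of proposed edges at a vertex
  is infinite, but a closed trail through given blocks only costs a return probability, so for large
  \<open>K\<close> the expected number of cycles through edges of the \<open>j\<close>-th block at a vertex is at most a constant times
  \<open>\<rho>^(K + j)\<close>, which is summable. Accepting proposals greedily as long as they extend a partial injection
  and close no cycle, one therefore loses few proposals, and mixing of the Bernoulli shift forces the
  partial injection to become a permutation. Doing this twice, the second time on top of the first
  permutation, gives two equivariant random permutations whose union is a forest, that is, a free
  action of \<open>F\<^sub>2\<close> inside the orbits of the shift.

  For ergodicity, a set invariant under the first generator cannot depend on the coins used only for
  the second one, since the orbits of the first generator leave every finite set. Given the coins of
  the first generator, the second generator moves the origin to any \<open>g\<close> in a suitable infinite
  set with positive probability, unless the first generator already joins the two. Hence an invariant set is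
  invariant under infinitely many group elements, and mixing makes it trivial.
\<close>

text \<open>Two demands pull against each other: matching every vertex calls for infinitely many
  expected proposals per vertex, while freeness forbids the cycles that abundant proposals create.
  They are reconciled because each block has total probability one, so the blocks sum to infinity,
  whereas closing a cycle through block \<open>j\<close> costs the value of a convolution power at
  one point, which is at most \<open>\<rho> ^ (K + j)\<close>. The index \<open>K\<close> is chosen
  with \<open>\<rho> ^ K / (1 - \<rho>) < 1 / 8\<close>: each further edge of a trail has two
  possible flags and two directions, so it costs at most the factor 4 / 8 = 1 / 2, and trails of all
  lengths sum up. All choices must be measurable and equivariant, hence no vertex may be preferred:
  time runs through the slots only, and edges proposed at the same time are judged in the presence
  of each other. The generators own disjoint sets of coins, so that the coins of one can be
  resampled while the other is kept. A permutation acts on a point by re-rooting: the point is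
  viewed from the vertex to which the permutation moves 0. Words in the generators then become walks
  in one fixed forest.\<close>

abbreviation nsum :: "('a \<Rightarrow> ennreal) \<Rightarrow> ennreal" (binder "\<Sum>\<^sup>+" 61) where
  "nsum \<equiv> nn_integral (count_space UNIV)"

section \<open>Non-amenability and return probabilities\<close>

definition fin_supp :: "('a \<Rightarrow> real) \<Rightarrow> bool" where
  "fin_supp f \<longleftrightarrow> finite {x. f x \<noteq> 0}"

lemma fin_supp_summable: "fin_supp f \<Longrightarrow> f summable_on UNIV"
  unfolding fin_supp_def by (rule finite_nonzero_values_imp_summable_on) auto

lemma fin_supp_add: "fin_supp f \<Longrightarrow> fin_supp g \<Longrightarrow> fin_supp (\<lambda>x. f x + g x)"
  unfolding fin_supp_def by (rule finite_subset[of _ "{x. f x \<noteq> 0} \<union> {x. g x \<noteq> 0}"]) auto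

lemma fin_supp_diff: "fin_supp f \<Longrightarrow> fin_supp g \<Longrightarrow> fin_supp (\<lambda>x. f x - g x)"
  unfolding fin_supp_def by (rule finite_subset[of _ "{x. f x \<noteq> 0} \<union> {x. g x \<noteq> 0}"]) auto

lemma fin_supp_mult1: "fin_supp f \<Longrightarrow> fin_supp (\<lambda>x. f x * g x)"
  unfolding fin_supp_def by (erule finite_subset[rotated]) auto

lemma fin_supp_mult2: "fin_supp g \<Longrightarrow> fin_supp (\<lambda>x. f x * g x)"
  unfolding fin_supp_def by (erule finite_subset[rotated]) auto

lemma fin_supp_power2: "fin_supp f \<Longrightarrow> fin_supp (\<lambda>x. (f x)\<^sup>2)"
  unfolding fin_supp_def by (erule finite_subset[rotated]) auto

lemma fin_supp_abs: "fin_supp f \<Longrightarrow> fin_supp (\<lambda>x. \<bar>f x\<bar>)"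
  unfolding fin_supp_def by (erule finite_subset[rotated]) auto

lemma fin_supp_divide: "fin_supp f \<Longrightarrow> fin_supp (\<lambda>x. f x / c)"
  unfolding fin_supp_def by (erule finite_subset[rotated]) auto

lemma fin_supp_shift:
  fixes a :: "'g::group_add"
  assumes "fin_supp f" shows "fin_supp (\<lambda>x. f (a + x))"
proof -
  have "{x. f (a + x) \<noteq> 0} = (\<lambda>x. - a + x) ` {x. f x \<noteq> 0}"
    by (force simp: image_iff add.assoc[symmetric] intro: exI[of _ "a + _"])
  then show ?thesis using assms unfolding fin_supp_def by simp
qed

lemma fin_supp_sum:
  assumes "\<And>s. s \<in> S \<Longrightarrow> fin_supp (f s)" shows "fin_supp (\<lambda>x. \<Sum>s\<in>S. f s x)"
  using assms
proof (induction S rule: infinite_finite_induct)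
  case (insert s S)
  then show ?case by (simp add: fin_supp_add)
qed (auto simp: fin_supp_def)

lemmas fin_supp_intros = fin_supp_add fin_supp_diff fin_supp_mult1 fin_supp_power2 fin_supp_shift
  fin_supp_sum fin_supp_divide fin_supp_abs

lemma infsum_left_shift:
  fixes a :: "'g::group_add" and f :: "'g \<Rightarrow> real"
  shows "infsum (\<lambda>x. f (a + x)) UNIV = infsum f UNIV"
proof (rule infsum_reindex_bij_betw)
  show "bij_betw ((+) a) UNIV UNIV"
    by (rule bij_betw_byWitness[where f' = "(+) (- a)"]) (auto simp: add.assoc[symmetric])
qed

lemma infsum_diff_fin_supp:
  assumes "fin_supp f" "fin_supp g"
  shows "infsum (\<lambda>x. f x - g x) UNIV = infsum f UNIV - infsum g UNIV"
proof -
  have "infsum (\<lambda>x. f x + (-1) * g x) UNIV = infsum f UNIV + infsum (\<lambda>x. (-1) * g x) UNIV"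
    by (intro infsum_add fin_supp_summable assms fin_supp_mult2)
  then show ?thesis by (simp add: infsum_uminus)
qed

lemma infsum_lincomb_fin_supp:
  assumes "fin_supp f" "fin_supp g"
  shows "infsum (\<lambda>x. a * f x + b * g x) UNIV = a * infsum f UNIV + b * infsum g UNIV"
  by (subst infsum_add)
    (auto intro!: fin_supp_summable fin_supp_mult2 assms simp: infsum_cmult_right')

lemma infsum_sum_fin_supp:
  assumes "finite S" "\<And>s. s \<in> S \<Longrightarrow> fin_supp (f s)"
  shows "infsum (\<lambda>x. \<Sum>s\<in>S. f s x) UNIV = (\<Sum>s\<in>S. infsum (f s) UNIV)"
  using assms
proof (induction S rule: finite_induct)
  case (insert s S)
  then show ?case
    by (simp add: infsum_add fin_supp_summable fin_supp_sum)
qed auto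

text \<open>Additivity is kept exact and only invariance is relaxed; the bounds place these set
  functions in a cube, which is compact in the product topology.\<close>

definition almost_invariant_means :: "'g::group_add set \<Rightarrow> real \<Rightarrow> ('g set \<Rightarrow> real) set" where
  "almost_invariant_means S \<delta> = {\<nu>. (\<forall>A. 0 \<le> \<nu> A \<and> \<nu> A \<le> 1) \<and> \<nu> UNIV = 1 \<and>
      (\<forall>A B. A \<inter> B = {} \<longrightarrow> \<nu> (A \<union> B) = \<nu> A + \<nu> B) \<and>
      (\<forall>s\<in>S. \<forall>A. \<bar>\<nu> ((\<lambda>h. s + h) ` A) - \<nu> A\<bar> \<le> \<delta>)}"

text \<open>Each condition involves finitely many values of the set function, and evaluation at a
  set is continuous in the product topology.\<close>

lemma closed_almost_invariant_means: "closed (almost_invariant_means S \<delta>)"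
proof -
  have ev: "continuous_on UNIV (\<lambda>\<nu>::'g set \<Rightarrow> real. \<nu> A)" for A
    by (rule continuous_on_product_coordinates)
  have "almost_invariant_means S \<delta> = (\<Inter>A. {\<nu>. 0 \<le> \<nu> A}) \<inter> (\<Inter>A. {\<nu>. \<nu> A \<le> 1}) \<inter> {\<nu>. \<nu> UNIV = 1} \<inter>
      (\<Inter>A. \<Inter>B\<in>{B. A \<inter> B = {}}. {\<nu>. \<nu> (A \<union> B) = \<nu> A + \<nu> B}) \<inter>
      (\<Inter>s\<in>S. \<Inter>A. {\<nu>. \<bar>\<nu> ((\<lambda>h. s + h) ` A) - \<nu> A\<bar> \<le> \<delta>})"
    unfolding almost_invariant_means_def by auto
  also have "closed \<dots>"
    by (intro closed_Int closed_INT ballI closed_Collect_le closed_Collect_eq continuous_intros ev)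
  finally show ?thesis .
qed

text \<open>Finite intersection property in the cube: finitely many requirements
  \<open>(S, \<delta>)\<close> follow from the one with the union of the sets and the least
  tolerance. A common point of all requirements has a defect below every positive number.\<close>

lemma amenable_groupI_almost_invariant_means:
  assumes "\<And>S \<delta>. finite S \<Longrightarrow> \<delta> > 0 \<Longrightarrow> almost_invariant_means S \<delta> \<noteq> ({} :: ('g::group_add set \<Rightarrow> real) set)"
  shows "amenable_group TYPE('g)"
proof -
  let ?I = "{(S, \<delta>). finite (S :: 'g set) \<and> \<delta> > (0::real)}"
  let ?C = "PiE (UNIV :: 'g set set) (\<lambda>_. {0..1::real})"
  have "compactin (product_topology (\<lambda>_. euclidean) (UNIV :: 'g set set)) ?C"
    unfolding compactin_PiE by auto
  then have comp: "compact ?C"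
    by (simp add: euclidean_product_topology)
  have "?C \<inter> (\<Inter>i\<in>?I. almost_invariant_means (fst i) (snd i)) \<noteq> {}"
  proof (rule compact_imp_fip_image[OF comp])
    fix i assume "i \<in> ?I"
    show "closed (almost_invariant_means (fst i) (snd i))"
      by (rule closed_almost_invariant_means)
  next
    fix I' assume I': "finite I'" "I' \<subseteq> ?I"
    \<comment> \<open>\<open>insert 1\<close> keeps the minimum defined and positive when
      \<open>I'\<close> is empty.\<close>
    let ?S = "\<Union>(fst ` I')" and ?d = "Min (insert 1 (snd ` I'))"
    have "finite ?S" "?d > 0" using I' by auto
    then obtain \<nu> where nu: "\<nu> \<in> almost_invariant_means ?S ?d" using assms by blast
    have "\<nu> \<in> almost_invariant_means (fst i) (snd i)" if "i \<in> I'" for i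
    proof -
      have "?d \<le> snd i" using I' that by (auto intro!: Min_le)
      moreover have "fst i \<subseteq> ?S" using that by auto
      ultimately have "\<forall>s\<in>fst i. \<forall>A. \<bar>\<nu> ((\<lambda>h. s + h) ` A) - \<nu> A\<bar> \<le> snd i"
        using nu unfolding almost_invariant_means_def mem_Collect_eq
        by (meson order_trans subsetD)
      then show ?thesis using nu unfolding almost_invariant_means_def by simp
    qed
    moreover have "\<nu> \<in> ?C" using nu unfolding almost_invariant_means_def by auto
    ultimately show "?C \<inter> (\<Inter>i\<in>I'. almost_invariant_means (fst i) (snd i)) \<noteq> {}" by blast
  qed
  then obtain \<nu> where "\<nu> \<in> (\<Inter>i\<in>?I. almost_invariant_means (fst i) (snd i))" by blast
  then have nu: "\<nu> \<in> almost_invariant_means S \<delta>" if "finite S" "\<delta> > 0" for S \<delta>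
    using that by (auto dest!: INT_D[of _ _ _ "(S, \<delta>)"])
  have "\<nu> ((\<lambda>h. g + h) ` A) = \<nu> A" for g A
  proof -
    have "\<bar>\<nu> ((\<lambda>h. g + h) ` A) - \<nu> A\<bar> \<le> \<delta>" if "\<delta> > 0" for \<delta>
      using nu[of "{g}" \<delta>] that unfolding almost_invariant_means_def by auto
    then have "\<bar>\<nu> ((\<lambda>h. g + h) ` A) - \<nu> A\<bar> \<le> 0" by (rule dense_ge)
    then show ?thesis by simp
  qed
  then show ?thesis
    using nu[of "{}" 1] unfolding almost_invariant_means_def amenable_group_def by auto
qed

text \<open>The square of a unit vector is a density. With \<open>u = f (s + x)\<close> and
  \<open>v = f x\<close>, densities differ by \<open>(u - v) * (u + v)\<close>; splitting this
  product into squares with weight \<open>\<delta>\<close> gives \<open>\<delta> / 2\<close> from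
  the first square and \<open>2 * \<delta>\<close> from the second, in total
  \<open>5 / 2 * \<delta>\<close>.\<close>

lemma l2_almost_invariant_mean:
  fixes f :: "'g::group_add \<Rightarrow> real"
  assumes f: "fin_supp f" "infsum (\<lambda>x. (f x)\<^sup>2) UNIV = 1" and "\<delta> > 0"
    and inv: "\<And>s. s \<in> S \<Longrightarrow> infsum (\<lambda>x. (f (s + x) - f x)\<^sup>2) UNIV \<le> \<delta>\<^sup>2"
  shows "(\<lambda>A. infsum (\<lambda>x. indicator A x * (f x)\<^sup>2) UNIV) \<in> almost_invariant_means S (5 / 2 * \<delta>)"
proof -
  let ?\<nu> = "\<lambda>A. infsum (\<lambda>x. indicator A x * (f x)\<^sup>2) UNIV"
  have fs: "fin_supp (\<lambda>x. indicator A x * (f x)\<^sup>2)" for A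
    by (intro fin_supp_mult2 fin_supp_power2 f)
  have "0 \<le> ?\<nu> A" for A by (intro infsum_nonneg) auto
  moreover have "?\<nu> A \<le> 1" for A
    unfolding f(2)[symmetric]
    by (intro infsum_mono fin_supp_summable fs fin_supp_power2 f) (auto split: split_indicator)
  moreover have "?\<nu> (A \<union> B) = ?\<nu> A + ?\<nu> B" if "A \<inter> B = {}" for A B
    by (subst infsum_add[symmetric])
      (use that in \<open>auto intro!: fin_supp_summable fs infsum_cong split: split_indicator\<close>)
  moreover have "\<bar>?\<nu> ((\<lambda>h. s + h) ` A) - ?\<nu> A\<bar> \<le> 5 / 2 * \<delta>" if s: "s \<in> S" for s A
  proof -
    have fsf: "fin_supp (\<lambda>x. f (s + x))" by (intro fin_supp_intros f)
    have ind: "indicator ((\<lambda>h. s + h) ` A) (s + x) = (indicator A x :: real)" for x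
      by (auto split: split_indicator)
    have "?\<nu> ((\<lambda>h. s + h) ` A) = infsum (\<lambda>x. indicator A x * (f (s + x))\<^sup>2) UNIV"
      by (subst infsum_left_shift[of _ s, symmetric]) (simp only: ind)
    then have "?\<nu> ((\<lambda>h. s + h) ` A) - ?\<nu> A = infsum (\<lambda>x. indicator A x * ((f (s + x))\<^sup>2 - (f x)\<^sup>2)) UNIV"
      by (simp add: right_diff_distrib) (intro infsum_diff_fin_supp[symmetric] fin_supp_mult2 fin_supp_power2 fsf f)
    also have "\<bar>\<dots>\<bar> \<le> infsum (\<lambda>x. \<bar>indicator A x * ((f (s + x))\<^sup>2 - (f x)\<^sup>2)\<bar>) UNIV"
      using norm_infsum_bound[of "\<lambda>x. indicator A x * ((f (s + x))\<^sup>2 - (f x)\<^sup>2)" UNIV]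
      by (simp add: fin_supp_summable[OF fin_supp_abs[OF fin_supp_mult2[OF fin_supp_diff]]] fin_supp_power2 fsf f
          abs_mult[symmetric])
    also have "\<dots> \<le> infsum (\<lambda>x. 1 / (2 * \<delta>) * (f (s + x) - f x)\<^sup>2 + \<delta> / 2 * (2 * (f (s + x))\<^sup>2 + 2 * (f x)\<^sup>2)) UNIV"
    proof (intro infsum_mono fin_supp_summable)
      fix x
      define u v where "u = f (s + x)" and "v = f x"
      \<comment> \<open>Weighted arithmetic-geometric inequality, used pointwise in place of
        Cauchy-Schwarz for the two sums.\<close>
      have "0 \<le> (\<bar>u - v\<bar> - \<delta> * \<bar>u + v\<bar>)\<^sup>2" by simp
      then have "2 * \<delta> * (\<bar>u - v\<bar> * \<bar>u + v\<bar>) \<le> (u - v)\<^sup>2 + \<delta>\<^sup>2 * (u + v)\<^sup>2"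
        by (simp add: power2_diff power_mult_distrib algebra_simps)
      also have "\<dots> \<le> (u - v)\<^sup>2 + \<delta>\<^sup>2 * (2 * u\<^sup>2 + 2 * v\<^sup>2)"
        by (intro add_left_mono mult_left_mono) (use sum_squares_bound[of u v] in \<open>auto simp: power2_sum\<close>)
      finally have "\<bar>u - v\<bar> * \<bar>u + v\<bar> \<le> 1 / (2 * \<delta>) * (u - v)\<^sup>2 + \<delta> / 2 * (2 * u\<^sup>2 + 2 * v\<^sup>2)"
        using \<open>\<delta> > 0\<close> by (simp add: field_simps power2_eq_square)
      moreover have "\<bar>u - v\<bar> * \<bar>u + v\<bar> = \<bar>u\<^sup>2 - v\<^sup>2\<bar>"
        by (simp add: abs_mult[symmetric] power2_eq_square algebra_simps)
      ultimately have "\<bar>u\<^sup>2 - v\<^sup>2\<bar> \<le> 1 / (2 * \<delta>) * (u - v)\<^sup>2 + \<delta> / 2 * (2 * u\<^sup>2 + 2 * v\<^sup>2)" by simp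
      moreover have "\<bar>indicator A x * (u\<^sup>2 - v\<^sup>2)\<bar> \<le> \<bar>u\<^sup>2 - v\<^sup>2\<bar>" by (auto split: split_indicator)
      ultimately show "\<bar>indicator A x * ((f (s + x))\<^sup>2 - (f x)\<^sup>2)\<bar>
          \<le> 1 / (2 * \<delta>) * (f (s + x) - f x)\<^sup>2 + \<delta> / 2 * (2 * (f (s + x))\<^sup>2 + 2 * (f x)\<^sup>2)"
        unfolding u_def v_def by linarith
    qed (intro fin_supp_mult2 fin_supp_intros f)+
    also have "\<dots> = 1 / (2 * \<delta>) * infsum (\<lambda>x. (f (s + x) - f x)\<^sup>2) UNIV
        + \<delta> / 2 * (2 * infsum (\<lambda>x. (f (s + x))\<^sup>2) UNIV + 2 * infsum (\<lambda>x. (f x)\<^sup>2) UNIV)"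
      by (simp only: infsum_lincomb_fin_supp fin_supp_power2 fin_supp_diff fin_supp_add fin_supp_mult2 fsf f)
    also have "infsum (\<lambda>x. (f (s + x))\<^sup>2) UNIV = 1"
      using infsum_left_shift[of "\<lambda>x. (f x)\<^sup>2" s] f(2) by simp
    also have "1 / (2 * \<delta>) * infsum (\<lambda>x. (f (s + x) - f x)\<^sup>2) UNIV \<le> 1 / (2 * \<delta>) * \<delta>\<^sup>2"
      using inv[OF s] \<open>\<delta> > 0\<close> by (intro mult_left_mono) auto
    finally show ?thesis using f(2) \<open>\<delta> > 0\<close> by (simp add: power2_eq_square field_simps)
  qed
  ultimately show ?thesis using f(2) unfolding almost_invariant_means_def by auto
qed

text \<open>By compactness some pair \<open>(S, \<delta>')\<close> admits no almost invariant mean,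
  so every unit vector is moved noticeably by some element of \<open>S\<close>. Homogeneity turns
  this into a quadratic inequality.\<close>

lemma nonamenable_l2_gap:
  assumes "\<not> amenable_group TYPE('g::group_add)"
  obtains S :: "'g::group_add set" and c :: real where "finite S" "S \<noteq> {}" "c > 0"
    "\<And>f. fin_supp f \<Longrightarrow> c * infsum (\<lambda>x. (f x)\<^sup>2) UNIV \<le> (\<Sum>s\<in>S. infsum (\<lambda>x. (f (s + x) - f x)\<^sup>2) UNIV)"
proof -
  obtain S :: "'g set" and \<delta>' :: real where S: "finite S" "\<delta>' > 0" "almost_invariant_means S \<delta>' = {}"
    using amenable_groupI_almost_invariant_means assms by blast
  \<comment> \<open>Undoes the factor 5 / 2 of \<open>l2_almost_invariant_mean\<close>.\<close>
  define \<delta> where "\<delta> = 2 / 5 * \<delta>'"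
  have \<delta>: "\<delta> > 0" "5 / 2 * \<delta> = \<delta>'" using S by (auto simp: \<delta>_def)
  have unit: "\<exists>s\<in>S. infsum (\<lambda>x. (f (s + x) - f x)\<^sup>2) UNIV > \<delta>\<^sup>2"
    if "fin_supp f" "infsum (\<lambda>x. (f x)\<^sup>2) UNIV = 1" for f :: "'g \<Rightarrow> real"
  proof (rule ccontr)
    assume "\<not> ?thesis"
    then have "infsum (\<lambda>x. (f (s + x) - f x)\<^sup>2) UNIV \<le> \<delta>\<^sup>2" if "s \<in> S" for s
      using that by (auto simp: not_less)
    from l2_almost_invariant_mean[OF that \<delta>(1) this, of S] S(3) \<delta>(2) show False by simp
  qed
  have gap: "\<delta>\<^sup>2 * infsum (\<lambda>x. (f x)\<^sup>2) UNIV \<le> (\<Sum>s\<in>S. infsum (\<lambda>x. (f (s + x) - f x)\<^sup>2) UNIV)"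
    if f: "fin_supp f" for f :: "'g \<Rightarrow> real"
  proof (cases "infsum (\<lambda>x. (f x)\<^sup>2) UNIV = 0")
    case True
    then show ?thesis by (simp add: sum_nonneg infsum_nonneg)
  next
    case False
    define N where "N = infsum (\<lambda>x. (f x)\<^sup>2) UNIV"
    have N: "N > 0" using False infsum_nonneg[of UNIV "\<lambda>x. (f x)\<^sup>2"] unfolding N_def by fastforce
    have sc: "infsum (\<lambda>x. (h x / sqrt N)\<^sup>2) UNIV = infsum (\<lambda>x. (h x)\<^sup>2) UNIV / N" for h :: "'g \<Rightarrow> real"
    proof -
      have "(\<lambda>x. (h x / sqrt N)\<^sup>2) = (\<lambda>x. inverse N * (h x)\<^sup>2)"
        using N by (auto simp: power_divide field_simps)
      then show ?thesis by (simp only: infsum_cmult_right') (simp add: field_simps)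
    qed
    obtain s where s: "s \<in> S" "infsum (\<lambda>x. (f (s + x) / sqrt N - f x / sqrt N)\<^sup>2) UNIV > \<delta>\<^sup>2"
      using unit[of "\<lambda>x. f x / sqrt N"] sc[of f] N f by (auto simp: fin_supp_divide N_def[symmetric])
    have "\<delta>\<^sup>2 < infsum (\<lambda>x. (f (s + x) - f x)\<^sup>2) UNIV / N"
      using s(2) sc[of "\<lambda>x. f (s + x) - f x"] by (simp add: diff_divide_distrib)
    then have "\<delta>\<^sup>2 * N \<le> infsum (\<lambda>x. (f (s + x) - f x)\<^sup>2) UNIV" using N by (simp add: field_simps)
    also have "\<dots> \<le> (\<Sum>s\<in>S. infsum (\<lambda>x. (f (s + x) - f x)\<^sup>2) UNIV)"
      using s S by (intro member_le_sum infsum_nonneg) auto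
    finally show ?thesis unfolding N_def .
  qed
  have "S \<noteq> {}"
  proof
    assume "S = {}"
    have "infsum (\<lambda>x. (indicator {0::'g} x :: real)\<^sup>2) UNIV = 1"
      by (subst infsum_cong_neutral[where T="{0}" and g="\<lambda>_. 1"]) auto
    moreover have "fin_supp (indicator {0::'g} :: 'g \<Rightarrow> real)" unfolding fin_supp_def by (simp add: indicator_def)
    ultimately show False using unit[of "indicator {0}"] \<open>S = {}\<close> by auto
  qed
  then show ?thesis using that[of S "\<delta>\<^sup>2"] S \<delta> gap by auto
qed

text \<open>Laziness turns a bound on the inner product of \<open>f\<close> with its average over \<open>S\<close> into a bound on the
  norm: no control of the spectrum near \<open>-1\<close> is needed.\<close>

definition lazy_step :: "'g::group_add set \<Rightarrow> ('g \<Rightarrow> real) \<Rightarrow> 'g \<Rightarrow> real" where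
  "lazy_step S f g = f g / 2 + (\<Sum>s\<in>S. f (s + g) + f (- s + g)) / (4 * real (card S))"

lemma fin_supp_lazy_step: "fin_supp f \<Longrightarrow> fin_supp (lazy_step S f)"
  unfolding lazy_step_def[abs_def] by (intro fin_supp_intros)

lemma lazy_step_contraction:
  assumes S: "finite S" "S \<noteq> {}" and f: "fin_supp f"
    and gap: "c * infsum (\<lambda>x. (f x)\<^sup>2) UNIV \<le> (\<Sum>s\<in>S. infsum (\<lambda>x. (f (s + x) - f x)\<^sup>2) UNIV)"
  shows "infsum (\<lambda>x. (lazy_step S f x)\<^sup>2) UNIV \<le> (1 - c / (4 * real (card S))) * infsum (\<lambda>x. (f x)\<^sup>2) UNIV"
proof -
  define n where "n = real (card S)"
  have n: "n > 0" using S by (auto simp: n_def card_gt_0_iff)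
  define N where "N = infsum (\<lambda>x. (f x)\<^sup>2) UNIV"
  \<comment> \<open>\<open>lazy_step S f\<close> is the mean of \<open>f\<close> and its symmetric
    average \<open>Q\<close>. In the expanded square, the gap bounds the cross term and convexity
    bounds the norm of \<open>Q\<close> by that of \<open>f\<close>; what is gained is
    \<open>1 / 2\<close> times \<open>c / (2 * n)\<close>.\<close>
  define Q where "Q x = (\<Sum>s\<in>S. f (s + x) + f (- s + x)) / (2 * n)" for x
  have fsQ: "fin_supp Q" unfolding Q_def[abs_def] by (intro fin_supp_intros f)
  have sh: "infsum (\<lambda>x. (f (a + x))\<^sup>2) UNIV = N" for a
    unfolding N_def by (rule infsum_left_shift[of "\<lambda>x. (f x)\<^sup>2"])
  have sh2: "infsum (\<lambda>x. f x * f (- s + x)) UNIV = infsum (\<lambda>x. f x * f (s + x)) UNIV" for s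
    by (subst infsum_left_shift[of _ s, symmetric]) (simp add: add.assoc[symmetric] mult.commute)
  have "infsum (\<lambda>x. (f (s + x) - f x)\<^sup>2) UNIV = 2 * N - 2 * infsum (\<lambda>x. f x * f (s + x)) UNIV" for s
  proof -
    have "infsum (\<lambda>x. (f (s + x) - f x)\<^sup>2) UNIV = infsum (\<lambda>x. ((f (s + x))\<^sup>2 + (f x)\<^sup>2) - 2 * (f x * f (s + x))) UNIV"
      by (intro infsum_cong) (simp add: power2_diff)
    also have "\<dots> = infsum (\<lambda>x. (f (s + x))\<^sup>2 + (f x)\<^sup>2) UNIV - infsum (\<lambda>x. 2 * (f x * f (s + x))) UNIV"
      by (intro infsum_diff_fin_supp fin_supp_add fin_supp_mult2 fin_supp_power2 fin_supp_mult1 fin_supp_shift f)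
    also have "infsum (\<lambda>x. (f (s + x))\<^sup>2 + (f x)\<^sup>2) UNIV = N + N"
      by (subst infsum_add) (auto intro!: fin_supp_summable fin_supp_intros f simp: sh N_def)
    finally show ?thesis by (simp add: infsum_cmult_right')
  qed
  then have "c * N \<le> (\<Sum>s\<in>S. 2 * N - 2 * infsum (\<lambda>x. f x * f (s + x)) UNIV)"
    using gap by (simp add: N_def)
  then have A: "(\<Sum>s\<in>S. infsum (\<lambda>x. f x * f (s + x)) UNIV) \<le> n * N - c / 2 * N"
    by (simp add: sum_subtractf n_def sum_distrib_left[symmetric])
  have "infsum (\<lambda>x. f x * Q x) UNIV = infsum (\<lambda>x. (1 / (2 * n)) * (\<Sum>s\<in>S. f x * f (s + x) + f x * f (- s + x))) UNIV"
    by (intro infsum_cong) (simp add: Q_def sum_distrib_left[symmetric] distrib_left[symmetric])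
  also have "\<dots> = (1 / (2 * n)) * (\<Sum>s\<in>S. infsum (\<lambda>x. f x * f (s + x) + f x * f (- s + x)) UNIV)"
    by (subst infsum_cmult_right', subst infsum_sum_fin_supp[OF S(1)]) (intro fin_supp_intros f, simp)
  also have "(\<Sum>s\<in>S. infsum (\<lambda>x. f x * f (s + x) + f x * f (- s + x)) UNIV)
     = (\<Sum>s\<in>S. 2 * infsum (\<lambda>x. f x * f (s + x)) UNIV)"
    by (intro sum.cong refl, subst infsum_add) (auto intro!: fin_supp_summable fin_supp_intros f simp: sh2)
  finally have B: "infsum (\<lambda>x. f x * Q x) UNIV \<le> N - c / (2 * n) * N"
    using A n by (simp add: sum_distrib_left[symmetric] field_simps)
  have Qsq: "(Q x)\<^sup>2 \<le> (\<Sum>s\<in>S. (f (s + x))\<^sup>2 + (f (- s + x))\<^sup>2) * (1 / (2 * n))" for x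
  proof -
    have "(\<Sum>s\<in>S. f (s + x) + f (- s + x))\<^sup>2 \<le> (\<Sum>s\<in>S. (f (s + x) + f (- s + x))\<^sup>2) * n"
      unfolding n_def by (rule sum_squared_le_sum_of_squares)
    also have "\<dots> \<le> (\<Sum>s\<in>S. 2 * ((f (s + x))\<^sup>2 + (f (- s + x))\<^sup>2)) * n"
    proof (intro mult_right_mono sum_mono)
      fix s
      show "(f (s + x) + f (- s + x))\<^sup>2 \<le> 2 * ((f (s + x))\<^sup>2 + (f (- s + x))\<^sup>2)"
        using sum_squares_bound[of "f (s + x)" "f (- s + x)"] by (simp add: power2_sum)
    qed (use n in simp)
    finally have "(\<Sum>s\<in>S. f (s + x) + f (- s + x))\<^sup>2 \<le> 2 * n * (\<Sum>s\<in>S. (f (s + x))\<^sup>2 + (f (- s + x))\<^sup>2)"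
      by (simp only: sum_distrib_left[symmetric]) (simp only: mult_ac)
    then show ?thesis using n by (simp add: Q_def power_divide field_simps power2_eq_square)
  qed
  have "infsum (\<lambda>x. (Q x)\<^sup>2) UNIV \<le> infsum (\<lambda>x. (\<Sum>s\<in>S. (f (s + x))\<^sup>2 + (f (- s + x))\<^sup>2) * (1 / (2 * n))) UNIV"
    by (intro infsum_mono Qsq fin_supp_summable fin_supp_intros fsQ f)
  also have "\<dots> = (\<Sum>s\<in>S. infsum (\<lambda>x. (f (s + x))\<^sup>2 + (f (- s + x))\<^sup>2) UNIV) * (1 / (2 * n))"
    by (subst infsum_cmult_left', subst infsum_sum_fin_supp[OF S(1)]) (intro fin_supp_intros f, simp)
  also have "\<dots> = N"
  proof -
    have "infsum (\<lambda>x. (f (s + x))\<^sup>2 + (f (- s + x))\<^sup>2) UNIV = 2 * N" for s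
      by (subst infsum_add) (auto intro!: fin_supp_summable fin_supp_intros f simp: sh)
    then show ?thesis using n by (simp add: n_def)
  qed
  finally have C: "infsum (\<lambda>x. (Q x)\<^sup>2) UNIV \<le> N" .
  have "infsum (\<lambda>x. (lazy_step S f x)\<^sup>2) UNIV = infsum (\<lambda>x. (1/4) * (f x)\<^sup>2 + ((1/2) * (f x * Q x) + (1/4) * (Q x)\<^sup>2)) UNIV"
    using n by (intro infsum_cong) (simp add: lazy_step_def Q_def n_def[symmetric] power2_eq_square field_simps)
  also have "\<dots> = infsum (\<lambda>x. (1/4) * (f x)\<^sup>2 + 1 * ((1/2) * (f x * Q x) + (1/4) * (Q x)\<^sup>2)) UNIV" by simp
  also have "\<dots> = (1/4) * N + 1 * ((1/2) * infsum (\<lambda>x. f x * Q x) UNIV + (1/4) * infsum (\<lambda>x. (Q x)\<^sup>2) UNIV)"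
    unfolding N_def
    by (simp only: infsum_lincomb_fin_supp fin_supp_power2 fin_supp_add fin_supp_mult2 fsQ f)
  also have "\<dots> = (1/4) * N + ((1/2) * infsum (\<lambda>x. f x * Q x) UNIV + (1/4) * infsum (\<lambda>x. (Q x)\<^sup>2) UNIV)" by simp
  also have "\<dots> \<le> (1/4) * N + ((1/2) * (N - c / (2 * n) * N) + (1/4) * N)"
    using B C by (intro add_mono mult_left_mono) auto
  also have "\<dots> = (1 - c / (4 * n)) * N" by (simp add: field_simps)
  finally show ?thesis unfolding N_def n_def .
qed

section \<open>Transition probabilities of the lazy walk\<close>

definition walk :: "'g::group_add set \<Rightarrow> nat \<Rightarrow> 'g \<Rightarrow> real" where
  "walk S k = (lazy_step S ^^ k) (indicator {0})"

lemma walk_0: "walk S 0 = indicator {0}"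
  by (simp add: walk_def)

lemma walk_Suc: "walk S (Suc k) = lazy_step S (walk S k)"
  by (simp add: walk_def)

lemma fin_supp_walk: "fin_supp (walk S k)"
proof (induction k)
  case 0
  then show ?case by (simp add: walk_0 fin_supp_def indicator_def)
qed (simp add: walk_Suc fin_supp_lazy_step)

lemma walk_nonneg: "0 \<le> walk S k g"
  by (induction k arbitrary: g) (auto simp: walk_0 walk_Suc lazy_step_def intro!: add_nonneg_nonneg divide_nonneg_nonneg sum_nonneg)

lemma nn_integral_left_shift:
  fixes a :: "'g::group_add"
  shows "(\<Sum>\<^sup>+x. f (a + x)) = (\<Sum>\<^sup>+x. f x)"
proof (rule nn_integral_bij_count_space)
  show "bij_betw ((+) a) UNIV UNIV"
    by (rule bij_betw_byWitness[where f' = "(+) (- a)"]) (auto simp: add.assoc[symmetric])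
qed

lemma nn_integral_uminus:
  fixes f :: "'g::group_add \<Rightarrow> ennreal"
  shows "(\<Sum>\<^sup>+x. f (- x)) = (\<Sum>\<^sup>+x. f x)"
proof (rule nn_integral_bij_count_space)
  show "bij_betw (uminus :: 'g \<Rightarrow> 'g) UNIV UNIV"
    by (rule bij_betw_byWitness[where f' = uminus]) auto
qed

lemma ennreal_lazy_step:
  assumes "\<And>g. 0 \<le> f g"
  shows "ennreal (lazy_step S f g) = ennreal (1/2) * ennreal (f g)
    + (\<Sum>s\<in>S. ennreal (1 / (4 * real (card S))) * ennreal (f (s + g)) + ennreal (1 / (4 * real (card S))) * ennreal (f (- s + g)))"
proof -
  have "lazy_step S f g = (1/2) * f g + (\<Sum>s\<in>S. (1 / (4 * real (card S))) * f (s + g) + (1 / (4 * real (card S))) * f (- s + g))"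
    by (simp add: lazy_step_def sum_divide_distrib add_divide_distrib)
  also have "ennreal \<dots> = ennreal ((1/2) * f g) + (\<Sum>s\<in>S. ennreal ((1 / (4 * real (card S))) * f (s + g)) + ennreal ((1 / (4 * real (card S))) * f (- s + g)))"
  proof -
    have *: "ennreal (a + (\<Sum>s\<in>S. b s + c s)) = ennreal a + (\<Sum>s\<in>S. ennreal (b s) + ennreal (c s))"
      if "0 \<le> a" "\<And>s. 0 \<le> b s" "\<And>s. 0 \<le> c s" for a b c
      using that by (simp add: sum_nonneg sum_ennreal[symmetric])
    show ?thesis by (rule *) (use assms in auto)
  qed
  finally show ?thesis using assms by (simp only: ennreal_mult divide_nonneg_nonneg zero_le_one zero_le_numeral mult_nonneg_nonneg of_nat_0_le_iff)
qed

text \<open>The lazy step is a symmetric operator: left translation moves it from \<open>f\<close>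
  to \<open>h\<close> and exchanges the shifts by \<open>s\<close> and \<open>- s\<close>.\<close>

lemma nn_integral_lazy_step:
  fixes h :: "'g::group_add \<Rightarrow> ennreal"
  assumes f: "\<And>g. 0 \<le> f g"
  shows "(\<Sum>\<^sup>+x. ennreal (lazy_step S f x) * h x) =
    ennreal (1/2) * (\<Sum>\<^sup>+x. ennreal (f x) * h x) +
    (\<Sum>s\<in>S. ennreal (1 / (4 * real (card S))) * (\<Sum>\<^sup>+x. ennreal (f x) * h (- s + x))
          + ennreal (1 / (4 * real (card S))) * (\<Sum>\<^sup>+x. ennreal (f x) * h (s + x)))"
proof -
  have "(\<Sum>\<^sup>+x. ennreal (f x) * h (- s + x)) = (\<Sum>\<^sup>+x. ennreal (f (s + x)) * h x)"
    "(\<Sum>\<^sup>+x. ennreal (f x) * h (s + x)) = (\<Sum>\<^sup>+x. ennreal (f (- s + x)) * h x)" for s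
    by (subst nn_integral_left_shift[of _ s, symmetric], simp add: add.assoc[symmetric])
       (subst nn_integral_left_shift[of _ "- s", symmetric], simp add: add.assoc[symmetric])
  then show ?thesis
    unfolding ennreal_lazy_step[OF f]
    by (simp add: distrib_right sum_distrib_right nn_integral_add nn_integral_sum nn_integral_cmult mult.assoc)
qed

lemma nn_integral_walk:
  fixes S :: "'g::group_add set"
  assumes S: "finite S" "S \<noteq> {}"
  shows "(\<Sum>\<^sup>+g. ennreal (walk S k g)) = 1"
proof (induction k)
  case 0
  then show ?case
    using nn_integral_indicator[of "{0::'g}" "count_space UNIV"] by (simp add: walk_0 ennreal_indicator)
next
  case (Suc k)
  have "ennreal (1/2) + of_nat (card S) * (ennreal (1 / (4 * real (card S))) + ennreal (1 / (4 * real (card S)))) = 1"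
  proof -
    have "ennreal (1/2) + of_nat (card S) * (ennreal (1 / (4 * real (card S))) + ennreal (1 / (4 * real (card S))))
      = ennreal (1/2 + real (card S) * (1 / (4 * real (card S)) + 1 / (4 * real (card S))))"
      by (simp only: ennreal_of_nat_eq_real_of_nat ennreal_mult ennreal_plus divide_nonneg_nonneg zero_le_one
          zero_le_numeral mult_nonneg_nonneg add_nonneg_nonneg of_nat_0_le_iff)
    also have "1/2 + real (card S) * (1 / (4 * real (card S)) + 1 / (4 * real (card S))) = 1"
      using S by (simp add: card_gt_0_iff field_simps)
    finally show ?thesis by simp
  qed
  then show ?case
    using nn_integral_lazy_step[where f = "walk S k" and h = "\<lambda>_. 1", OF walk_nonneg] Suc
    by (simp add: walk_Suc sum_distrib_left)
qed

text \<open>Chapman-Kolmogorov. In the induction, symmetry moves the outermost step onto the second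
  factor, where it becomes the same step in the variable \<open>g\<close>.\<close>

lemma walk_convolution:
  fixes g :: "'g::group_add"
  shows "(\<Sum>\<^sup>+h. ennreal (walk S k h) * ennreal (walk S l (- h + g))) = ennreal (walk S (k + l) g)"
proof (induction k arbitrary: g)
  case 0
  have "(\<Sum>\<^sup>+h. ennreal (walk S 0 h) * ennreal (walk S l (- h + g)))
      = (\<Sum>\<^sup>+(h::'g). ennreal (walk S l g) * indicator {0} h)"
    by (intro nn_integral_cong) (auto simp: walk_0 split: split_indicator)
  then show ?case by (simp add: nn_integral_cmult_indicator)
next
  case (Suc k)
  show ?case
    unfolding walk_Suc add_Suc
    apply (subst nn_integral_lazy_step[where f = "walk S k" and h = "\<lambda>h. ennreal (walk S l (- h + g))", OF walk_nonneg])
    apply (subst ennreal_lazy_step[OF walk_nonneg])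
    using Suc by (simp only: minus_add add.assoc minus_minus)
qed

lemma walk_1_uminus: "walk S 1 (- g) = walk S 1 g"
proof -
  have "indicator {0} (s + - g) = (indicator {0} (- s + g) :: real)"
    "indicator {0} (- s + - g) = (indicator {0} (s + g) :: real)" for s
    by (auto simp: indicator_def add_eq_0_iff neg_eq_iff_add_eq_0 minus_equation_iff[of s])
  then show ?thesis
    by (simp add: walk_Suc walk_0 lazy_step_def add.commute) (simp add: indicator_def)
qed

text \<open>Splitting off the first step on one side and the last step on the other, that is,
  comparing \<open>1 + k\<close> with \<open>k + 1\<close>, passes the symmetry from one step to
  all.\<close>

lemma walk_uminus: "walk S k (- g) = walk S k g"
proof (induction k arbitrary: g)
  case 0
  then show ?case by (simp add: walk_0 indicator_def)
next
  case (Suc k)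
  have "ennreal (walk S (Suc k) (- g)) = (\<Sum>\<^sup>+h. ennreal (walk S 1 h) * ennreal (walk S k (- h + - g)))"
    using walk_convolution[of S 1 k "- g"] by simp
  also have "\<dots> = (\<Sum>\<^sup>+h. ennreal (walk S k (g + h)) * ennreal (walk S 1 h))"
  proof (intro nn_integral_cong)
    fix h show "ennreal (walk S 1 h) * ennreal (walk S k (- h + - g)) = ennreal (walk S k (g + h)) * ennreal (walk S 1 h)"
      using Suc[of "g + h"] by (simp only: minus_add mult.commute)
  qed
  also have "\<dots> = (\<Sum>\<^sup>+h. ennreal (walk S k h) * ennreal (walk S 1 (- g + h)))"
    by (subst nn_integral_left_shift[of _ g, symmetric]) (simp add: add.assoc[symmetric])
  also have "\<dots> = (\<Sum>\<^sup>+h. ennreal (walk S k h) * ennreal (walk S 1 (- h + g)))"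
    using walk_1_uminus[of S "- _ + g"] by (simp add: minus_add)
  also have "\<dots> = ennreal (walk S (Suc k) g)"
    using walk_convolution[of S k 1 g] by simp
  finally show ?case using walk_nonneg by (metis ennreal_inj)
qed

text \<open>A transition probability is at most the l2 norm of \<open>walk S k\<close>, and the
  squared norm shrinks by the factor \<open>r\<close> at each step; hence the rate
  \<open>sqrt r\<close>.\<close>

theorem nonamenable_walk:
  assumes "\<not> amenable_group TYPE('g::group_add)"
  obtains p :: "nat \<Rightarrow> 'g::group_add \<Rightarrow> real" and \<rho> :: real where "0 < \<rho>" "\<rho> < 1"
    "\<And>k g. 0 \<le> p k g" "\<And>k g. p k g \<le> \<rho> ^ k" "\<And>k g. p k (- g) = p k g"
    "\<And>k. (\<Sum>\<^sup>+g. ennreal (p k g)) = 1"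
    "\<And>k l g. (\<Sum>\<^sup>+h. ennreal (p k h) * ennreal (p l (- h + g))) = ennreal (p (k + l) g)"
proof -
  obtain S :: "'g set" and c where S: "finite S" "S \<noteq> {}" "c > 0"
    and gap: "\<And>f. fin_supp f \<Longrightarrow> c * infsum (\<lambda>x. (f x)\<^sup>2) UNIV \<le> (\<Sum>s\<in>S. infsum (\<lambda>x. (f (s + x) - f x)\<^sup>2) UNIV)"
    by (rule nonamenable_l2_gap[OF assms]) blast
  \<comment> \<open>The maximum with \<open>1/2\<close> ensures \<open>r > 0\<close> whatever the
    size of \<open>c\<close>.\<close>
  define r where "r = max (1/2) (1 - c / (4 * real (card S)))"
  have r: "0 < r" "r < 1" using S by (auto simp: r_def card_gt_0_iff)
  have norm: "infsum (\<lambda>x. (walk S k x)\<^sup>2) UNIV \<le> r ^ k" for k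
  proof (induction k)
    case 0
    have "infsum (\<lambda>x::'g. (walk S 0 x)\<^sup>2) UNIV = 1"
      by (subst infsum_cong_neutral[where T="{0}" and g="\<lambda>_. 1"]) (auto simp: walk_0)
    then show ?case by simp
  next
    case (Suc k)
    have nn: "0 \<le> infsum (\<lambda>x. (walk S k x)\<^sup>2) UNIV" by (rule infsum_nonneg) simp
    have "infsum (\<lambda>x. (walk S (Suc k) x)\<^sup>2) UNIV \<le> (1 - c / (4 * real (card S))) * infsum (\<lambda>x. (walk S k x)\<^sup>2) UNIV"
      unfolding walk_Suc by (rule lazy_step_contraction[OF S(1,2) fin_supp_walk gap[OF fin_supp_walk]])
    also have "\<dots> \<le> r * infsum (\<lambda>x. (walk S k x)\<^sup>2) UNIV"
      by (intro mult_right_mono nn) (simp add: r_def)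
    also have "\<dots> \<le> r * r ^ k" using Suc r by (intro mult_left_mono) auto
    finally show ?case by simp
  qed
  have bound: "walk S k g \<le> sqrt r ^ k" for k g
  proof -
    have "(walk S k g)\<^sup>2 = infsum (\<lambda>x. (walk S k x)\<^sup>2) {g}" by simp
    also have "\<dots> \<le> infsum (\<lambda>x. (walk S k x)\<^sup>2) UNIV"
      by (intro infsum_mono2 fin_supp_summable fin_supp_intros fin_supp_walk) auto
    also have "\<dots> \<le> r ^ k" by (rule norm)
    also have "\<dots> = (sqrt r ^ k)\<^sup>2" using r by (metis less_imp_le power_mult mult.commute real_sqrt_pow2)
    finally show ?thesis using r by (intro power2_le_imp_le[of "walk S k g" "sqrt r ^ k"]) auto
  qed
  show ?thesis
    by (rule that[of "sqrt r" "walk S"]) (use r bound walk_nonneg walk_uminus nn_integral_walk[OF S(1,2)] walk_convolution in auto)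
qed

section \<open>Independent fields and mixing of the shift\<close>

text \<open>The sets with limit 0 form a Dynkin system, since domination by a multiple of the
  measure gives dominated convergence along disjoint unions. Applied to one argument at a time, this
  extends mixing and the later coupling from cylinders to all events.\<close>

lemma set_function_tendsto_0:
  fixes \<phi> :: "'i \<Rightarrow> 'a set \<Rightarrow> real"
  assumes M: "finite_measure M" and E: "Int_stable E" "E \<subseteq> Pow (space M)" "sets M = sigma_sets (space M) E"
    and add: "\<And>i A. disjoint_family A \<Longrightarrow> range A \<subseteq> sets M \<Longrightarrow> (\<lambda>n. \<phi> i (A n)) sums \<phi> i (\<Union>n. A n)"
    and bd: "\<And>i B. B \<in> sets M \<Longrightarrow> \<bar>\<phi> i B\<bar> \<le> K * measure M B"
    and sp: "((\<lambda>i. \<phi> i (space M)) \<longlongrightarrow> 0) F" and gen: "\<And>B. B \<in> E \<Longrightarrow> ((\<lambda>i. \<phi> i B) \<longlongrightarrow> 0) F"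
    and B: "B \<in> sets M"
  shows "((\<lambda>i. \<phi> i B) \<longlongrightarrow> 0) F"
proof (cases "F = bot")
  case False
  interpret finite_measure M by fact
  have B': "B \<in> sigma_sets (space M) E" using B E(3) by simp
  have emp: "\<phi> i {} = 0" for i using bd[of "{}" i] by simp
  show ?thesis
  proof (rule sigma_sets_induct_disjoint[OF E(1,2) B'])
    fix A assume "A \<in> sigma_sets (space M) E" and lim: "((\<lambda>i. \<phi> i A) \<longlongrightarrow> 0) F"
    then have A: "A \<in> sets M" using E(3) by simp
    have "\<phi> i (space M - A) = \<phi> i (space M) - \<phi> i A" for i
    proof -
      have "(\<lambda>n. \<phi> i (binaryset A (space M - A) n)) sums \<phi> i (\<Union>n. binaryset A (space M - A) n)"
        using A by (intro add) (auto simp: disjoint_family_on_def binaryset_def)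
      moreover have "(\<lambda>n. \<phi> i (binaryset A (space M - A) n)) sums (\<phi> i A + \<phi> i (space M - A))"
        by (rule binaryset_sums) (rule emp)
      moreover have "(\<Union>n. binaryset A (space M - A) n) = space M"
        using sets.sets_into_space[OF A] by (auto simp: UN_binaryset_eq)
      ultimately show ?thesis by (metis sums_unique2 add_diff_cancel_left')
    qed
    then show "((\<lambda>i. \<phi> i (space M - A)) \<longlongrightarrow> 0) F"
      using tendsto_diff[OF sp lim] by simp
  next
    fix A :: "nat \<Rightarrow> 'a set"
    assume dis: "disjoint_family A" and "range A \<subseteq> sigma_sets (space M) E"
      and lim: "\<And>n. ((\<lambda>i. \<phi> i (A n)) \<longlongrightarrow> 0) F"
    then have A: "range A \<subseteq> sets M" using E(3) by simp
    have "summable (\<lambda>n. K * measure M (A n))"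
      by (intro summable_mult sums_summable[OF finite_measure_UNION[OF A dis]])
    then have "((\<lambda>i. \<Sum>n. \<phi> i (A n)) \<longlongrightarrow> (\<Sum>n. 0)) F"
      using lim A bd by (intro conjunct2[OF conjunct2[OF tannerys_theorem[where M = "\<lambda>n. K * measure M (A n)"]]])
        (auto intro!: always_eventually False)
    then show "((\<lambda>i. \<phi> i (\<Union>n. A n)) \<longlongrightarrow> 0) F"
      using sums_unique[OF add[OF dis A]] by simp
  qed (use gen emp in auto)
qed simp

text \<open>Independence of disjoint sets of coordinates is used in the form that \<open>mix S\<close> of two independent
  fields is again a field with the same law (\<open>distr_mix\<close>).\<close>

definition mix :: "'i set \<Rightarrow> ('i \<Rightarrow> 'v) \<Rightarrow> ('i \<Rightarrow> 'v) \<Rightarrow> 'i \<Rightarrow> 'v" where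
  "mix S \<omega> \<omega>' i = (if i \<in> S then \<omega> i else \<omega>' i)"

definition depends_on :: "'i set \<Rightarrow> ('i \<Rightarrow> 'v) set \<Rightarrow> bool" where
  "depends_on S A \<longleftrightarrow> (\<forall>\<omega> \<omega>'. (\<forall>i\<in>S. \<omega> i = \<omega>' i) \<longrightarrow> \<omega> \<in> A \<longleftrightarrow> \<omega>' \<in> A)"

definition cyl :: "'i set \<Rightarrow> ('i \<Rightarrow> 'v set) \<Rightarrow> ('i \<Rightarrow> 'v) set" where
  "cyl J F = {\<omega>. \<forall>j\<in>J. \<omega> j \<in> F j}"

lemma depends_on_mono: "depends_on S A \<Longrightarrow> S \<subseteq> T \<Longrightarrow> depends_on T A"
  unfolding depends_on_def by blast

lemma depends_on_Int: "depends_on S A \<Longrightarrow> depends_on S B \<Longrightarrow> depends_on S (A \<inter> B)"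
  unfolding depends_on_def by blast

lemma depends_on_Compl: "depends_on S A \<Longrightarrow> depends_on S (- A)"
  unfolding depends_on_def by blast

lemma depends_on_cyl: "depends_on J (cyl J F)"
  unfolding depends_on_def cyl_def by simp

lemma depends_on_mix: "depends_on S A \<Longrightarrow> mix S \<omega> \<omega>' \<in> A \<longleftrightarrow> \<omega> \<in> A"
  unfolding depends_on_def mix_def by simp

lemma depends_on_mix2: "depends_on T A \<Longrightarrow> S \<inter> T = {} \<Longrightarrow> mix S \<omega> \<omega>' \<in> A \<longleftrightarrow> \<omega>' \<in> A"
proof -
  assume A: "depends_on T A" and disj: "S \<inter> T = {}"
  have "\<forall>i\<in>T. mix S \<omega> \<omega>' i = \<omega>' i" using disj by (auto simp: mix_def)
  then show ?thesis using A unfolding depends_on_def by blast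
qed

text \<open>\<open>space V = UNIV\<close> makes every total function a point of the product space,
  so fields can be spliced and shifted without side conditions.\<close>

locale iid_space = prob_space V for V :: "'v measure" +
  fixes P :: "('i \<Rightarrow> 'v) measure"
  assumes space_V[simp]: "space V = UNIV" and P_def: "P = PiM UNIV (\<lambda>_. V)"
begin

sublocale product: product_prob_space "\<lambda>_. V" "UNIV :: 'i set" ..

sublocale P: prob_space P
  unfolding P_def by (rule prob_space_PiM) unfold_locales

sublocale PP: pair_prob_space P P ..

lemma space_P[simp]: "space P = UNIV"
  by (simp add: P_def space_PiM)

lemma prod_emb_eq_cyl: "prod_emb UNIV (\<lambda>_. V) J (Pi\<^sub>E J F) = cyl J F"
  by (auto simp: prod_emb_def cyl_def PiE_iff)

lemma sets_cyl: "finite J \<Longrightarrow> (\<And>j. j \<in> J \<Longrightarrow> F j \<in> sets V) \<Longrightarrow> cyl J F \<in> sets P"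
  unfolding prod_emb_eq_cyl[symmetric] P_def by (rule sets_PiM_I) auto

lemma emeasure_cyl:
  "finite J \<Longrightarrow> (\<And>j. j \<in> J \<Longrightarrow> F j \<in> sets V) \<Longrightarrow> emeasure P (cyl J F) = (\<Prod>j\<in>J. emeasure V (F j))"
  unfolding prod_emb_eq_cyl[symmetric] P_def by (rule product.emeasure_PiM_emb) auto

lemma measure_cyl:
  "finite J \<Longrightarrow> (\<And>j. j \<in> J \<Longrightarrow> F j \<in> sets V) \<Longrightarrow> measure P (cyl J F) = (\<Prod>j\<in>J. measure V (F j))"
  unfolding prod_emb_eq_cyl[symmetric] P_def by (rule product.measure_PiM_emb) auto

lemma P_eqI:
  assumes "sets M' = sets P"
    "\<And>J F. finite J \<Longrightarrow> (\<And>j. j \<in> J \<Longrightarrow> F j \<in> sets V) \<Longrightarrow> emeasure M' (cyl J F) = (\<Prod>j\<in>J. emeasure V (F j))"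
  shows "M' = P"
  unfolding P_def by (rule product.PiM_eq) (use assms in \<open>auto simp: P_def prod_emb_eq_cyl\<close>)

definition cylinders :: "('i \<Rightarrow> 'v) set set" where
  "cylinders = {cyl J F |J F. finite J \<and> (\<forall>j\<in>J. F j \<in> sets V)}"

lemma cylinders_eq: "cylinders = prod_algebra UNIV (\<lambda>_. V)"
proof
  have "cyl J F \<in> prod_algebra UNIV (\<lambda>_. V)" if "finite J" "\<forall>j\<in>J. F j \<in> sets V" for J :: "'i set" and F
  proof (cases "J = {}")
    case True
    \<comment> \<open>Over a nonempty index set \<open>prod_algebraI\<close> asks for a nonempty
      \<open>J\<close>, so the whole space is written as a cylinder over an arbitrary
      coordinate.\<close>
    have "cyl J F = cyl {undefined} (\<lambda>_. UNIV)" using True by (simp add: cyl_def)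
    moreover have "UNIV \<in> sets V" using sets.top[of V] by simp
    ultimately show ?thesis unfolding prod_emb_eq_cyl[symmetric]
      by (auto intro!: prod_algebraI)
  next
    case False
    then show ?thesis using that unfolding prod_emb_eq_cyl[symmetric] by (intro prod_algebraI) auto
  qed
  then show "cylinders \<subseteq> prod_algebra UNIV (\<lambda>_. V)" unfolding cylinders_def by blast
  show "prod_algebra UNIV (\<lambda>_. V) \<subseteq> cylinders"
  proof
    fix A :: "('i \<Rightarrow> 'v) set" assume "A \<in> prod_algebra UNIV (\<lambda>_. V)"
    then obtain J F where "A = prod_emb UNIV (\<lambda>_. V) J (Pi\<^sub>E J F)" "finite J" "\<And>i. i \<in> J \<Longrightarrow> F i \<in> sets V"
      by (rule prod_algebraE) blast
    then show "A \<in> cylinders" unfolding prod_emb_eq_cyl cylinders_def by blast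
  qed
qed

lemma Int_stable_cylinders: "Int_stable cylinders"
  unfolding cylinders_eq by (rule Int_stable_prod_algebra)

lemma sets_P_cylinders: "sets P = sigma_sets (space P) cylinders"
  unfolding cylinders_eq by (simp add: P_def sets_PiM space_PiM)

lemma measurable_into_P: "(\<And>i. (\<lambda>x. f x i) \<in> N \<rightarrow>\<^sub>M V) \<Longrightarrow> f \<in> N \<rightarrow>\<^sub>M P"
  unfolding P_def by (rule measurable_abs_UNIV)

lemma measurable_coord[measurable]: "(\<lambda>\<omega>. \<omega> i) \<in> P \<rightarrow>\<^sub>M V"
  unfolding P_def by (rule measurable_component_singleton) simp

lemma measurable_mix[measurable]: "(\<lambda>x. mix S (fst x) (snd x)) \<in> P \<Otimes>\<^sub>M P \<rightarrow>\<^sub>M P"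
  by (rule measurable_into_P) (simp add: mix_def)

lemma measurable_mix2[measurable]: "(\<lambda>\<omega>. mix S \<omega> \<omega>') \<in> P \<rightarrow>\<^sub>M P"
  by (rule measurable_into_P) (simp add: mix_def)

lemma distr_mix: "distr (P \<Otimes>\<^sub>M P) P (\<lambda>x. mix S (fst x) (snd x)) = P"
proof (rule P_eqI)
  fix J :: "'i set" and F assume J: "finite J" and F: "\<And>j. j \<in> J \<Longrightarrow> F j \<in> sets V"
  have "emeasure (distr (P \<Otimes>\<^sub>M P) P (\<lambda>x. mix S (fst x) (snd x))) (cyl J F)
     = emeasure (P \<Otimes>\<^sub>M P) (cyl (J \<inter> S) F \<times> cyl (J - S) F)"
    using sets_cyl[OF J F]
    by (subst emeasure_distr) (auto simp: space_pair_measure mix_def cyl_def intro!: arg_cong[where f="emeasure _"])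
  also have "\<dots> = emeasure P (cyl (J \<inter> S) F) * emeasure P (cyl (J - S) F)"
    using J F by (intro P.emeasure_pair_measure_Times sets_cyl) auto
  also have "\<dots> = (\<Prod>j\<in>J \<inter> S. emeasure V (F j)) * (\<Prod>j\<in>J - S. emeasure V (F j))"
    using J F by (subst (1 2) emeasure_cyl) auto
  also have "\<dots> = (\<Prod>j\<in>J. emeasure V (F j))"
    using J by (subst prod.union_disjoint[symmetric]) (auto intro!: prod.cong)
  finally show "emeasure (distr (P \<Otimes>\<^sub>M P) P (\<lambda>x. mix S (fst x) (snd x))) (cyl J F) = (\<Prod>j\<in>J. emeasure V (F j))" .
qed simp

lemma measure_mix:
  assumes "A \<in> sets P"
  shows "measure P A = measure (P \<Otimes>\<^sub>M P) {x. mix S (fst x) (snd x) \<in> A}"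
  by (subst (1) distr_mix[of S, symmetric], subst measure_distr)
    (use assms in \<open>auto simp: space_pair_measure vimage_def\<close>)

lemma measure_pair_Times: "A \<in> sets P \<Longrightarrow> B \<in> sets P \<Longrightarrow> measure (P \<Otimes>\<^sub>M P) (A \<times> B) = measure P A * measure P B"
  using P.emeasure_pair_measure_Times[of A P B]
  by (simp add: P.emeasure_eq_measure PP.emeasure_eq_measure ennreal_mult[symmetric])

text \<open>\<open>mix S\<close> turns the intersection into the rectangle
  \<open>A \<times> B\<close>: \<open>A\<close> reads only the first copy and \<open>B\<close> only
  the second.\<close>

lemma depends_on_indep:
  assumes "A \<in> sets P" "B \<in> sets P" "depends_on S A" "depends_on T B" "S \<inter> T = {}"
  shows "measure P (A \<inter> B) = measure P A * measure P B"
proof -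
  have "{x. mix S (fst x) (snd x) \<in> A \<inter> B} = A \<times> B"
    using depends_on_mix[OF assms(3)] depends_on_mix2[OF assms(4,5)] by auto
  then show ?thesis
    using measure_mix[of "A \<inter> B" S] measure_pair_Times[of A B] assms by simp
qed

end

text \<open>The slot index stays in place. \<open>sft (- g) \<omega>\<close> is the field viewed
  from \<open>g\<close>, so \<open>sft (- g) \<omega> \<in> B\<close> says that \<open>B\<close>
  happens at the vertex \<open>g\<close>.\<close>

definition sft :: "'g::group_add \<Rightarrow> ('g \<times> 'k \<Rightarrow> 'v) \<Rightarrow> 'g \<times> 'k \<Rightarrow> 'v" where
  "sft l \<omega> = (\<lambda>(v, k). \<omega> (- l + v, k))"

lemma sft_apply: "sft l \<omega> (v, k) = \<omega> (- l + v, k)"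
  by (simp add: sft_def)

lemma sft_sft: "sft a (sft b \<omega>) = sft (a + b) \<omega>"
  by (auto simp: sft_def fun_eq_iff minus_add add.assoc[symmetric])

lemma sft_0[simp]: "sft 0 \<omega> = \<omega>"
  by (auto simp: sft_def fun_eq_iff)

lemma depends_on_sft:
  "depends_on S A \<Longrightarrow> depends_on ((\<lambda>(v, k). (- l + v, k)) ` S) {\<omega>. sft l \<omega> \<in> A}"
  unfolding depends_on_def
proof (intro allI impI)
  fix \<omega> \<omega>' :: "'a \<times> 'b \<Rightarrow> 'c"
  assume A: "\<forall>\<omega> \<omega>'. (\<forall>i\<in>S. \<omega> i = \<omega>' i) \<longrightarrow> (\<omega> \<in> A) = (\<omega>' \<in> A)"
    and eq: "\<forall>i\<in>(\<lambda>(v, k). (- l + v, k)) ` S. \<omega> i = \<omega>' i"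
  have "\<forall>i\<in>S. sft l \<omega> i = sft l \<omega>' i" using eq by (auto simp: sft_def)
  then show "(\<omega> \<in> {\<omega>. sft l \<omega> \<in> A}) = (\<omega>' \<in> {\<omega>. sft l \<omega> \<in> A})" using A by simp
qed

locale iid_action = iid_space V P for V :: "'v measure" and P :: "('g::{countable,group_add} \<times> 'k \<Rightarrow> 'v) measure"
begin

lemma measurable_sft[measurable]: "sft l \<in> P \<rightarrow>\<^sub>M P"
proof (rule measurable_into_P)
  fix i show "(\<lambda>\<omega>. sft l \<omega> i) \<in> P \<rightarrow>\<^sub>M V" by (cases i) (simp add: sft_apply)
qed

lemma distr_sft: "distr P P (sft l) = P"
proof -
  have "inj (\<lambda>(v :: 'g, k :: 'k). (- l + v, k))" by (auto simp: inj_on_def)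
  then have "distr (Pi\<^sub>M UNIV (\<lambda>_. V)) (\<Pi>\<^sub>M i\<in>UNIV. V) (\<lambda>\<omega>. \<lambda>n\<in>UNIV. \<omega> ((\<lambda>(v, k). (- l + v, k :: 'k)) n)) = (\<Pi>\<^sub>M i\<in>UNIV. V)"
    by (intro distr_PiM_reindex) (auto intro: prob_space_axioms)
  moreover have "(\<lambda>\<omega> :: 'g \<times> 'k \<Rightarrow> 'v. \<lambda>n\<in>UNIV. \<omega> ((\<lambda>(v, k). (- l + v, k :: 'k)) n)) = sft l"
    by (auto simp: fun_eq_iff sft_def)
  ultimately show ?thesis unfolding P_def by (simp only:)
qed

lemma sets_sft[measurable]: "A \<in> sets P \<Longrightarrow> {\<omega>. sft l \<omega> \<in> A} \<in> sets P"
  using measurable_sets[OF measurable_sft, of A l] by (simp add: vimage_def)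

lemma measure_sft: "A \<in> sets P \<Longrightarrow> measure P {\<omega>. sft l \<omega> \<in> A} = measure P A"
  by (subst (2) distr_sft[of l, symmetric], subst measure_distr) (auto simp: vimage_def)

lemma AE_sft:
  assumes "AE \<omega> in P. Q \<omega>" shows "AE \<omega> in P. \<forall>l. Q (sft l \<omega>)"
proof (subst AE_all_countable, rule allI)
  fix l
  have "AE \<omega> in distr P P (sft l). Q \<omega>" unfolding distr_sft by (rule assms)
  then show "AE \<omega> in P. Q (sft l \<omega>)" by (rule AE_distrD[OF measurable_sft])
qed

lemma cyl_disjoint_shift:
  assumes "finite I" "finite J"
  obtains G :: "'g set" where "finite G" "\<And>g. g \<notin> G \<Longrightarrow> I \<inter> (\<lambda>(v, k). (g + v, k)) ` J = {}"
proof -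
  have "g \<in> (\<lambda>(u, v). u - v) ` (fst ` I \<times> fst ` J)" if "I \<inter> (\<lambda>(v, k). (g + v, k)) ` J \<noteq> {}" for g
    using that by (force simp: image_iff)
  then show ?thesis using assms
    by (intro that[of "(\<lambda>(u, v). u - v) ` (fst ` I \<times> fst ` J)"]) (blast intro: finite_imageI finite_cartesian_product)+
qed

text \<open>Cylinders are exactly independent unless \<open>g\<close> is one of the finitely many
  differences of their base vertices; \<open>set_function_tendsto_0\<close>, applied in each
  argument, removes the restriction to cylinders.\<close>

lemma mixing:
  assumes A: "A \<in> sets P" and B: "B \<in> sets P"
  shows "((\<lambda>g. measure P (A \<inter> {\<omega>. sft (- g) \<omega> \<in> B})) \<longlongrightarrow> measure P A * measure P B) cofinite"
proof -
  define \<phi> where "\<phi> A B g = measure P (A \<inter> {\<omega>. sft (- g) \<omega> \<in> B}) - measure P A * measure P B" for A B g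
  have bd1: "\<bar>\<phi> A B g\<bar> \<le> 1 * measure P A" and bd2: "\<bar>\<phi> A B g\<bar> \<le> 1 * measure P B"
    if "A \<in> sets P" "B \<in> sets P" for A B g
  proof -
    have "measure P (A \<inter> {\<omega>. sft (- g) \<omega> \<in> B}) \<le> measure P A"
      using that by (intro P.finite_measure_mono) auto
    moreover have "measure P (A \<inter> {\<omega>. sft (- g) \<omega> \<in> B}) \<le> measure P {\<omega>. sft (- g) \<omega> \<in> B}"
      using that by (intro P.finite_measure_mono) auto
    moreover have "measure P A * measure P B \<le> measure P A * 1" "measure P A * measure P B \<le> 1 * measure P B"
      by (intro mult_left_mono mult_right_mono; simp)+
    ultimately show "\<bar>\<phi> A B g\<bar> \<le> 1 * measure P A" "\<bar>\<phi> A B g\<bar> \<le> 1 * measure P B"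
      using measure_sft[OF that(2), of "- g"] mult_nonneg_nonneg[OF measure_nonneg measure_nonneg, of P A P B]
        measure_nonneg[of P "A \<inter> {\<omega>. sft (- g) \<omega> \<in> B}"]
      unfolding \<phi>_def by linarith+
  qed
  have add1: "(\<lambda>n. \<phi> (A n) B g) sums \<phi> (\<Union>n. A n) B g"
    if "disjoint_family A" "range A \<subseteq> sets P" "B \<in> sets P" for A B g
  proof -
    have "(\<lambda>n. measure P (A n \<inter> {\<omega>. sft (- g) \<omega> \<in> B})) sums measure P (\<Union>n. A n \<inter> {\<omega>. sft (- g) \<omega> \<in> B})"
      using that by (intro P.finite_measure_UNION) (auto simp: disjoint_family_on_def)
    then show ?thesis unfolding \<phi>_def
      using that by (intro sums_diff sums_mult2 P.finite_measure_UNION) auto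
  qed
  have add2: "(\<lambda>n. \<phi> A (B n) g) sums \<phi> A (\<Union>n. B n) g"
    if "disjoint_family B" "range B \<subseteq> sets P" "A \<in> sets P" for A B g
  proof -
    have "(\<lambda>n. measure P (A \<inter> {\<omega>. sft (- g) \<omega> \<in> B n})) sums measure P (\<Union>n. A \<inter> {\<omega>. sft (- g) \<omega> \<in> B n})"
      using that by (intro P.finite_measure_UNION) (auto simp: disjoint_family_on_def)
    moreover have "(\<Union>n. A \<inter> {\<omega>. sft (- g) \<omega> \<in> B n}) = A \<inter> {\<omega>. sft (- g) \<omega> \<in> (\<Union>n. B n)}" by auto
    ultimately show ?thesis unfolding \<phi>_def
      using that by (intro sums_diff sums_mult P.finite_measure_UNION) auto
  qed
  have UN: "\<phi> UNIV B g = 0" "\<phi> B UNIV g = 0" if "B \<in> sets P" for B g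
    using that measure_sft[of B "- g"] P.prob_space by (auto simp: \<phi>_def)
  have UN': "((\<lambda>g. \<phi> UNIV B g) \<longlongrightarrow> 0) cofinite" "((\<lambda>g. \<phi> B UNIV g) \<longlongrightarrow> 0) cofinite" if "B \<in> sets P" for B
    using UN[OF that] by (auto intro!: tendsto_eventually)
  have cyl0: "((\<lambda>g. \<phi> A B g) \<longlongrightarrow> 0) cofinite" if AB: "A \<in> cylinders" "B \<in> cylinders" for A B
  proof -
    obtain I F J F' where I: "A = cyl I F" "finite I" "\<forall>j\<in>I. F j \<in> sets V" and J: "B = cyl J F'" "finite J" "\<forall>j\<in>J. F' j \<in> sets V"
      using AB unfolding cylinders_def by blast
    obtain G where G: "finite G" "\<And>g. g \<notin> G \<Longrightarrow> I \<inter> (\<lambda>(v, k). (g + v, k)) ` J = {}"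
      using cyl_disjoint_shift[OF I(2) J(2)] by blast
    have "\<phi> A B g = 0" if "g \<notin> G" for g
    proof -
      have AB: "A \<in> sets P" "B \<in> sets P" using I J by (auto intro: sets_cyl)
      have "depends_on ((\<lambda>(v, k). (g + v, k)) ` J) {\<omega>. sft (- g) \<omega> \<in> B}"
        using depends_on_sft[OF depends_on_cyl, of "- g" J F'] J(1) by simp
      then have "measure P (A \<inter> {\<omega>. sft (- g) \<omega> \<in> B}) = measure P A * measure P {\<omega>. sft (- g) \<omega> \<in> B}"
        using G(2)[OF that] AB I(1) depends_on_cyl by (intro depends_on_indep) auto
      then show ?thesis using measure_sft[OF AB(2)] by (simp add: \<phi>_def)
    qed
    then have "eventually (\<lambda>g. \<phi> A B g = 0) cofinite"
      using G(1) by (auto simp: eventually_cofinite intro: finite_subset[of _ G])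
    then show ?thesis by (rule tendsto_eventually)
  qed
  have sub: "cylinders \<subseteq> Pow (space P)" "cylinders \<subseteq> sets P" by (auto simp: cylinders_def intro: sets_cyl)
  have fin: "finite_measure P" by (rule P.finite_measure_axioms)
  have step: "((\<lambda>g. \<phi> A B g) \<longlongrightarrow> 0) cofinite" if "A \<in> sets P" "B \<in> cylinders" for A B
    by (rule set_function_tendsto_0[OF fin Int_stable_cylinders sub(1) sets_P_cylinders, where \<phi> = "\<lambda>g A. \<phi> A B g" and K = 1])
      (use that sub add1 bd1 cyl0 UN' in \<open>auto simp del: mult_1\<close>)
  have "((\<lambda>g. \<phi> A B g) \<longlongrightarrow> 0) cofinite"
    by (rule set_function_tendsto_0[OF fin Int_stable_cylinders sub(1) sets_P_cylinders, where \<phi> = "\<lambda>g B. \<phi> A B g" and K = 1])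
      (use assms sub add2 bd2 step UN' in \<open>auto simp del: mult_1\<close>)
  then show ?thesis unfolding \<phi>_def by (simp add: LIM_zero_iff)
qed

end

section \<open>Forests, greedy matchings and trails\<close>

definition conn :: "('a \<times> 'a) set \<Rightarrow> ('a \<times> 'a) set" where
  "conn R = (R \<union> R\<inverse>)\<^sup>*"

text \<open>Every edge is a bridge; this also forbids loops and pairs of opposite edges.\<close>

definition forest :: "('a \<times> 'a) set \<Rightarrow> bool" where
  "forest H \<longleftrightarrow> (\<forall>u v. (u, v) \<in> H \<longrightarrow> (u, v) \<notin> conn (H - {(u, v)}))"

lemma conn_refl[simp]: "(x, x) \<in> conn R"
  by (simp add: conn_def)

lemma conn_edge: "(x, y) \<in> R \<Longrightarrow> (x, y) \<in> conn R"
  by (auto simp: conn_def)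

lemma conn_sym: "(x, y) \<in> conn R \<Longrightarrow> (y, x) \<in> conn R"
proof -
  have "sym ((R \<union> R\<inverse>)\<^sup>*)" by (intro sym_rtrancl) (auto simp: sym_def)
  then show "(x, y) \<in> conn R \<Longrightarrow> (y, x) \<in> conn R" unfolding conn_def by (rule symD)
qed

lemma conn_trans: "(x, y) \<in> conn R \<Longrightarrow> (y, z) \<in> conn R \<Longrightarrow> (x, z) \<in> conn R"
  unfolding conn_def by (rule rtrancl_trans)

lemma conn_mono: "(x, y) \<in> conn R \<Longrightarrow> R \<subseteq> S \<Longrightarrow> (x, y) \<in> conn S"
  unfolding conn_def using rtrancl_mono[of "R \<union> R\<inverse>" "S \<union> S\<inverse>"] by blast

lemma conn_insert:
  assumes "(x, y) \<in> conn (insert (a, b) R)"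
  shows "(x, y) \<in> conn R \<or> (x, a) \<in> conn R \<and> (b, y) \<in> conn R \<or> (x, b) \<in> conn R \<and> (a, y) \<in> conn R"
  using assms unfolding conn_def[of "insert (a, b) R"]
proof (induction rule: rtrancl_induct)
  case (step y z)
  then consider "(y, z) \<in> R \<or> (z, y) \<in> R" | "y = a" "z = b" | "y = b" "z = a" by auto
  then show ?case
  proof cases
    case 1
    then have "(y, z) \<in> conn R" using conn_edge conn_sym by fast
    then show ?thesis using step.IH conn_trans by fast
  next
    case 2
    then show ?thesis using step.IH by auto
  next
    case 3
    then show ?thesis using step.IH by auto
  qed
qed simp

lemma conn_finite_subset:
  assumes "(x, y) \<in> conn (R \<union> B)"
  obtains B' where "finite B'" "B' \<subseteq> B" "(x, y) \<in> conn (R \<union> B')"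
proof -
  have "\<exists>B'. finite B' \<and> B' \<subseteq> B \<and> (x, y) \<in> conn (R \<union> B')"
    using assms unfolding conn_def[of "R \<union> B"]
  proof (induction rule: rtrancl_induct)
    case base
    show ?case by (rule exI[of _ "{}"]) simp
  next
    case (step y z)
    then obtain B' where B': "finite B'" "B' \<subseteq> B" "(x, y) \<in> conn (R \<union> B')" by blast
    let ?B = "B' \<union> (B \<inter> {(y, z), (z, y)})"
    have "(y, z) \<in> conn (R \<union> ?B)"
      using step(2) by (auto intro: conn_edge conn_sym[OF conn_edge])
    moreover have "(x, y) \<in> conn (R \<union> ?B)" by (rule conn_mono[OF B'(3)]) auto
    ultimately have "(x, z) \<in> conn (R \<union> ?B)" by (rule conn_trans[rotated])
    then show ?case using B' by (intro exI[of _ ?B]) auto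
  qed
  then show ?thesis using that by blast
qed

text \<open>An edge of \<open>A\<close> lies on no cycle even when all of \<open>E\<close> is
  present. A new cycle through an edge of \<open>H\<close> would use edges of \<open>A\<close>;
  adding these one at a time, the one that completes the cycle would have its ends joined by the
  rest of it.\<close>

lemma forest_extend:
  assumes H: "forest H" and disj: "A \<inter> H = {}" and sub: "A \<subseteq> E"
    and acc: "\<And>u v. (u, v) \<in> A \<Longrightarrow> (u, v) \<notin> conn ((H \<union> E) - {(u, v)})"
  shows "forest (H \<union> A)"
  unfolding forest_def
proof (intro allI impI notI)
  fix u v assume uv: "(u, v) \<in> H \<union> A" and c: "(u, v) \<in> conn (H \<union> A - {(u, v)})"
  show False
  proof (cases "(u, v) \<in> A")
    case True
    have "(u, v) \<in> conn ((H \<union> E) - {(u, v)})" by (rule conn_mono[OF c]) (use sub in auto)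
    then show False using acc[OF True] by simp
  next
    case False
    then have uvH: "(u, v) \<in> H" using uv by simp
    have "H \<union> A - {(u, v)} = (H - {(u, v)}) \<union> A" using False by auto
    then obtain A' where A': "finite A'" "A' \<subseteq> A" "(u, v) \<in> conn ((H - {(u, v)}) \<union> A')"
      using c conn_finite_subset by metis
    have "(u, v) \<notin> conn ((H - {(u, v)}) \<union> A')" using A'(1,2)
    proof (induction A' rule: finite_induct)
      case empty
      then show ?case using H uvH unfolding forest_def by auto
    next
      case (insert f A')
      obtain a b where f: "f = (a, b)" by (cases f)
      let ?K = "(H - {(u, v)}) \<union> A'"
      show ?case
      proof
        assume "(u, v) \<in> conn (H - {(u, v)} \<union> insert f A')"
        then have "(u, v) \<in> conn (insert (a, b) ?K)" by (simp add: f)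
        moreover have "(u, v) \<notin> conn ?K" using insert by simp
        ultimately have *: "(u, a) \<in> conn ?K \<and> (b, v) \<in> conn ?K \<or> (u, b) \<in> conn ?K \<and> (a, v) \<in> conn ?K"
          using conn_insert by metis
        have sub': "insert (u, v) ?K \<subseteq> (H \<union> E) - {(a, b)}"
          using insert disj sub uvH f by auto
        have uv': "(u, v) \<in> conn (insert (u, v) ?K)" by (rule conn_edge) simp
        have up: "(p, q) \<in> conn (insert (u, v) ?K)" if "(p, q) \<in> conn ?K" for p q
          by (rule conn_mono[OF that]) auto
        have "(a, b) \<in> conn (insert (u, v) ?K)"
          using *
        proof (elim disjE conjE)
          assume "(u, a) \<in> conn ?K" "(b, v) \<in> conn ?K"
          then show ?thesis
            by (intro conn_trans[OF conn_trans[OF conn_sym[OF up] uv'] conn_sym[OF up]])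
        next
          assume "(u, b) \<in> conn ?K" "(a, v) \<in> conn ?K"
          then show ?thesis
            by (intro conn_trans[OF conn_trans[OF up conn_sym[OF uv']] up])
        qed
        then have "(a, b) \<in> conn ((H \<union> E) - {(a, b)})" using sub' by (rule conn_mono)
        then show False using acc[of a b] insert(4) f by simp
      qed
    qed
    then show False using A' by simp
  qed
qed

lemma conn_chain:
  assumes "\<And>n. R n \<subseteq> R (Suc n)" "(x, y) \<in> conn (\<Union>n. R n :: ('a \<times> 'a) set)"
  shows "\<exists>n. (x, y) \<in> conn (R n)"
  using assms(2) unfolding conn_def[of "\<Union>n. R n"]
proof (induction rule: rtrancl_induct)
  case (step y z)
  obtain n m where "(x, y) \<in> conn (R n)" "(y, z) \<in> R m \<or> (z, y) \<in> R m" using step by auto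
  moreover have "R n \<subseteq> R (max n m)" "R m \<subseteq> R (max n m)"
    using lift_Suc_mono_le[of R] assms(1) by auto
  ultimately have "(x, y) \<in> conn (R (max n m))" "(y, z) \<in> conn (R (max n m))"
    by (auto intro: conn_mono conn_edge conn_sym[OF conn_edge])
  then show ?case using conn_trans by fast
qed simp

lemma conn_avoid:
  assumes "(x, y) \<in> conn R" "(x, z) \<notin> conn R"
  shows "(x, y) \<in> conn (R \<inter> {(a, b). a \<noteq> z \<and> b \<noteq> z})"
  using assms(1) unfolding conn_def[of R]
proof (induction rule: rtrancl_induct)
  case (step y y')
  have "(x, y) \<in> conn R" "(x, y') \<in> conn R"
    using step(1,2) unfolding conn_def by (auto intro: rtrancl_into_rtrancl)
  then have "y \<noteq> z" "y' \<noteq> z" using assms(2) by auto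
  then have "(y, y') \<in> conn (R \<inter> {(a, b). a \<noteq> z \<and> b \<noteq> z})"
    using step(2) by (auto intro: conn_edge conn_sym[OF conn_edge])
  then show ?case using step.IH conn_trans by fast
qed simp

section \<open>The greedy matching\<close>

definition edges_at :: "('s::countable \<Rightarrow> 'g::group_add) \<Rightarrow> ('g \<times> 's) set \<Rightarrow> nat \<Rightarrow> ('g \<times> 'g) set" where
  "edges_at el W n = {(u, v). \<exists>s. to_nat s = n \<and> v = u + el s \<and> (u, s) \<in> W}"

text \<open>Time \<open>n\<close> belongs to the at most one slot \<open>s\<close> with \<open>to_nat s = n\<close>. All edges proposed then have
  the same increment \<open>el s\<close>, so they never compete for an endpoint; an edge is rejected only if an
  endpoint is taken or if it would close a cycle, possibly together with other edges proposed at
  time \<open>n\<close>.\<close>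

definition accepted where
  "accepted el W H M n = {(u, v) \<in> edges_at el W n. u \<notin> Domain M \<and> v \<notin> Range M \<and>
      (u, v) \<notin> H \<union> M \<and> (u, v) \<notin> conn (H \<union> M \<union> edges_at el W n - {(u, v)})}"

primrec matching where
  "matching el W H 0 = {}"
| "matching el W H (Suc n) = matching el W H n \<union> accepted el W H (matching el W H n) n"

definition matching_lim where
  "matching_lim el W H = (\<Union>n. matching el W H n)"

lemma matching_mono: "m \<le> n \<Longrightarrow> matching el W H m \<subseteq> matching el W H n"
  by (rule lift_Suc_mono_le[of "matching el W H"]) auto

lemma matching_edges: "(u, v) \<in> matching el W H n \<Longrightarrow> \<exists>s. to_nat s < n \<and> v = u + el s \<and> (u, s) \<in> W"
proof (induction n)
  case (Suc n)
  then show ?case by (auto simp: accepted_def edges_at_def less_Suc_eq)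
qed simp

lemma matching_lim_edges: "(u, v) \<in> matching_lim el W H \<Longrightarrow> \<exists>s. v = u + el s \<and> (u, s) \<in> W"
  unfolding matching_lim_def using matching_edges by fast

lemma matching_functional:
  "(u, v) \<in> matching el W H n \<Longrightarrow> (u, v') \<in> matching el W H n \<Longrightarrow> v = v'"
  "(u, v) \<in> matching el W H n \<Longrightarrow> (u', v) \<in> matching el W H n \<Longrightarrow> u = u'"
proof (induction n)
  case (Suc n)
  {
    case 1
    then show ?case using Suc(1) by (auto simp: accepted_def edges_at_def Domain_iff)
  next
    case 2
    then show ?case using Suc(2) by (auto simp: accepted_def edges_at_def Range_iff)
  }
qed auto

lemma matching_lim_functional:
  "(u, v) \<in> matching_lim el W H \<Longrightarrow> (u, v') \<in> matching_lim el W H \<Longrightarrow> v = v'"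
  "(u, v) \<in> matching_lim el W H \<Longrightarrow> (u', v) \<in> matching_lim el W H \<Longrightarrow> u = u'"
proof -
  have *: "\<exists>k. p \<in> matching el W H k \<and> q \<in> matching el W H k"
    if pq: "p \<in> matching_lim el W H" "q \<in> matching_lim el W H" for p q
  proof -
    obtain m n where "p \<in> matching el W H m" "q \<in> matching el W H n"
      using pq unfolding matching_lim_def by blast
    then show ?thesis
      using matching_mono[of m "max m n" el W H] matching_mono[of n "max m n" el W H] by auto
  qed
  show "(u, v) \<in> matching_lim el W H \<Longrightarrow> (u, v') \<in> matching_lim el W H \<Longrightarrow> v = v'"
    using * matching_functional(1) by metis
  show "(u, v) \<in> matching_lim el W H \<Longrightarrow> (u', v) \<in> matching_lim el W H \<Longrightarrow> u = u'"
    using * matching_functional(2) by metis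
qed

lemma matching_disjoint: "matching el W H n \<inter> H = {}"
  by (induction n) (auto simp: accepted_def)

lemma matching_lim_disjoint: "matching_lim el W H \<inter> H = {}"
  using matching_disjoint unfolding matching_lim_def by blast

lemma forest_matching: "forest H \<Longrightarrow> forest (H \<union> matching el W H n)"
proof (induction n)
  case (Suc n)
  let ?M = "matching el W H n"
  have "forest (H \<union> ?M \<union> accepted el W H ?M n)"
    by (rule forest_extend[OF Suc.IH[OF Suc.prems], where E = "edges_at el W n"]) (auto simp: accepted_def)
  then show ?case by (simp add: Un_assoc)
qed simp

lemma forest_matching_lim:
  assumes "forest H" shows "forest (H \<union> matching_lim el W H)"
  unfolding forest_def
proof (intro allI impI notI)
  fix u v assume uv: "(u, v) \<in> H \<union> matching_lim el W H"
    and c: "(u, v) \<in> conn (H \<union> matching_lim el W H - {(u, v)})"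
  let ?R = "\<lambda>n. H \<union> matching el W H n - {(u, v)}"
  have "H \<union> matching_lim el W H - {(u, v)} = (\<Union>n. ?R n)" by (auto simp: matching_lim_def)
  then obtain n where n: "(u, v) \<in> conn (?R n)" using c conn_chain[of ?R u v] by auto
  obtain m where m: "(u, v) \<in> H \<union> matching el W H m" using uv by (auto simp: matching_lim_def)
  have "matching el W H n \<subseteq> matching el W H (max n m)" "matching el W H m \<subseteq> matching el W H (max n m)"
    by (auto intro!: matching_mono)
  then have "(u, v) \<in> conn (?R (max n m))" "(u, v) \<in> H \<union> matching el W H (max n m)"
    using m by (auto intro: conn_mono[OF n])
  then show False using forest_matching[OF assms, of el W "max n m"] unfolding forest_def by blast
qed

text \<open>Adaptedness: the state before time \<open>n\<close> reads earlier slots only, which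
  later makes it independent of the coins of time \<open>n\<close>.\<close>

lemma matching_cong:
  assumes "\<And>v s. to_nat s < n \<Longrightarrow> (v, s) \<in> W \<longleftrightarrow> (v, s) \<in> W'"
  shows "matching el W H n = matching el W' H n"
  using assms
proof (induction n)
  case (Suc n)
  have "edges_at el W n = edges_at el W' n" using Suc.prems by (auto simp: edges_at_def)
  moreover have "matching el W H n = matching el W' H n" using Suc by simp
  ultimately show ?case by (simp add: accepted_def)
qed simp

definition translate :: "'g::group_add \<Rightarrow> ('g \<times> 'g) set \<Rightarrow> ('g \<times> 'g) set" where
  "translate l X = {(u, v). (- l + u, - l + v) \<in> X}"

lemma conn_translate: "conn (translate l R) = translate l (conn R)"
proof -
  have *: "(l + u, l + v) \<in> conn (translate l R)" if "(u, v) \<in> conn R" for u v l and R :: "('a::group_add \<times> 'a) set"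
    using that unfolding conn_def[of R]
  proof (induction rule: rtrancl_induct)
    case (step y z)
    have "(l + y, l + z) \<in> conn (translate l R)"
      using step(2) by (auto simp: translate_def add.assoc[symmetric] intro: conn_edge conn_sym[OF conn_edge])
    then show ?case using step.IH conn_trans by fast
  qed simp
  have tr: "translate (- l) (translate l R) = R" by (auto simp: translate_def add.assoc[symmetric])
  show ?thesis
  proof (intro set_eqI iffI; clarify)
    fix u v assume "(u, v) \<in> conn (translate l R)"
    then have "(- l + u, - l + v) \<in> conn R" using *[of u v "translate l R" "- l"] tr by simp
    then show "(u, v) \<in> translate l (conn R)" by (simp add: translate_def)
  next
    fix u v assume "(u, v) \<in> translate l (conn R)"
    then have "(- l + u, - l + v) \<in> conn R" by (simp add: translate_def)
    from *[OF this, of l] show "(u, v) \<in> conn (translate l R)" by (simp add: add.assoc[symmetric])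
  qed
qed

lemma mem_translate: "(u, v) \<in> translate l X \<longleftrightarrow> (- l + u, - l + v) \<in> X"
  by (simp add: translate_def)

lemma Domain_translate: "u \<in> Domain (translate l X) \<longleftrightarrow> - l + u \<in> Domain X"
  by (auto simp: translate_def Domain_iff) (metis add.assoc add.left_neutral left_minus)

lemma Range_translate: "u \<in> Range (translate l X) \<longleftrightarrow> - l + u \<in> Range X"
  by (auto simp: translate_def Range_iff) (metis add.assoc add.left_neutral left_minus)

lemma edges_at_translate:
  "edges_at el {(v, s). (- l + v, s) \<in> W} n = translate l (edges_at el W n)"
  by (auto simp: edges_at_def translate_def add.assoc)

text \<open>Edges are right translations, which commute with the left translation by
  \<open>l\<close>, and the order of decisions refers to slots but never to vertices.\<close>

lemma matching_translate:
  "matching el {(v, s). (- l + v, s) \<in> W} (translate l H) n = translate l (matching el W H n)"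
proof (induction n)
  case 0
  show ?case by (simp add: translate_def)
next
  case (Suc n)
  let ?M = "matching el W H n"
  have eq: "translate l X \<union> translate l Y \<union> translate l Z - {(u, v)} = translate l (X \<union> Y \<union> Z - {(- l + u, - l + v)})"
    for X Y Z u v by (auto simp: translate_def)
  have "accepted el {(v, s). (- l + v, s) \<in> W} (translate l H) (translate l ?M) n = translate l (accepted el W H ?M n)"
    unfolding accepted_def edges_at_translate eq conn_translate
    by (auto simp: mem_translate Domain_translate Range_translate)
  then show ?case using Suc by (auto simp: translate_def)
qed

lemma matching_lim_translate:
  "matching_lim el {(v, s). (- l + v, s) \<in> W} (translate l H) = translate l (matching_lim el W H)"
  unfolding matching_lim_def matching_translate by (auto simp: translate_def)

text \<open>A step \<open>(k, True)\<close> follows an edge proposed by slot \<open>k\<close>, and \<open>(k, False)\<close> follows one backwards;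
  \<open>src\<close> is the coordinate on which the presence of that edge depends.\<close>

fun nxt :: "('k \<Rightarrow> 'g::group_add) \<Rightarrow> 'g \<Rightarrow> 'k \<times> bool \<Rightarrow> 'g" where
  "nxt el x (k, True) = x + el k"
| "nxt el x (k, False) = x - el k"

fun src :: "('k \<Rightarrow> 'g::group_add) \<Rightarrow> 'g \<Rightarrow> 'k \<times> bool \<Rightarrow> 'g \<times> 'k" where
  "src el x (k, True) = (x, k)"
| "src el x (k, False) = (x - el k, k)"

fun endp :: "('k \<Rightarrow> 'g::group_add) \<Rightarrow> 'g \<Rightarrow> ('k \<times> bool) list \<Rightarrow> 'g" where
  "endp el x [] = x"
| "endp el x (l # \<gamma>) = endp el (nxt el x l) \<gamma>"

fun coords :: "('k \<Rightarrow> 'g::group_add) \<Rightarrow> 'g \<Rightarrow> ('k \<times> bool) list \<Rightarrow> ('g \<times> 'k) list" where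
  "coords el x [] = []"
| "coords el x (l # \<gamma>) = src el x l # coords el (nxt el x l) \<gamma>"

fun verts :: "('k \<Rightarrow> 'g::group_add) \<Rightarrow> 'g \<Rightarrow> ('k \<times> bool) list \<Rightarrow> 'g list" where
  "verts el x [] = [x]"
| "verts el x (l # \<gamma>) = x # verts el (nxt el x l) \<gamma>"

lemma src_ends: "src el x l = (v, k) \<Longrightarrow> {v, v + el k} = {x, nxt el x l}"
  by (cases l; cases "snd l") auto

lemma hd_verts: "x \<in> set (verts el x \<gamma>)"
  by (cases \<gamma>) auto

lemma coords_verts: "(v, k) \<in> set (coords el x \<gamma>) \<Longrightarrow> v \<in> set (verts el x \<gamma>) \<and> v + el k \<in> set (verts el x \<gamma>)"
proof (induction \<gamma> arbitrary: x)
  case (Cons l \<gamma>)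
  show ?case
  proof (cases "(v, k) = src el x l")
    case True
    then have "{v, v + el k} = {x, nxt el x l}" using src_ends by metis
    then show ?thesis using hd_verts[of "nxt el x l" el \<gamma>] by (auto simp: doubleton_eq_iff)
  qed (use Cons in auto)
qed simp

text \<open>A repeated coordinate would bring back both ends of its edge, among them the current
  vertex. Distinctness is what makes the probability of a trail a product.\<close>

lemma distinct_coords: "distinct (verts el x \<gamma>) \<Longrightarrow> distinct (coords el x \<gamma>)"
proof (induction \<gamma> arbitrary: x)
  case (Cons l \<gamma>)
  obtain v k where vk: "src el x l = (v, k)" by (cases "src el x l")
  have "src el x l \<notin> set (coords el (nxt el x l) \<gamma>)"
  proof
    assume "src el x l \<in> set (coords el (nxt el x l) \<gamma>)"
    then have "{v, v + el k} \<subseteq> set (verts el (nxt el x l) \<gamma>)" using coords_verts vk by fastforce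
    then show False using src_ends[OF vk] Cons.prems by auto
  qed
  then show ?case using Cons by simp
qed simp

text \<open>Loop erasure: if a trail returns to \<open>x\<close>, its part from there on serves as a
  trail from \<open>x\<close>.\<close>

lemma trail_suffix:
  "x \<in> set (verts el y \<gamma>) \<Longrightarrow> distinct (verts el y \<gamma>) \<Longrightarrow>
    \<exists>\<gamma>'. endp el x \<gamma>' = endp el y \<gamma> \<and> distinct (verts el x \<gamma>') \<and> set (coords el x \<gamma>') \<subseteq> set (coords el y \<gamma>)"
proof (induction \<gamma> arbitrary: y)
  case Nil
  then show ?case by (intro exI[of _ "[]"]) auto
next
  case (Cons l \<gamma>)
  show ?case
  proof (cases "x = y")
    case True
    then show ?thesis using Cons.prems by (intro exI[of _ "l # \<gamma>"]) auto
  next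
    case False
    then obtain \<gamma>' where "endp el x \<gamma>' = endp el (nxt el y l) \<gamma>" "distinct (verts el x \<gamma>')"
      "set (coords el x \<gamma>') \<subseteq> set (coords el (nxt el y l) \<gamma>)"
      using Cons.IH[of "nxt el y l"] Cons.prems by auto
    then show ?thesis by (intro exI[of _ \<gamma>']) auto
  qed
qed

text \<open>Edges are prepended one by one and loops erased at once. This converts connectedness
  into an event on finitely many distinct coins, ready for a union bound.\<close>

lemma trail_exists:
  assumes "(x, y) \<in> conn R" and R: "\<And>u v. (u, v) \<in> R \<Longrightarrow> \<exists>k. v = u + el k \<and> (u, k) \<in> W"
  obtains \<gamma> where "endp el x \<gamma> = y" "distinct (coords el x \<gamma>)" "set (coords el x \<gamma>) \<subseteq> W"
proof -
  have "\<exists>\<gamma>. endp el x \<gamma> = y \<and> distinct (verts el x \<gamma>) \<and> set (coords el x \<gamma>) \<subseteq> W"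
    using assms(1) unfolding conn_def
  proof (induction rule: converse_rtrancl_induct)
    case base
    show ?case by (rule exI[of _ "[]"]) simp
  next
    case (step x x')
    then obtain \<gamma> where \<gamma>: "endp el x' \<gamma> = y" "distinct (verts el x' \<gamma>)" "set (coords el x' \<gamma>) \<subseteq> W" by blast
    obtain l where l: "nxt el x l = x'" "src el x l \<in> W"
    proof (cases "(x, x') \<in> R")
      case True
      then obtain k where "x' = x + el k" "(x, k) \<in> W" using R by blast
      then show ?thesis using that[of "(k, True)"] by simp
    next
      case False
      then have "(x', x) \<in> R" using step by auto
      then obtain k where "x = x' + el k" "(x', k) \<in> W" using R by blast
      then show ?thesis using that[of "(k, False)"] by simp
    qed
    show ?case
    proof (cases "x \<in> set (verts el x' \<gamma>)")
      case True
      from trail_suffix[OF this \<gamma>(2)] show ?thesis using \<gamma> by auto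
    next
      case False
      then show ?thesis using \<gamma> l by (intro exI[of _ "l # \<gamma>"]) auto
    qed
  qed
  then show ?thesis using that distinct_coords by blast
qed

text \<open>Read as a path in the forest, a reduced word never backtracks, and such a path cannot
  close up when every edge is a bridge.\<close>

lemma reduced_word_acts_freely:
  assumes f: "bij f" and g: "bij g" and forest: "forest ({(v, f v) |v. True} \<union> {(v, g v) |v. True})"
    and disj: "\<And>v. f v \<noteq> g v" and w: "reduced_word w" "w \<noteq> []"
  shows "word_act UNIV f g w v \<noteq> v"
proof -
  define H where "H = {(v, f v) |v. True} \<union> {(v, g v) |v. True}"
  define fn where "fn l = (if fst l then f else g)" for l :: f2_letter
  \<comment> \<open>The edge that the letter \<open>l\<close> crosses from \<open>y\<close>, always
    oriented from a vertex to its image; an inverse letter crosses it backwards.\<close>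
  define e where "e l y = (if snd l then (y, fn l y) else (inv (fn l) y, y))" for l y
  define L where "L = letter_act UNIV f g"
  have bij: "bij (fn l)" for l using f g by (simp add: fn_def)
  have L: "L l y = (if snd l then fn l y else inv (fn l) y)" for l y
    by (simp add: L_def letter_act_def fn_def Let_def)
  have fi: "fn l (inv (fn l) y) = y" "inv (fn l) (fn l y) = y" for l y
    using bij[of l] by (auto simp: bij_def surj_f_inv_f)
  have eH: "e l y \<in> H" for l y
  proof -
    have "(z, fn l z) \<in> H" for z by (auto simp: H_def fn_def)
    moreover have "e l y = (fst (e l y), fn l (fst (e l y)))" using fi by (auto simp: e_def)
    ultimately show ?thesis by metis
  qed
  have e_ends: "e l y = (y, L l y) \<or> e l y = (L l y, y)" for l y by (auto simp: e_def L)
  have noconn: "(y, L l y) \<notin> conn (H - {e l y})" for l y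
    using forest eH[of l y] e_ends[of l y] conn_sym unfolding forest_def H_def[symmetric] by fastforce
  have nofix: "fn l y \<noteq> y" for l y
    using noconn[of y "(fst l, True)"] by (auto simp: L fn_def)
  \<comment> \<open>Invariant: the start is joined to the current vertex without the edge that the
    next letter crosses. As that edge is a bridge, the next vertex is not the start.\<close>
  have main: "reduced_word (l # w) \<Longrightarrow> (v, word_act UNIV f g w v) \<in> conn (H - {e l (word_act UNIV f g w v)})" for l w
  proof (induction w arbitrary: l)
    case (Cons l2 w)
    define y2 where "y2 = word_act UNIV f g w v"
    have y: "word_act UNIV f g (l2 # w) v = L l2 y2" by (simp add: y2_def L_def)
    have IH: "(v, y2) \<in> conn (H - {e l2 y2})" using Cons by (simp add: y2_def)
    have nc: "(v, L l2 y2) \<notin> conn (H - {e l2 y2})"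
    proof
      assume "(v, L l2 y2) \<in> conn (H - {e l2 y2})"
      then have "(y2, L l2 y2) \<in> conn (H - {e l2 y2})" using IH conn_sym conn_trans by fast
      then show False using noconn by blast
    qed
    \<comment> \<open>For the same generator the signs agree by reducedness, and equal edges would
      yield a fixed point, that is, a loop. Different generators share no edge by
      \<open>disj\<close>.\<close>
    have ne: "e l (L l2 y2) \<noteq> e l2 y2"
    proof
      assume eq: "e l (L l2 y2) = e l2 y2"
      have red: "\<not> (fst l = fst l2 \<and> snd l \<noteq> snd l2)" using Cons.prems by simp
      show False
      proof (cases "fst l = fst l2")
        case True
        then have "snd l = snd l2" "fn l = fn l2" using red by (auto simp: fn_def)
        then show False using eq nofix[of l2 y2] nofix[of l2 "inv (fn l2) y2"] fi[of l2 y2]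
          by (auto simp: e_def L split: if_splits)
      next
        case False
        have snd_e: "snd (e l y) = fn l (fst (e l y))" for l y using fi by (simp add: e_def)
        have "fn l x \<noteq> fn l2 x" for x using False disj[of x] by (auto simp: fn_def)
        then show False using snd_e[of l "L l2 y2"] snd_e[of l2 y2] eq by metis
      qed
    qed
    \<comment> \<open>Without the edge just crossed, the new vertex \<open>L l2 y2\<close> is in
      another component, so the connection from \<open>v\<close> to \<open>y2\<close> avoids it and
      with it the next edge.\<close>
    have "(v, y2) \<in> conn ((H - {e l2 y2}) \<inter> {(a, b). a \<noteq> L l2 y2 \<and> b \<noteq> L l2 y2})"
      by (rule conn_avoid[OF IH nc])
    then have "(v, y2) \<in> conn (H - {e l (L l2 y2)})"
      by (rule conn_mono) (use e_ends[of l "L l2 y2"] in auto)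
    moreover have "(y2, L l2 y2) \<in> conn (H - {e l (L l2 y2)})"
      using e_ends[of l2 y2] eH[of l2 y2] ne conn_edge conn_sym by (metis Diff_iff singletonD)
    ultimately show ?case unfolding y by (rule conn_trans)
  qed simp
  obtain l w' where w': "w = l # w'" using w by (cases w) auto
  show ?thesis
  proof
    assume "word_act UNIV f g w v = v"
    then have "L l (word_act UNIV f g w' v) = v" by (simp add: w' L_def)
    then show False using main[of l w'] w w' noconn conn_sym by metis
  qed
qed

section \<open>Weights of closed trails\<close>

lemma nn_integral_count_space_swap:
  "(\<Sum>\<^sup>+x. \<Sum>\<^sup>+y. f x y) = (\<Sum>\<^sup>+y. \<Sum>\<^sup>+x. f x y)"
  using nn_integral_fst_count_space[of "\<lambda>(x, y). f x y"] nn_integral_snd_count_space[of "\<lambda>(x, y). f x y"]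
  by simp

lemma nn_integral_count_space_prod:
  "(\<Sum>\<^sup>+z. f z) = (\<Sum>\<^sup>+x. \<Sum>\<^sup>+y. f (x, y))"
  by (rule nn_integral_fst_count_space[symmetric])

lemma nn_integral_count_space_bool:
  "(\<Sum>\<^sup>+b. f b) = f True + (f False :: ennreal)"
  by (simp add: nn_integral_count_space_finite UNIV_bool add.commute)

lemma nn_integral_count_space_Cons:
  assumes "f [] = 0"
  shows "(\<Sum>\<^sup>+\<gamma>. f \<gamma>) = (\<Sum>\<^sup>+l. \<Sum>\<^sup>+\<gamma>. f (l # \<gamma>))"
proof -
  have "bij_betw (\<lambda>(l, \<gamma>). l # \<gamma>) UNIV {\<gamma> :: 'a list. \<gamma> \<noteq> []}"
    by (rule bij_betw_byWitness[where f' = "\<lambda>\<gamma>. (hd \<gamma>, tl \<gamma>)"]) auto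
  then have "(\<Sum>\<^sup>+z. f ((\<lambda>(l, \<gamma>). l # \<gamma>) z)) = (\<integral>\<^sup>+\<gamma>. f \<gamma> \<partial>count_space {\<gamma>. \<gamma> \<noteq> []})"
    by (rule nn_integral_bij_count_space)
  also have "\<dots> = (\<Sum>\<^sup>+\<gamma>. f \<gamma>)"
    using assms by (intro nn_integral_count_space_eq) auto
  finally show ?thesis by (simp add: nn_integral_count_space_prod)
qed

lemma emeasure_UN_le:
  fixes A :: "'i::countable \<Rightarrow> 'a set"
  assumes [measurable]: "\<And>i. A i \<in> sets M"
  shows "emeasure M (\<Union>i. A i) \<le> (\<Sum>\<^sup>+i. emeasure M (A i))"
proof -
  have "emeasure M (\<Union>i. A i) = (\<integral>\<^sup>+x. indicator (\<Union>i. A i) x \<partial>M)" by simp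
  also have "\<dots> \<le> (\<integral>\<^sup>+x. \<Sum>\<^sup>+i. indicator (A i) x \<partial>M)"
  proof (intro nn_integral_mono)
    fix x
    show "indicator (\<Union>i. A i) x \<le> (\<Sum>\<^sup>+i. (indicator (A i) x :: ennreal))"
    proof (cases "x \<in> (\<Union>i. A i)")
      case True
      then obtain i where i: "x \<in> A i" by auto
      have "(1 :: ennreal) = (\<Sum>\<^sup>+j. indicator {i} j)" by simp
      also have "\<dots> \<le> (\<Sum>\<^sup>+i. indicator (A i) x)"
        using i by (intro nn_integral_mono) (auto split: split_indicator)
      finally show ?thesis using True by simp
    qed simp
  qed
  also have "\<dots> = (\<Sum>\<^sup>+i. emeasure M (A i))"
    by (subst nn_integral_count_space_nn_integral) auto
  finally show ?thesis .
qed

text \<open>Connectedness is a countable union over path lengths and intermediate vertices.\<close>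

lemma pred_conn:
  fixes R :: "'x \<Rightarrow> ('a::countable \<times> 'a) set"
  assumes [measurable]: "\<And>u v. Measurable.pred N (\<lambda>\<omega>. (u, v) \<in> R \<omega>)"
  shows "Measurable.pred N (\<lambda>\<omega>. (x, y) \<in> conn (R \<omega>))"
proof -
  have "Measurable.pred N (\<lambda>\<omega>. (x, y) \<in> (R \<omega> \<union> (R \<omega>)\<inverse>) ^^ n)" for n
  proof (induction n arbitrary: y)
    case (Suc n)
    note [measurable] = Suc
    have "(\<lambda>\<omega>. (x, y) \<in> (R \<omega> \<union> (R \<omega>)\<inverse>) ^^ Suc n) =
      (\<lambda>\<omega>. \<exists>z. (x, z) \<in> (R \<omega> \<union> (R \<omega>)\<inverse>) ^^ n \<and> ((z, y) \<in> R \<omega> \<or> (y, z) \<in> R \<omega>))"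
      by (auto simp: fun_eq_iff)
    then show ?case by simp
  qed simp
  note [measurable] = this
  have "(\<lambda>\<omega>. (x, y) \<in> conn (R \<omega>)) = (\<lambda>\<omega>. \<exists>n. (x, y) \<in> (R \<omega> \<union> (R \<omega>)\<inverse>) ^^ n)"
    by (simp add: conn_def rtrancl_is_UN_relpow)
  then show ?thesis by simp
qed

text \<open>Slot \<open>(b, j, g)\<close> proposes at each vertex \<open>v\<close> independently, with probability \<open>p (K + j) g\<close>, the edge
  from \<open>v\<close> to \<open>v + g\<close>, where \<open>p k\<close> is the \<open>k\<close>-step kernel of a random walk. The flag \<open>b\<close> says for which
  of the two generators the edge is intended. By \<open>small\<close> a vertex expects few edges in the sense of
  operator norms, although it meets infinitely many slots.\<close>

locale percolation = iid_action V P for V :: "'v measure"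
    and P :: "('g::{countable,group_add} \<times> (bool \<times> nat \<times> 'g) \<Rightarrow> 'v) measure" +
  fixes p :: "nat \<Rightarrow> 'g \<Rightarrow> real" and \<rho> :: real and K :: nat and On :: "bool \<times> nat \<times> 'g \<Rightarrow> 'v set"
  assumes \<rho>: "0 < \<rho>" "\<rho> < 1" and K: "0 < K"
    and p_nonneg: "\<And>k g. 0 \<le> p k g" and p_le: "\<And>k g. p k g \<le> \<rho> ^ k" and p_uminus: "\<And>k g. p k (- g) = p k g"
    and p_sum: "\<And>k. (\<Sum>\<^sup>+g. ennreal (p k g)) = 1"
    and p_conv: "\<And>k l g. (\<Sum>\<^sup>+h. ennreal (p k h) * ennreal (p l (- h + g))) = ennreal (p (k + l) g)"
    and small: "(\<Sum>\<^sup>+j. ennreal (\<rho> ^ (K + j))) \<le> ennreal (1 / 8)"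
    and sets_On[measurable]: "\<And>k. On k \<in> sets V"
    and measure_On: "\<And>b j g. measure V (On (b, j, g)) = p (K + j) g"
begin

definition el :: "bool \<times> nat \<times> 'g \<Rightarrow> 'g" where
  "el k = snd (snd k)"

definition q :: "bool \<times> nat \<times> 'g \<Rightarrow> real" where
  "q k = p (K + fst (snd k)) (snd (snd k))"

definition onset :: "('g \<times> (bool \<times> nat \<times> 'g) \<Rightarrow> 'v) \<Rightarrow> ('g \<times> (bool \<times> nat \<times> 'g)) set" where
  "onset \<omega> = {(v, k). \<omega> (v, k) \<in> On k}"

definition coins :: "bool \<Rightarrow> ('g \<times> (bool \<times> nat \<times> 'g) \<Rightarrow> 'v) \<Rightarrow> ('g \<times> (nat \<times> 'g)) set" where
  "coins b \<omega> = {(v, s). (v, (b, s)) \<in> onset \<omega>}"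

lemma q_nonneg: "0 \<le> q k"
  by (simp add: q_def p_nonneg)

text \<open>Hence every coin is off with positive probability; \<open>0 < K\<close> makes the bound
  by a power of \<open>\<rho>\<close> strict.\<close>

lemma q_less_1: "q k < 1"
proof -
  have "q k \<le> \<rho> ^ (K + fst (snd k))" by (simp add: q_def p_le)
  also have "\<dots> < 1" using power_strict_decreasing[of 0 "K + fst (snd k)" \<rho>] \<rho> K by simp
  finally show ?thesis .
qed

lemma measure_On_q: "measure V (On k) = q k"
  by (cases k) (simp add: q_def measure_On)

lemma pred_onset[measurable]: "Measurable.pred P (\<lambda>\<omega>. (v, k) \<in> onset \<omega>)"
  by (simp add: onset_def)

lemma onset_sft: "(v, k) \<in> onset (sft l \<omega>) \<longleftrightarrow> (- l + v, k) \<in> onset \<omega>"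
  by (simp add: onset_def sft_def)

lemma coins_sft: "coins b (sft l \<omega>) = {(v, s). (- l + v, s) \<in> coins b \<omega>}"
  by (auto simp: coins_def onset_sft)

lemma onset_eq_cyl: "{\<omega>. J \<subseteq> onset \<omega>} = cyl J (\<lambda>(v, k). On k)"
  by (auto simp: onset_def cyl_def)

lemma sets_onset: "finite J \<Longrightarrow> {\<omega>. J \<subseteq> onset \<omega>} \<in> sets P"
  unfolding onset_eq_cyl by (rule sets_cyl) auto

lemma measure_onset: "finite J \<Longrightarrow> measure P {\<omega>. J \<subseteq> onset \<omega>} = (\<Prod>i\<in>J. q (snd i))"
  unfolding onset_eq_cyl by (subst measure_cyl) (auto intro!: prod.cong simp: measure_On_q)

definition wt :: "((bool \<times> nat \<times> 'g) \<times> bool) list \<Rightarrow> ennreal" where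
  "wt \<gamma> = prod_list (map (\<lambda>l. ennreal (q (fst l))) \<gamma>)"

lemma wt_simps: "wt [] = 1" "wt (l # \<gamma>) = ennreal (q (fst l)) * wt \<gamma>"
  by (simp_all add: wt_def)

lemma snd_coords: "map snd (coords el x \<gamma>) = map fst \<gamma>"
proof (induction \<gamma> arbitrary: x)
  case (Cons l \<gamma>)
  have "snd (src el x l) = fst l" by (cases l; cases "snd l") auto
  then show ?case using Cons by simp
qed simp

lemma emeasure_coords:
  assumes "distinct (coords el x \<gamma>)"
  shows "emeasure P {\<omega>. set (coords el x \<gamma>) \<subseteq> onset \<omega>} = wt \<gamma>"
proof -
  have "measure P {\<omega>. set (coords el x \<gamma>) \<subseteq> onset \<omega>} = (\<Prod>i\<in>set (coords el x \<gamma>). q (snd i))"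
    by (rule measure_onset) simp
  also have "\<dots> = prod_list (map (\<lambda>i. q (snd i)) (coords el x \<gamma>))"
    using assms by (rule prod.distinct_set_conv_list)
  also have "map (\<lambda>i. q (snd i)) (coords el x \<gamma>) = map q (map snd (coords el x \<gamma>))" by simp
  also have "\<dots> = map (\<lambda>l. q (fst l)) \<gamma>" unfolding snd_coords by simp
  finally have "emeasure P {\<omega>. set (coords el x \<gamma>) \<subseteq> onset \<omega>} = ennreal (prod_list (map (\<lambda>l. q (fst l)) \<gamma>))"
    by (simp add: P.emeasure_eq_measure)
  also have "\<dots> = wt \<gamma>"
  proof (induction \<gamma>)
    case (Cons l \<gamma>)
    have "0 \<le> prod_list (map (\<lambda>l. q (fst l)) \<gamma>)" by (induction \<gamma>) (auto simp: q_nonneg)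
    then show ?case using Cons by (simp add: wt_simps ennreal_mult q_nonneg)
  qed (simp add: wt_simps)
  finally show ?thesis .
qed

text \<open>Runs over all step sequences that reach 0, also those that repeat a coordinate. This
  overcount yields a one-step recursion and suffices for upper bounds.\<close>

definition Z :: "nat \<Rightarrow> 'g \<Rightarrow> ennreal" where
  "Z n x = (\<Sum>\<^sup>+\<gamma>. wt \<gamma> * indicator {\<gamma>. length \<gamma> = n \<and> endp el x \<gamma> = 0} \<gamma>)"

lemma Z_0: "Z 0 x = indicator {0} x"
proof -
  have "Z 0 x = (\<Sum>\<^sup>+(\<gamma> :: ((bool \<times> nat \<times> 'g) \<times> bool) list). indicator {0} x * indicator {[]} \<gamma>)"
    unfolding Z_def by (intro nn_integral_cong) (auto simp: wt_simps split: split_indicator)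
  then show ?thesis by (simp add: nn_integral_cmult_indicator)
qed

lemma Z_Suc: "Z (Suc n) x = (\<Sum>\<^sup>+l. ennreal (q (fst l)) * Z n (nxt el x l))"
proof -
  have "Z (Suc n) x = (\<Sum>\<^sup>+l. \<Sum>\<^sup>+\<gamma>. wt (l # \<gamma>) * indicator {\<gamma>. length \<gamma> = Suc n \<and> endp el x \<gamma> = 0} (l # \<gamma>))"
    unfolding Z_def by (rule nn_integral_count_space_Cons) simp
  also have "\<dots> = (\<Sum>\<^sup>+l. \<Sum>\<^sup>+\<gamma>. ennreal (q (fst l)) * (wt \<gamma> * indicator {\<gamma>. length \<gamma> = n \<and> endp el (nxt el x l) \<gamma> = 0} \<gamma>))"
    by (intro nn_integral_cong) (simp add: wt_simps mult.assoc indicator_def)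
  also have "\<dots> = (\<Sum>\<^sup>+l. ennreal (q (fst l)) * Z n (nxt el x l))"
    unfolding Z_def by (intro nn_integral_cong nn_integral_cmult) simp
  finally show ?thesis .
qed

text \<open>Since the increments within a block are distributed like a walk, convolving them along the trail
  leaves only return probabilities, so a trail of length \<open>n\<close> costs at most \<open>(1/2)^n\<close>.\<close>

lemma p_Z: "(\<Sum>\<^sup>+g. ennreal (p m g) * Z n g) \<le> ennreal (\<rho> ^ m * (1/2) ^ n)"
proof (induction n arbitrary: m)
  case 0
  have "(\<Sum>\<^sup>+g. ennreal (p m g) * Z 0 g) = (\<Sum>\<^sup>+(g :: 'g). ennreal (p m 0) * indicator {0} g)"
    by (intro nn_integral_cong) (auto simp: Z_0 split: split_indicator)
  also have "\<dots> = ennreal (p m 0)" by (simp add: nn_integral_cmult_indicator)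
  finally show ?case using p_le by (simp add: ennreal_leI)
next
  case (Suc n)
  have Zf: "Z (Suc n) g = 4 * (\<Sum>\<^sup>+j. \<Sum>\<^sup>+h. ennreal (p (K + j) h) * Z n (g + h))" (is "_ = 4 * ?I g") for g
  proof -
    \<comment> \<open>The factor 4 counts two flags and two directions: by symmetry of
      \<open>p\<close>, a backward step contributes as much as a forward one.\<close>
    have 1: "(\<Sum>\<^sup>+h. ennreal (p (K + j) h) * Z n (g - h)) = (\<Sum>\<^sup>+h. ennreal (p (K + j) h) * Z n (g + h))" for j
      by (subst nn_integral_uminus[symmetric]) (simp add: p_uminus)
    have "Z (Suc n) g = (\<Sum>\<^sup>+k. ennreal (q k) * Z n (g + el k)) + (\<Sum>\<^sup>+k. ennreal (q k) * Z n (g - el k))"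
      unfolding Z_Suc
      by (subst nn_integral_count_space_prod, subst nn_integral_count_space_swap) (simp add: nn_integral_count_space_bool)
    also have "(\<Sum>\<^sup>+k. ennreal (q k) * Z n (g + el k)) = ?I g + ?I g"
      by (simp add: nn_integral_count_space_prod nn_integral_count_space_bool q_def el_def mult_2_right)
    also have "(\<Sum>\<^sup>+k. ennreal (q k) * Z n (g - el k)) = ?I g + ?I g"
      by (simp add: nn_integral_count_space_prod nn_integral_count_space_bool q_def el_def 1 mult_2_right)
    finally show ?thesis by (simp add: mult_2[symmetric] mult.assoc[symmetric] distrib_right[symmetric])
  qed
  have "(\<Sum>\<^sup>+g. ennreal (p m g) * Z (Suc n) g)
     = 4 * (\<Sum>\<^sup>+g. \<Sum>\<^sup>+j. \<Sum>\<^sup>+h. ennreal (p m g) * (ennreal (p (K + j) h) * Z n (g + h)))"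
    unfolding Zf by (simp add: nn_integral_cmult mult.left_commute[of _ 4])
  also have "(\<Sum>\<^sup>+g. \<Sum>\<^sup>+j. \<Sum>\<^sup>+h. ennreal (p m g) * (ennreal (p (K + j) h) * Z n (g + h)))
     = (\<Sum>\<^sup>+j. \<Sum>\<^sup>+g. \<Sum>\<^sup>+h. ennreal (p m g) * (ennreal (p (K + j) h) * Z n (g + h)))"
    by (rule nn_integral_count_space_swap)
  also have "\<dots> = (\<Sum>\<^sup>+j. \<Sum>\<^sup>+y. ennreal (p (m + (K + j)) y) * Z n y)"
  proof (rule nn_integral_cong)
    fix j
    have "(\<Sum>\<^sup>+g. \<Sum>\<^sup>+h. ennreal (p m g) * (ennreal (p (K + j) h) * Z n (g + h)))
      = (\<Sum>\<^sup>+g. \<Sum>\<^sup>+y. (ennreal (p m g) * ennreal (p (K + j) (- g + y))) * Z n y)"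
    proof (rule nn_integral_cong)
      fix g
      show "(\<Sum>\<^sup>+h. ennreal (p m g) * (ennreal (p (K + j) h) * Z n (g + h)))
        = (\<Sum>\<^sup>+y. (ennreal (p m g) * ennreal (p (K + j) (- g + y))) * Z n y)"
        by (subst nn_integral_left_shift[of _ "- g", symmetric]) (simp add: add.assoc[symmetric] mult.assoc)
    qed
    also have "\<dots> = (\<Sum>\<^sup>+y. (\<Sum>\<^sup>+g. ennreal (p m g) * ennreal (p (K + j) (- g + y))) * Z n y)"
      by (subst nn_integral_count_space_swap) (simp add: nn_integral_multc)
    finally show "(\<Sum>\<^sup>+g. \<Sum>\<^sup>+h. ennreal (p m g) * (ennreal (p (K + j) h) * Z n (g + h)))
      = (\<Sum>\<^sup>+y. ennreal (p (m + (K + j)) y) * Z n y)"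
      by (simp add: p_conv)
  qed
  also have "\<dots> \<le> (\<Sum>\<^sup>+j. ennreal (\<rho> ^ (m + (K + j)) * (1/2) ^ n))"
    by (intro nn_integral_mono Suc)
  also have "\<dots> = (\<Sum>\<^sup>+j. ennreal (\<rho> ^ m * (1/2) ^ n) * ennreal (\<rho> ^ (K + j)))"
    using \<rho> by (intro nn_integral_cong) (simp add: ennreal_mult[symmetric] power_add mult_ac)
  also have "\<dots> = ennreal (\<rho> ^ m * (1/2) ^ n) * (\<Sum>\<^sup>+j. ennreal (\<rho> ^ (K + j)))"
    by (rule nn_integral_cmult) simp
  \<comment> \<open>The prefactor 4 times 1 / 8 is the factor 1 / 2 gained per step, which explains
    the constant in \<open>small\<close>.\<close>
  also have "\<dots> \<le> ennreal (\<rho> ^ m * (1/2) ^ n) * ennreal (1 / 8)"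
    by (intro mult_left_mono small) simp
  finally have "(\<Sum>\<^sup>+g. ennreal (p m g) * Z (Suc n) g) \<le> 4 * (ennreal (\<rho> ^ m * (1/2) ^ n) * ennreal (1 / 8))"
    by (simp add: mult_left_mono)
  also have "\<dots> = ennreal (4 * (\<rho> ^ m * (1/2) ^ n * (1 / 8)))"
  proof -
    have "4 * (ennreal a * ennreal (1 / 8)) = ennreal (4 * (a * (1 / 8)))" if "0 \<le> a" for a
    proof -
      have "ennreal (4 * (a * (1 / 8))) = ennreal 4 * (ennreal a * ennreal (1 / 8))"
        using that by (simp only: ennreal_mult mult_nonneg_nonneg zero_le_numeral divide_nonneg_nonneg zero_le_one)
      then show ?thesis by simp
    qed
    from this[of "\<rho> ^ m * (1/2) ^ n"] show ?thesis using \<rho> by (simp only: mult.assoc) simp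
  qed
  also have "4 * (\<rho> ^ m * (1/2) ^ n * (1 / 8)) = \<rho> ^ m * (1/2) ^ Suc n" by simp
  finally show ?case .
qed

definition Ztot :: "'g \<Rightarrow> ennreal" where
  "Ztot x = (\<Sum>\<^sup>+\<gamma>. wt \<gamma> * indicator {\<gamma>. endp el x \<gamma> = 0} \<gamma>)"

lemma Ztot_eq: "Ztot x = (\<Sum>\<^sup>+n. Z n x)"
proof -
  have "(\<Sum>\<^sup>+n. Z n x) = (\<Sum>\<^sup>+\<gamma>. \<Sum>\<^sup>+n. (wt \<gamma> * indicator {\<gamma>. endp el x \<gamma> = 0} \<gamma>) * indicator {length \<gamma>} n)"
    unfolding Z_def by (subst nn_integral_count_space_swap) (auto intro!: nn_integral_cong split: split_indicator)
  also have "\<dots> = Ztot x" unfolding Ztot_def by (intro nn_integral_cong) (simp add: nn_integral_cmult_indicator)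
  finally show ?thesis ..
qed

lemma p_Ztot: "(\<Sum>\<^sup>+g. ennreal (p m g) * Ztot g) \<le> ennreal (2 * \<rho> ^ m)"
proof -
  have "(\<Sum>\<^sup>+g. ennreal (p m g) * Ztot g) = (\<Sum>\<^sup>+n. \<Sum>\<^sup>+g. ennreal (p m g) * Z n g)"
    unfolding Ztot_eq by (subst nn_integral_count_space_swap) (simp add: nn_integral_cmult)
  also have "\<dots> \<le> (\<Sum>\<^sup>+n. ennreal (\<rho> ^ m * (1/2) ^ n))"
    by (intro nn_integral_mono p_Z)
  also have "\<dots> = (\<Sum>n. ennreal (\<rho> ^ m * (1/2) ^ n))" by (rule nn_integral_count_space_nat)
  also have "\<dots> = ennreal (\<Sum>n. \<rho> ^ m * (1/2) ^ n)"
    using \<rho> by (intro suminf_ennreal2 summable_mult summable_geometric) auto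
  also have "(\<Sum>n. \<rho> ^ m * (1/2) ^ n) = 2 * \<rho> ^ m"
    using suminf_geometric[of "1/2 :: real"] by (subst suminf_mult) (auto intro!: summable_geometric)
  finally show ?thesis .
qed

text \<open>Bounds the expected number of proposals at 0 for one generator that close a cycle: the
  end of the proposed edge is distributed like the walk, so \<open>p_Ztot\<close> applies and the
  total is at most \<open>2 * (1 / 8)\<close>.\<close>

lemma sum_q_Ztot: "(\<Sum>\<^sup>+s. ennreal (q (b, s)) * Ztot (snd s)) \<le> 1"
proof -
  have "(\<Sum>\<^sup>+s. ennreal (q (b, s)) * Ztot (snd s)) =
      (\<Sum>\<^sup>+j. \<Sum>\<^sup>+g. ennreal (p (K + j) g) * Ztot g)"
    by (subst nn_integral_count_space_prod) (simp add: q_def)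
  also have "\<dots> \<le> (\<Sum>\<^sup>+j. ennreal (2 * \<rho> ^ (K + j)))"
    by (intro nn_integral_mono p_Ztot)
  also have "\<dots> = 2 * (\<Sum>\<^sup>+j. ennreal (\<rho> ^ (K + j)))"
    using \<rho> by (subst nn_integral_cmult[symmetric]) (auto simp: ennreal_mult)
  also have "\<dots> \<le> 2 * ennreal (1/8)" by (intro mult_left_mono small) simp
  also have "\<dots> = ennreal 2 * ennreal (1/8)" by simp
  also have "\<dots> = ennreal (2 * (1/8))" by (rule ennreal_mult[symmetric]) auto
  also have "\<dots> \<le> 1" by simp
  finally show ?thesis .
qed

text \<open>The walk gives each point mass at most \<open>\<rho> ^ k\<close>, so a finite
  exceptional set costs at most \<open>card F\<close> times that, and these costs are summable in
  \<open>k\<close>.\<close>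

lemma walk_average:
  fixes f :: "'g \<Rightarrow> ennreal"
  assumes "finite F" "\<And>g. g \<notin> F \<Longrightarrow> c \<le> f g" "c \<le> 1"
  shows "c \<le> (\<Sum>\<^sup>+g. ennreal (p k g) * f g) + of_nat (card F) * ennreal (\<rho> ^ k)"
proof -
  have "c = (\<Sum>\<^sup>+g. ennreal (p k g) * c)"
    by (simp add: nn_integral_multc p_sum)
  also have "\<dots> \<le> (\<Sum>\<^sup>+g. ennreal (p k g) * f g + ennreal (p k g) * indicator F g)"
  proof (intro nn_integral_mono)
    fix g
    show "ennreal (p k g) * c \<le> ennreal (p k g) * f g + ennreal (p k g) * indicator F g"
    proof (cases "g \<in> F")
      case True
      have "ennreal (p k g) * c \<le> ennreal (p k g) * 1" by (intro mult_left_mono assms) simp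
      then show ?thesis using True by (simp add: add_increasing)
    next
      case False
      then show ?thesis using assms(2) by (simp add: mult_left_mono)
    qed
  qed
  also have "\<dots> = (\<Sum>\<^sup>+g. ennreal (p k g) * f g) + (\<Sum>\<^sup>+g. ennreal (p k g) * indicator F g)"
    by (rule nn_integral_add) auto
  also have "(\<Sum>\<^sup>+g. ennreal (p k g) * indicator F g) = (\<Sum>g\<in>F. ennreal (p k g))"
    by (subst nn_integral_indicator_finite[OF assms(1)]) auto
  also have "\<dots> \<le> (\<Sum>g\<in>F. ennreal (\<rho> ^ k))" by (intro sum_mono ennreal_leI p_le)
  finally show ?thesis by (simp add: add_left_mono)
qed

end

section \<open>Every vertex gets matched\<close>

text \<open>One greedy run for the flag \<open>b\<close> on top of a given graph \<open>H\<close>.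
  By \<open>H_cong\<close> the graph is independent of the coins of this run, and by
  \<open>H_edges\<close> cycles through \<open>H\<close> are trails of coins that are on. It is used
  twice: with \<open>H\<close> empty, then with \<open>H\<close> the first matching.\<close>

locale percolation_stage = percolation V P p \<rho> K On for V :: "'v measure"
    and P :: "('g::{countable,group_add} \<times> (bool \<times> nat \<times> 'g) \<Rightarrow> 'v) measure"
    and p :: "nat \<Rightarrow> 'g \<Rightarrow> real" and \<rho> :: real and K :: nat and On :: "bool \<times> nat \<times> 'g \<Rightarrow> 'v set" +
  fixes b :: bool and H :: "('g \<times> (bool \<times> nat \<times> 'g) \<Rightarrow> 'v) \<Rightarrow> ('g \<times> 'g) set"
  assumes pred_H[measurable]: "\<And>u v. Measurable.pred P (\<lambda>\<omega>. (u, v) \<in> H \<omega>)"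
    and H_sft: "\<And>l \<omega>. H (sft l \<omega>) = translate l (H \<omega>)"
    and H_cong: "\<And>\<omega> \<omega>'. (\<And>v b' s. b' \<noteq> b \<Longrightarrow> \<omega> (v, (b', s)) = \<omega>' (v, (b', s))) \<Longrightarrow> H \<omega> = H \<omega>'"
    and H_edges: "\<And>u v \<omega>. (u, v) \<in> H \<omega> \<Longrightarrow> \<exists>k. fst k \<noteq> b \<and> v = u + el k \<and> (u, k) \<in> onset \<omega>"
begin

definition M where "M n \<omega> = matching snd (coins b \<omega>) (H \<omega>) n"
definition E where "E n \<omega> = edges_at snd (coins b \<omega>) n"
definition Mlim where "Mlim \<omega> = matching_lim snd (coins b \<omega>) (H \<omega>)"
definition Acc where "Acc n \<omega> = accepted snd (coins b \<omega>) (H \<omega>) (M n \<omega>) n"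

lemma M_0: "M 0 \<omega> = {}"
  by (simp add: M_def)

lemma M_Suc: "M (Suc n) \<omega> = M n \<omega> \<union> Acc n \<omega>"
  by (simp add: M_def Acc_def)

lemma Mlim_eq: "Mlim \<omega> = (\<Union>n. M n \<omega>)"
  by (simp add: Mlim_def M_def matching_lim_def)

lemma M_mono: "m \<le> n \<Longrightarrow> M m \<omega> \<subseteq> M n \<omega>"
  unfolding M_def by (rule matching_mono)

lemma mem_E: "(u, v) \<in> E n \<omega> \<longleftrightarrow> (\<exists>s. to_nat s = n \<and> v = u + snd s \<and> (u, (b, s)) \<in> onset \<omega>)"
  by (simp add: E_def edges_at_def coins_def)

lemma mem_Acc: "(u, v) \<in> Acc n \<omega> \<longleftrightarrow> (u, v) \<in> E n \<omega> \<and> (\<forall>w. (u, w) \<notin> M n \<omega>) \<and> (\<forall>w. (w, v) \<notin> M n \<omega>) \<and>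
    (u, v) \<notin> H \<omega> \<and> (u, v) \<notin> conn (H \<omega> \<union> M n \<omega> \<union> E n \<omega> - {(u, v)})"
  by (auto simp: Acc_def accepted_def E_def Domain_iff Range_iff)

lemma M_edges: "(u, v) \<in> M n \<omega> \<Longrightarrow> \<exists>s. to_nat s < n \<and> v = u + snd s \<and> (u, (b, s)) \<in> onset \<omega>"
  unfolding M_def using matching_edges[of u v snd "coins b \<omega>" "H \<omega>" n] by (auto simp: coins_def)

lemma pred_E[measurable]: "Measurable.pred P (\<lambda>\<omega>. (u, v) \<in> E n \<omega>)"
  unfolding mem_E by measurable

lemma pred_M[measurable]: "Measurable.pred P (\<lambda>\<omega>. (u, v) \<in> M n \<omega>)"
proof (induction n arbitrary: u v)
  case (Suc n)
  note [measurable] = Suc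
  have [measurable]: "Measurable.pred P (\<lambda>\<omega>. (x, y) \<in> conn (H \<omega> \<union> M n \<omega> \<union> E n \<omega> - {(u, v)}))" for x y
    by (rule pred_conn) simp
  show ?case unfolding M_Suc Un_iff mem_Acc by measurable
qed (simp add: M_0)

lemma pred_conn_M[measurable]: "Measurable.pred P (\<lambda>\<omega>. (x, y) \<in> conn (H \<omega> \<union> M n \<omega> \<union> E n \<omega> - {(u, v)}))"
  by (rule pred_conn) simp

lemma pred_Acc[measurable]: "Measurable.pred P (\<lambda>\<omega>. (u, v) \<in> Acc n \<omega>)"
  unfolding mem_Acc by measurable

lemma sets_Acc[measurable]: "{\<omega>. (u, v) \<in> Acc n \<omega>} \<in> sets P"
  using pred_Acc[of u v n] by (simp add: pred_def)

lemma pred_Mlim[measurable]: "Measurable.pred P (\<lambda>\<omega>. (u, v) \<in> Mlim \<omega>)"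
  unfolding Mlim_eq UN_iff by measurable

lemma sets_Mlim[measurable]: "{\<omega>. (u, v) \<in> Mlim \<omega>} \<in> sets P"
  using pred_Mlim[of u v] by (simp add: pred_def)

lemma Mlim_functional:
  "(u, v) \<in> Mlim \<omega> \<Longrightarrow> (u, v') \<in> Mlim \<omega> \<Longrightarrow> v = v'"
  "(u, v) \<in> Mlim \<omega> \<Longrightarrow> (u', v) \<in> Mlim \<omega> \<Longrightarrow> u = u'"
  unfolding Mlim_def by (fact matching_lim_functional)+

lemma Mlim_sft: "Mlim (sft l \<omega>) = translate l (Mlim \<omega>)"
  unfolding Mlim_def coins_sft H_sft by (rule matching_lim_translate)

lemma M_cong:
  assumes "\<And>v k. fst k \<noteq> b \<or> to_nat (snd k) < n \<Longrightarrow> \<omega> (v, k) = \<omega>' (v, k)"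
  shows "M n \<omega> = M n \<omega>'"
proof -
  have "H \<omega> = H \<omega>'" by (rule H_cong) (use assms in auto)
  moreover have "matching snd (coins b \<omega>) (H \<omega>) n = matching snd (coins b \<omega>') (H \<omega>) n"
    by (rule matching_cong) (use assms in \<open>auto simp: coins_def onset_def\<close>)
  ultimately show ?thesis by (simp add: M_def)
qed

text \<open>Proposals from 0 that are doomed for reasons other than an occupied endpoint. Occupied
  endpoints are left out because they do not occur at unmatched vertices.\<close>

definition Bad where
  "Bad s = {\<omega>. (0, (b, s)) \<in> onset \<omega> \<and> ((0, snd s) \<in> H \<omega> \<or>
     (0, snd s) \<in> conn (H \<omega> \<union> M (to_nat s) \<omega> \<union> E (to_nat s) \<omega> - {(0, snd s)}))}"

lemma sets_Bad[measurable]: "Bad s \<in> sets P"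
proof -
  have "{\<omega> \<in> space P. (0, (b, s)) \<in> onset \<omega> \<and> ((0, snd s) \<in> H \<omega> \<or>
     (0, snd s) \<in> conn (H \<omega> \<union> M (to_nat s) \<omega> \<union> E (to_nat s) \<omega> - {(0, snd s)}))} \<in> sets P"
    by measurable
  then show ?thesis by (simp add: Bad_def)
qed

text \<open>The trail avoids the coin of the proposal itself: edges of \<open>H\<close> carry the
  other flag, edges of \<open>M\<close> come from earlier slots, and among the simultaneous edges
  the proposed one is removed.\<close>

lemma Bad_trail:
  assumes "\<omega> \<in> Bad s"
  obtains \<gamma> where "endp el (snd s) \<gamma> = 0" "distinct (coords el (snd s) \<gamma>)"
    "set (coords el (snd s) \<gamma>) \<subseteq> onset \<omega> - {(0, (b, s))}"
proof -
  let ?R = "H \<omega> \<union> M (to_nat s) \<omega> \<union> (E (to_nat s) \<omega> - {(0, snd s)})"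
  have "(0, snd s) \<in> conn ?R"
  proof -
    from assms consider "(0, snd s) \<in> H \<omega>" | "(0, snd s) \<in> conn (H \<omega> \<union> M (to_nat s) \<omega> \<union> E (to_nat s) \<omega> - {(0, snd s)})"
      unfolding Bad_def by blast
    then show ?thesis
    proof cases
      case 1
      then show ?thesis by (intro conn_edge) simp
    next
      case 2
      then show ?thesis by (rule conn_mono) auto
    qed
  qed
  then have "(snd s, 0) \<in> conn ?R" by (rule conn_sym)
  moreover have "\<exists>k. v = u + el k \<and> (u, k) \<in> onset \<omega> - {(0, (b, s))}" if "(u, v) \<in> ?R" for u v
    using that
  proof (elim UnE)
    assume "(u, v) \<in> H \<omega>"
    then show ?thesis using H_edges by fastforce
  next
    assume "(u, v) \<in> M (to_nat s) \<omega>"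
    then obtain s' where "to_nat s' < to_nat s" "v = u + snd s'" "(u, (b, s')) \<in> onset \<omega>" using M_edges by blast
    then show ?thesis by (intro exI[of _ "(b, s')"]) (auto simp: el_def)
  next
    assume "(u, v) \<in> E (to_nat s) \<omega> - {(0, snd s)}"
    then show ?thesis by (intro exI[of _ "(b, s)"]) (auto simp: el_def mem_E)
  qed
  ultimately show ?thesis by (rule trail_exists) (assumption | rule that)+
qed

text \<open>Union bound over trails; the coin of the proposal is not on the trail and contributes
  its own factor \<open>q (b, s)\<close>.\<close>

lemma emeasure_Bad: "emeasure P (Bad s) \<le> ennreal (q (b, s)) * Ztot (snd s)"
proof -
  define A where "A \<gamma> = (if endp el (snd s) \<gamma> = 0 \<and> distinct (coords el (snd s) \<gamma>) \<and> (0, (b, s)) \<notin> set (coords el (snd s) \<gamma>)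
     then {\<omega>. insert (0, (b, s)) (set (coords el (snd s) \<gamma>)) \<subseteq> onset \<omega>} else {})" for \<gamma>
  have [measurable]: "A \<gamma> \<in> sets P" for \<gamma>
    unfolding A_def by (auto intro!: sets_onset simp del: insert_subset)
  have "Bad s \<subseteq> (\<Union>\<gamma>. A \<gamma>)"
  proof
    fix \<omega> assume \<omega>: "\<omega> \<in> Bad s"
    obtain \<gamma> where "endp el (snd s) \<gamma> = 0" "distinct (coords el (snd s) \<gamma>)"
      "set (coords el (snd s) \<gamma>) \<subseteq> onset \<omega> - {(0, (b, s))}" using Bad_trail[OF \<omega>] by blast
    moreover have "(0, (b, s)) \<in> onset \<omega>" using \<omega> by (simp add: Bad_def)
    ultimately have "\<omega> \<in> A \<gamma>" by (auto simp: A_def)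
    then show "\<omega> \<in> (\<Union>\<gamma>. A \<gamma>)" by blast
  qed
  then have "emeasure P (Bad s) \<le> emeasure P (\<Union>\<gamma>. A \<gamma>)" by (intro emeasure_mono) auto
  also have "\<dots> \<le> (\<Sum>\<^sup>+\<gamma>. emeasure P (A \<gamma>))" by (rule emeasure_UN_le) simp
  also have "\<dots> \<le> (\<Sum>\<^sup>+\<gamma>. ennreal (q (b, s)) * (wt \<gamma> * indicator {\<gamma>. endp el (snd s) \<gamma> = 0} \<gamma>))"
  proof (intro nn_integral_mono)
    fix \<gamma>
    show "emeasure P (A \<gamma>) \<le> ennreal (q (b, s)) * (wt \<gamma> * indicator {\<gamma>. endp el (snd s) \<gamma> = 0} \<gamma>)"
    proof (cases "endp el (snd s) \<gamma> = 0 \<and> distinct (coords el (snd s) \<gamma>) \<and> (0, (b, s)) \<notin> set (coords el (snd s) \<gamma>)")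
      case True
      let ?J = "set (coords el (snd s) \<gamma>)"
      have "emeasure P (A \<gamma>) = ennreal (\<Prod>i\<in>insert (0, (b, s)) ?J. q (snd i))"
        using True measure_onset[of "insert (0, (b, s)) ?J"] by (simp add: A_def P.emeasure_eq_measure)
      also have "(\<Prod>i\<in>insert (0, (b, s)) ?J. q (snd i)) = q (b, s) * (\<Prod>i\<in>?J. q (snd i))"
        using True by simp
      also have "ennreal \<dots> = ennreal (q (b, s)) * emeasure P {\<omega>. ?J \<subseteq> onset \<omega>}"
        using measure_onset[of ?J] by (simp add: P.emeasure_eq_measure ennreal_mult q_nonneg prod_nonneg)
      also have "\<dots> = ennreal (q (b, s)) * wt \<gamma>" using True by (simp add: emeasure_coords)
      finally show ?thesis using True by simp
    qed (simp only: A_def if_False emeasure_empty zero_le)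
  qed
  also have "\<dots> = ennreal (q (b, s)) * Ztot (snd s)"
    unfolding Ztot_def by (rule nn_integral_cmult) simp
  finally show ?thesis .
qed

lemma sum_Bad: "(\<Sum>\<^sup>+s. emeasure P (Bad s)) \<le> 1"
  by (rule order_trans[OF nn_integral_mono[OF emeasure_Bad] sum_q_Ztot])

text \<open>At most one accepted edge leaves 0, so these events are disjoint.\<close>

lemma sum_Acc: "(\<Sum>\<^sup>+(s :: nat \<times> 'g). emeasure P {\<omega>. (0, snd s) \<in> Acc (to_nat s) \<omega>}) \<le> 1"
proof -
  let ?A = "\<lambda>s :: nat \<times> 'g. {\<omega> \<in> space P. (0, snd s) \<in> Acc (to_nat s) \<omega>}"
  have *: False if "m < n" "(0, v) \<in> Acc m \<omega>" "(0, w) \<in> Acc n \<omega>" for m n v w \<omega>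
  proof -
    have "(0, v) \<in> M n \<omega>" using that(1,2) M_mono[of "Suc m" n \<omega>] by (auto simp: M_Suc)
    then show False using that(3) by (auto simp: mem_Acc)
  qed
  have dis: "disjoint_family ?A"
  proof (clarsimp simp: disjoint_family_on_def disjoint_iff)
    fix m m' :: nat and v w :: 'g and \<omega>
    assume ne: "m = m' \<longrightarrow> v \<noteq> w" and "(0, v) \<in> Acc (to_nat (m, v)) \<omega>" "(0, w) \<in> Acc (to_nat (m', w)) \<omega>"
    moreover have "to_nat (m, v) \<noteq> to_nat (m', w)" using ne by (auto dest: injD[OF inj_to_nat])
    ultimately show False using * by (metis linorder_neqE_nat)
  qed
  have "(\<Sum>\<^sup>+s. emeasure P (?A s)) = emeasure P (\<Union>s. ?A s)"
    by (rule emeasure_UN_countable[symmetric]) (use dis sets_Acc in auto)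
  also have "\<dots> \<le> 1" by (rule P.measure_le_1)
  finally show ?thesis by simp
qed

section \<open>Unmatched vertices form a null event\<close>

definition undef_out where "undef_out = {\<omega>. 0 \<notin> Domain (Mlim \<omega>)}"
definition undef_in where "undef_in = {\<omega>. 0 \<notin> Range (Mlim \<omega>)}"

lemma sets_undef[measurable]: "undef_out \<in> sets P" "undef_in \<in> sets P"
proof -
  have "{\<omega> \<in> space P. \<forall>v. (0, v) \<notin> Mlim \<omega>} \<in> sets P" "{\<omega> \<in> space P. \<forall>v. (v, 0) \<notin> Mlim \<omega>} \<in> sets P"
    by measurable
  then show "undef_out \<in> sets P" "undef_in \<in> sets P"
    by (auto simp: undef_out_def undef_in_def Domain_iff Range_iff)
qed

lemma sft_undef: "sft (- g) \<omega> \<in> undef_out \<longleftrightarrow> g \<notin> Domain (Mlim \<omega>)" "sft (- g) \<omega> \<in> undef_in \<longleftrightarrow> g \<notin> Range (Mlim \<omega>)"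
  by (simp_all add: undef_out_def undef_in_def Mlim_sft Domain_translate Range_translate)

text \<open>A coin for the edge from \<open>0\<close> to \<open>g\<close> is independent of everything decided earlier, in particular of
  whether \<open>0\<close> and \<open>g\<close> are still unmatched.\<close>

lemma coin_step:
  "ennreal (q (b, s)) * emeasure P (undef_out \<inter> {\<omega>. sft (- snd s) \<omega> \<in> undef_in})
    \<le> emeasure P {\<omega>. (0, snd s) \<in> Acc (to_nat s) \<omega>} + emeasure P (Bad s)"
proof -
  let ?n = "to_nat s"
  define B where "B = {\<omega>. (\<forall>w. (0, w) \<notin> M ?n \<omega>) \<and> (\<forall>w. (w, snd s) \<notin> M ?n \<omega>)}"
  have "{\<omega> \<in> space P. (\<forall>w. (0, w) \<notin> M ?n \<omega>) \<and> (\<forall>w. (w, snd s) \<notin> M ?n \<omega>)} \<in> sets P" by measurable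
  then have sB[measurable]: "B \<in> sets P" by (simp add: B_def)
  have "{\<omega> \<in> space P. (0, snd s) \<in> Acc ?n \<omega>} \<in> sets P" by measurable
  then have sA[measurable]: "{\<omega>. (0, snd s) \<in> Acc ?n \<omega>} \<in> sets P" by simp
  have sC[measurable]: "{\<omega>. {(0, (b, s))} \<subseteq> onset \<omega>} \<in> sets P" by (rule sets_onset) simp
  have "undef_out \<inter> {\<omega>. sft (- snd s) \<omega> \<in> undef_in} \<subseteq> B"
    unfolding sft_undef by (auto simp: undef_out_def B_def Mlim_eq Domain_iff Range_iff)
  then have "ennreal (q (b, s)) * emeasure P (undef_out \<inter> {\<omega>. sft (- snd s) \<omega> \<in> undef_in})
      \<le> ennreal (q (b, s)) * emeasure P B"
    by (intro mult_left_mono emeasure_mono) auto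
  also have "\<dots> = emeasure P ({\<omega>. {(0, (b, s))} \<subseteq> onset \<omega>} \<inter> B)"
  proof -
    have "depends_on {(0, (b, s))} {\<omega>. {(0, (b, s))} \<subseteq> onset \<omega>}"
      unfolding onset_eq_cyl by (rule depends_on_cyl)
    moreover have "depends_on (- {(0, (b, s))}) B"
      unfolding depends_on_def
    proof (intro allI impI)
      fix \<omega> \<omega>' :: "'g \<times> (bool \<times> nat \<times> 'g) \<Rightarrow> 'v"
      assume "\<forall>i\<in>- {(0, (b, s))}. \<omega> i = \<omega>' i"
      \<comment> \<open>\<open>M ?n\<close> reads slots of the flag \<open>b\<close> strictly before
        \<open>?n\<close>, and the coin of \<open>s\<close> belongs to time \<open>?n\<close>
        itself.\<close>
      then have "M ?n \<omega> = M ?n \<omega>'" by (intro M_cong) auto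
      then show "(\<omega> \<in> B) = (\<omega>' \<in> B)" by (simp add: B_def)
    qed
    ultimately have "measure P ({\<omega>. {(0, (b, s))} \<subseteq> onset \<omega>} \<inter> B) = measure P {\<omega>. {(0, (b, s))} \<subseteq> onset \<omega>} * measure P B"
      by (intro depends_on_indep[OF sC sB]) auto
    also have "measure P {\<omega>. {(0, (b, s))} \<subseteq> onset \<omega>} = q (b, s)" by (subst measure_onset) auto
    finally show ?thesis by (simp add: P.emeasure_eq_measure ennreal_mult q_nonneg)
  qed
  also have "\<dots> \<le> emeasure P ({\<omega>. (0, snd s) \<in> Acc ?n \<omega>} \<union> Bad s)"
  proof (intro emeasure_mono subsetI)
    fix \<omega> assume \<omega>: "\<omega> \<in> {\<omega>. {(0, (b, s))} \<subseteq> onset \<omega>} \<inter> B"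
    then have "(0, snd s) \<in> E ?n \<omega>" by (auto simp: mem_E intro!: exI[of _ s])
    then show "\<omega> \<in> {\<omega>. (0, snd s) \<in> Acc ?n \<omega>} \<union> Bad s"
      using \<omega> by (auto simp: mem_Acc Bad_def B_def)
  qed simp
  also have "\<dots> \<le> emeasure P {\<omega>. (0, snd s) \<in> Acc ?n \<omega>} + emeasure P (Bad s)"
    by (rule emeasure_subadditive) auto
  finally show ?thesis .
qed

text \<open>If unmatched vertices had positive density then, by mixing, each block of slots would match a fixed
  proportion of them, while accepted and rejected edges have finite total expectation.\<close>

lemma undef_product: "measure P undef_out * measure P undef_in = 0"
proof (rule ccontr)
  define c where "c = measure P undef_out * measure P undef_in"
  assume "measure P undef_out * measure P undef_in \<noteq> 0"
  then have c: "0 < c" using measure_nonneg[of P undef_out] measure_nonneg[of P undef_in]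
    unfolding c_def by (metis less_eq_real_def mult_nonneg_nonneg)
  have c1: "c \<le> 1" unfolding c_def by (intro mult_le_one) auto
  define r where "r g = emeasure P (undef_out \<inter> {\<omega>. sft (- g) \<omega> \<in> undef_in})" for g
  have "eventually (\<lambda>g. measure P (undef_out \<inter> {\<omega>. sft (- g) \<omega> \<in> undef_in}) > c / 2) cofinite"
    using mixing[of undef_out undef_in] c by (intro order_tendstoD(1)[of _ c]) (auto simp: c_def mult.commute)
  then obtain F where F: "finite F" "\<And>g. g \<notin> F \<Longrightarrow> measure P (undef_out \<inter> {\<omega>. sft (- g) \<omega> \<in> undef_in}) > c / 2"
    unfolding eventually_cofinite by blast
  have r: "ennreal (c / 2) \<le> r g" if "g \<notin> F" for g
    using F(2)[OF that] by (simp add: r_def P.emeasure_eq_measure ennreal_leI)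
  have "ennreal (c / 2) \<le> (\<Sum>\<^sup>+g. ennreal (p (K + j) g) * r g) + of_nat (card F) * ennreal (\<rho> ^ (K + j))" for j
    using c1 by (intro walk_average F(1) r) auto
  \<comment> \<open>The left side is infinite, one positive constant for each block; the right side
    will turn out finite.\<close>
  then have "(\<integral>\<^sup>+j. ennreal (c / 2) \<partial>count_space (UNIV :: nat set))
     \<le> (\<Sum>\<^sup>+j. (\<Sum>\<^sup>+g. ennreal (p (K + j) g) * r g) + of_nat (card F) * ennreal (\<rho> ^ (K + j)))"
    by (intro nn_integral_mono)
  also have "\<dots> = (\<Sum>\<^sup>+s. ennreal (q (b, s)) * r (snd s)) + of_nat (card F) * (\<Sum>\<^sup>+j. ennreal (\<rho> ^ (K + j)))"
  proof -
    have "(\<Sum>\<^sup>+s. ennreal (q (b, s)) * r (snd s)) =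
        (\<Sum>\<^sup>+j. \<Sum>\<^sup>+g. ennreal (p (K + j) g) * r g)"
      by (subst nn_integral_count_space_prod) (simp add: q_def)
    then show ?thesis by (simp add: nn_integral_add nn_integral_cmult)
  qed
  \<comment> \<open>The 2 is made up of at most 1 for accepted edges and at most 1 for bad
    ones.\<close>
  also have "\<dots> \<le> 2 + of_nat (card F) * ennreal (1 / 8)"
  proof (intro add_mono mult_left_mono small)
    have "(\<Sum>\<^sup>+s. ennreal (q (b, s)) * r (snd s)) \<le>
        (\<Sum>\<^sup>+s. emeasure P {\<omega>. (0, snd s) \<in> Acc (to_nat s) \<omega>} + emeasure P (Bad s))"
      unfolding r_def by (intro nn_integral_mono coin_step)
    also have "\<dots> = (\<Sum>\<^sup>+(s :: nat \<times> 'g). emeasure P {\<omega>. (0, snd s) \<in> Acc (to_nat s) \<omega>}) + (\<Sum>\<^sup>+s. emeasure P (Bad s))"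
      by (rule nn_integral_add) auto
    also have "\<dots> \<le> 1 + 1" by (intro add_mono sum_Acc sum_Bad)
    finally show "(\<Sum>\<^sup>+s. ennreal (q (b, s)) * r (snd s)) \<le> 2" by simp
  qed simp
  also have "\<dots> < \<top>" by (simp add: ennreal_mult_less_top of_nat_less_top)
  finally show False using c by (simp add: ennreal_mult_top)
qed

text \<open>Mass transport: by invariance an edge from 0 to \<open>v\<close> is as likely as one
  from \<open>- v\<close> to 0, and summing over \<open>v\<close> compares having an outgoing edge
  with having an incoming one.\<close>

lemma undef_out_eq_in: "measure P undef_out = measure P undef_in"
proof -
  have s1: "{\<omega> \<in> space P. (u, v) \<in> Mlim \<omega>} \<in> sets P" for u v by measurable
  then have [measurable]: "{\<omega>. (u, v) \<in> Mlim \<omega>} \<in> sets P" for u v by simp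
  have "emeasure P (space P - undef_out) = emeasure P (\<Union>v. {\<omega>. (0, v) \<in> Mlim \<omega>})"
    by (intro arg_cong[where f = "emeasure P"]) (auto simp: undef_out_def)
  also have "\<dots> = (\<Sum>\<^sup>+v. emeasure P {\<omega>. (0, v) \<in> Mlim \<omega>})"
    by (intro emeasure_UN_countable) (use sets_Mlim in \<open>auto simp: disjoint_family_on_def dest: Mlim_functional(1)\<close>)
  also have "\<dots> = (\<Sum>\<^sup>+v. emeasure P {\<omega>. (- v, 0) \<in> Mlim \<omega>})"
  proof (rule nn_integral_cong)
    fix v
    have "measure P {\<omega>. (0, v) \<in> Mlim \<omega>} = measure P {\<omega>. sft v \<omega> \<in> {\<omega>. (0, v) \<in> Mlim \<omega>}}"
      by (rule measure_sft[symmetric]) simp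
    also have "{\<omega>. sft v \<omega> \<in> {\<omega>. (0, v) \<in> Mlim \<omega>}} = {\<omega>. (- v, 0) \<in> Mlim \<omega>}"
      by (simp add: Mlim_sft mem_translate)
    finally show "emeasure P {\<omega>. (0, v) \<in> Mlim \<omega>} = emeasure P {\<omega>. (- v, 0) \<in> Mlim \<omega>}"
      by (simp add: P.emeasure_eq_measure)
  qed
  also have "\<dots> = (\<Sum>\<^sup>+v. emeasure P {\<omega>. (v, 0) \<in> Mlim \<omega>})"
    by (rule nn_integral_uminus)
  also have "\<dots> = emeasure P (\<Union>v. {\<omega>. (v, 0) \<in> Mlim \<omega>})"
    by (intro emeasure_UN_countable[symmetric]) (use sets_Mlim in \<open>auto simp: disjoint_family_on_def dest: Mlim_functional(2)\<close>)
  also have "\<dots> = emeasure P (space P - undef_in)"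
    by (intro arg_cong[where f = "emeasure P"]) (auto simp: undef_in_def)
  finally have "measure P (space P - undef_out) = measure P (space P - undef_in)"
    by (simp add: measure_def)
  then show ?thesis using P.prob_compl[of undef_out] P.prob_compl[of undef_in] by simp
qed

lemma Mlim_total: "AE \<omega> in P. \<forall>v. v \<in> Domain (Mlim \<omega>) \<and> v \<in> Range (Mlim \<omega>)"
proof -
  have "measure P undef_out = 0" "measure P undef_in = 0"
    using undef_product undef_out_eq_in by auto
  then have "AE \<omega> in P. \<omega> \<notin> undef_out" "AE \<omega> in P. \<omega> \<notin> undef_in"
    by (auto intro!: AE_not_in null_setsI simp: P.emeasure_eq_measure)
  then have "AE \<omega> in P. \<omega> \<notin> undef_out \<and> \<omega> \<notin> undef_in" by auto
  then have "AE \<omega> in P. \<forall>l. sft l \<omega> \<notin> undef_out \<and> sft l \<omega> \<notin> undef_in" by (rule AE_sft)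
  then show ?thesis
  proof (rule AE_mp, intro AE_I2 impI allI)
    fix \<omega> v assume *: "\<forall>l. sft l \<omega> \<notin> undef_out \<and> sft l \<omega> \<notin> undef_in"
    show "v \<in> Domain (Mlim \<omega>) \<and> v \<in> Range (Mlim \<omega>)"
      using *[THEN spec, of "- v"] by (simp add: sft_undef)
  qed
qed

lemma Mlim_edges: "(u, v) \<in> Mlim \<omega> \<Longrightarrow> \<exists>k. fst k = b \<and> v = u + el k \<and> (u, k) \<in> onset \<omega>"
  unfolding Mlim_def by (drule matching_lim_edges) (force simp: coins_def el_def)

lemma Mlim_disjoint: "Mlim \<omega> \<inter> H \<omega> = {}"
  unfolding Mlim_def by (rule matching_lim_disjoint)

lemma forest_Mlim: "forest (H \<omega>) \<Longrightarrow> forest (H \<omega> \<union> Mlim \<omega>)"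
  unfolding Mlim_def by (rule forest_matching_lim)

end

text \<open>The re-rooting map is cut into pieces on which it is a single translation. Moving the
  piece for \<open>g\<close> by \<open>T g\<close> gives the part of \<open>C\<close> where
  \<open>\<theta> x (- g) = 0\<close>, and these parts partition \<open>C\<close> because 0 has
  exactly one preimage under \<open>\<theta> x\<close>.\<close>

lemma equivariant_permutation_measure_preserving:
  fixes T :: "'g::{countable,group_add} \<Rightarrow> 'a \<Rightarrow> 'a" and \<theta> :: "'a \<Rightarrow> 'g \<Rightarrow> 'g"
  assumes T[measurable]: "\<And>l. T l \<in> M \<rightarrow>\<^sub>M M" and mp: "\<And>l. distr M M (T l) = M"
    and inv: "\<And>l x. x \<in> space M \<Longrightarrow> T (- l) (T l x) = x"
    and \<theta>: "\<And>u v. {x \<in> space M. \<theta> x u = v} \<in> sets M"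
    and equi: "\<And>x l v. x \<in> space M \<Longrightarrow> \<theta> (T l x) (l + v) = l + \<theta> x v"
    and bij: "\<And>x. x \<in> space M \<Longrightarrow> bij (\<theta> x)"
  shows "(\<lambda>x. T (- \<theta> x 0) x) \<in> M \<rightarrow>\<^sub>M M" "distr M M (\<lambda>x. T (- \<theta> x 0) x) = M"
proof -
  note [measurable] = \<theta>
  have sp: "T l x \<in> space M" if "x \<in> space M" for l x
    using measurable_space[OF T] that .
  have vim: "(\<lambda>x. T (- \<theta> x 0) x) -` C \<inter> space M = (\<Union>g. {x \<in> space M. \<theta> x 0 = g} \<inter> (T (- g) -` C \<inter> space M))" for C
    by auto
  show meas: "(\<lambda>x. T (- \<theta> x 0) x) \<in> M \<rightarrow>\<^sub>M M"
  proof (rule measurableI)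
    fix C assume [measurable]: "C \<in> sets M"
    show "(\<lambda>x. T (- \<theta> x 0) x) -` C \<inter> space M \<in> sets M" unfolding vim by measurable
  qed (use sp in auto)
  show "distr M M (\<lambda>x. T (- \<theta> x 0) x) = M"
  proof (rule measure_eqI)
    fix C assume "C \<in> sets (distr M M (\<lambda>x. T (- \<theta> x 0) x))"
    then have C[measurable]: "C \<in> sets M" by simp
    have "emeasure (distr M M (\<lambda>x. T (- \<theta> x 0) x)) C = emeasure M ((\<lambda>x. T (- \<theta> x 0) x) -` C \<inter> space M)"
      using meas C by (rule emeasure_distr)
    also have "\<dots> = (\<Sum>\<^sup>+g. emeasure M ({x \<in> space M. \<theta> x 0 = g} \<inter> (T (- g) -` C \<inter> space M)))"
      unfolding vim by (intro emeasure_UN_countable) (auto simp: disjoint_family_on_def)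
    also have "\<dots> = (\<Sum>\<^sup>+g. emeasure M ({x \<in> space M. \<theta> x (- g) = 0} \<inter> C))"
    proof (rule nn_integral_cong)
      fix g
      have "emeasure M ({x \<in> space M. \<theta> x 0 = g} \<inter> (T (- g) -` C \<inter> space M))
        = emeasure (distr M M (T g)) ({x \<in> space M. \<theta> x 0 = g} \<inter> (T (- g) -` C \<inter> space M))"
        by (simp add: mp)
      also have "\<dots> = emeasure M (T g -` ({x \<in> space M. \<theta> x 0 = g} \<inter> (T (- g) -` C \<inter> space M)) \<inter> space M)"
        by (rule emeasure_distr) auto
      also have "T g -` ({x \<in> space M. \<theta> x 0 = g} \<inter> (T (- g) -` C \<inter> space M)) \<inter> space M = {x \<in> space M. \<theta> x (- g) = 0} \<inter> C"
      proof -
        have "\<theta> (T g x) 0 = g \<longleftrightarrow> \<theta> x (- g) = 0" if "x \<in> space M" for x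
          
        proof -
          have "\<theta> (T g x) 0 = g + \<theta> x (- g)" using equi[OF that, of g "- g"] by (simp only: right_minus)
          then show ?thesis using add_left_cancel[of g "\<theta> x (- g)" 0] by (simp only: add_0_right)
        qed
        then show ?thesis using sp inv sets.sets_into_space[OF C] by auto
      qed
      finally show "emeasure M ({x \<in> space M. \<theta> x 0 = g} \<inter> (T (- g) -` C \<inter> space M)) = emeasure M ({x \<in> space M. \<theta> x (- g) = 0} \<inter> C)" .
    qed
    also have "\<dots> = (\<Sum>\<^sup>+g. emeasure M ({x \<in> space M. \<theta> x g = 0} \<inter> C))"
      by (rule nn_integral_uminus)
    also have "\<dots> = emeasure M (\<Union>g. {x \<in> space M. \<theta> x g = 0} \<inter> C)"
    proof (intro emeasure_UN_countable[symmetric])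
      have "g = h" if "x \<in> space M" "\<theta> x g = 0" "\<theta> x h = 0" for x g h
        using injD[OF bij_is_inj[OF bij[OF that(1)]], of g h] that by simp
      then show "disjoint_family (\<lambda>g. {x \<in> space M. \<theta> x g = 0} \<inter> C)"
        unfolding disjoint_family_on_def by blast
    qed auto
    also have "(\<Union>g. {x \<in> space M. \<theta> x g = 0} \<inter> C) = C"
    proof -
      have "\<exists>g. \<theta> x g = 0" if "x \<in> C" for x
        using bij_is_surj[OF bij, of x] sets.sets_into_space[OF C] that by (metis subsetD surjD)
      then show ?thesis using sets.sets_into_space[OF C] by auto
    qed
    finally show "emeasure (distr M M (\<lambda>x. T (- \<theta> x 0) x)) C = emeasure M C" .
  qed simp
qed

section \<open>The two random permutations\<close>

definition partial_injection :: "('a \<times> 'a) set \<Rightarrow> bool" where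
  "partial_injection R \<longleftrightarrow> (\<forall>u v v'. (u, v) \<in> R \<longrightarrow> (u, v') \<in> R \<longrightarrow> v = v') \<and>
     (\<forall>u u' v. (u, v) \<in> R \<longrightarrow> (u', v) \<in> R \<longrightarrow> u = u')"

definition total_graph :: "('a \<times> 'a) set \<Rightarrow> bool" where
  "total_graph R \<longleftrightarrow> (\<forall>v. v \<in> Domain R \<and> v \<in> Range R)"

text \<open>The identity where the relation is not the graph of a permutation, which keeps all maps below
  bijective and equivariant everywhere.\<close>

definition perm_of :: "('a \<times> 'a) set \<Rightarrow> 'a \<Rightarrow> 'a" where
  "perm_of R v = (if total_graph R then (THE w. (v, w) \<in> R) else v)"

lemma perm_of_iff:
  assumes inj: "partial_injection R" and R: "total_graph R"
  shows "perm_of R v = w \<longleftrightarrow> (v, w) \<in> R"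
proof -
  obtain w' where w': "(v, w') \<in> R" using R by (auto simp: total_graph_def)
  have uni: "x = w'" if "(v, x) \<in> R" for x using inj w' that unfolding partial_injection_def by blast
  have "perm_of R v = w'" using R the_equality[where P = "\<lambda>w. (v, w) \<in> R", OF w' uni] by (simp add: perm_of_def)
  then show ?thesis using w' uni by metis
qed

lemma bij_perm_of:
  assumes inj: "partial_injection R" shows "bij (perm_of R)"
proof (cases "total_graph R")
  case True
  note iff = perm_of_iff[OF inj True]
  have "inj (perm_of R)"
  proof (rule injI)
    fix u u' assume "perm_of R u = perm_of R u'"
    then have "(u, perm_of R u') \<in> R" "(u', perm_of R u') \<in> R" using iff by blast+
    then show "u = u'" using inj unfolding partial_injection_def by blast
  qed
  moreover have "surj (perm_of R)"
  proof (unfold surj_def, rule allI)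
    fix w
    obtain v where "(v, w) \<in> R" using True by (auto simp: total_graph_def)
    then have "perm_of R v = w" using iff by simp
    then show "\<exists>v. w = perm_of R v" by (blast intro: sym)
  qed
  ultimately show ?thesis by (rule bijI)
next
  case False
  then have "perm_of R = id" by (auto simp: perm_of_def)
  then show ?thesis by simp
qed

lemma total_graph_translate: "total_graph (translate l R) \<longleftrightarrow> total_graph R"
proof -
  have *: "(\<forall>v. Q (- l + v)) \<longleftrightarrow> (\<forall>v. Q v)" for Q :: "'a \<Rightarrow> bool"
    by (metis minus_add_cancel add.inverse_inverse)
  show ?thesis
    unfolding total_graph_def Domain_translate Range_translate
    by (rule *[of "\<lambda>v. v \<in> Domain R \<and> v \<in> Range R"])
qed

lemma perm_of_translate:
  assumes inj: "partial_injection R"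
  shows "perm_of (translate l R) (l + v) = l + perm_of R v"
proof (cases "total_graph R")
  case True
  have "partial_injection (translate l R)"
    using inj unfolding partial_injection_def mem_translate by (metis add_left_cancel)
  then have "perm_of (translate l R) (l + v) = l + perm_of R v \<longleftrightarrow> (l + v, l + perm_of R v) \<in> translate l R"
    using True by (intro perm_of_iff) (simp_all add: total_graph_translate)
  moreover have "(v, perm_of R v) \<in> R" using perm_of_iff[OF inj True] by blast
  ultimately show ?thesis by (simp add: mem_translate)
qed (simp add: perm_of_def total_graph_translate)

lemma pred_total_graph[measurable]:
  fixes R :: "'x \<Rightarrow> ('a::countable \<times> 'a) set"
  assumes [measurable]: "\<And>u v. Measurable.pred N (\<lambda>\<omega>. (u, v) \<in> R \<omega>)"
  shows "Measurable.pred N (\<lambda>\<omega>. total_graph (R \<omega>))"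
  unfolding total_graph_def Domain_iff Range_iff by measurable

lemma pred_perm_of:
  fixes R :: "'x \<Rightarrow> ('a::countable \<times> 'a) set"
  assumes inj: "\<And>\<omega>. partial_injection (R \<omega>)" and [measurable]: "\<And>u v. Measurable.pred N (\<lambda>\<omega>. (u, v) \<in> R \<omega>)"
  shows "Measurable.pred N (\<lambda>\<omega>. perm_of (R \<omega>) u = v)"
proof -
  have "(\<lambda>\<omega>. perm_of (R \<omega>) u = v) = (\<lambda>\<omega>. if total_graph (R \<omega>) then (u, v) \<in> R \<omega> else u = v)"
    using perm_of_iff[OF inj] by (auto simp: perm_of_def fun_eq_iff)
  then show ?thesis by simp
qed

context percolation
begin

definition Ma where "Ma \<omega> = matching_lim snd (coins False \<omega>) {}"
definition Mc where "Mc \<omega> = matching_lim snd (coins True \<omega>) (Ma \<omega>)"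

lemma stage_a: "percolation_stage V P p \<rho> K On False (\<lambda>_. {})"
  by unfold_locales (auto simp: translate_def)

interpretation A: percolation_stage V P p \<rho> K On False "\<lambda>_. {}"
  by (rule stage_a)

lemma A_Mlim: "A.Mlim = Ma"
  by (simp add: fun_eq_iff A.Mlim_def Ma_def)

lemma Ma_cong:
  assumes "\<And>v s. \<omega> (v, (False, s)) = \<omega>' (v, (False, s))" shows "Ma \<omega> = Ma \<omega>'"
proof -
  have "coins False \<omega> = coins False \<omega>'" using assms by (auto simp: coins_def onset_def)
  then show ?thesis by (simp add: Ma_def)
qed

lemma stage_c: "percolation_stage V P p \<rho> K On True Ma"
proof unfold_locales
  show "Measurable.pred P (\<lambda>\<omega>. (u, v) \<in> Ma \<omega>)" for u v
    using A.pred_Mlim unfolding A_Mlim .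
  show "Ma (sft l \<omega>) = translate l (Ma \<omega>)" for l \<omega>
    using A.Mlim_sft unfolding A_Mlim .
  show "Ma \<omega> = Ma \<omega>'" if "\<And>v b' s. b' \<noteq> True \<Longrightarrow> \<omega> (v, b', s) = \<omega>' (v, b', s)" for \<omega> \<omega>'
    by (rule Ma_cong) (simp add: that)
  show "\<exists>k. fst k \<noteq> True \<and> v = u + el k \<and> (u, k) \<in> onset \<omega>" if "(u, v) \<in> Ma \<omega>" for u v \<omega>
    using A.Mlim_edges[of u v \<omega>] that unfolding A_Mlim by auto
qed

interpretation C: percolation_stage V P p \<rho> K On True Ma
  by (rule stage_c)

lemma C_Mlim: "C.Mlim = Mc"
  by (simp add: fun_eq_iff C.Mlim_def Mc_def)

lemmas Ma_sft = A.Mlim_sft[unfolded A_Mlim]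
  and Ma_functional = A.Mlim_functional[unfolded A_Mlim]
  and Ma_edges = A.Mlim_edges[unfolded A_Mlim]
  and pred_Ma[measurable] = A.pred_Mlim[unfolded A_Mlim]
  and Mc_sft = C.Mlim_sft[unfolded C_Mlim]
  and Mc_functional = C.Mlim_functional[unfolded C_Mlim]
  and pred_Mc[measurable] = C.pred_Mlim[unfolded C_Mlim]
  and Ma_Mc_disjoint = C.Mlim_disjoint[unfolded C_Mlim]

lemma inj_Ma: "partial_injection (Ma \<omega>)" and inj_Mc: "partial_injection (Mc \<omega>)"
  unfolding partial_injection_def using Ma_functional Mc_functional by blast+

lemma forest_Ma_Mc: "forest (Ma \<omega> \<union> Mc \<omega>)"
proof -
  have "forest (Ma \<omega>)" using A.forest_Mlim[of \<omega>] by (simp add: forest_def A_Mlim)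
  then show ?thesis using C.forest_Mlim unfolding C_Mlim by blast
qed

definition Good where "Good = {\<omega>. total_graph (Ma \<omega>) \<and> total_graph (Mc \<omega>)}"

definition pa where "pa \<omega> = perm_of (Ma \<omega>)"
definition pc where "pc \<omega> = perm_of (Mc \<omega>)"

lemma sets_Good[measurable]: "Good \<in> sets P"
proof -
  have "{\<omega> \<in> space P. total_graph (Ma \<omega>) \<and> total_graph (Mc \<omega>)} \<in> sets P" by measurable
  then show ?thesis by (simp add: Good_def)
qed

lemma AE_Good: "AE \<omega> in P. \<omega> \<in> Good"
  using A.Mlim_total C.Mlim_total unfolding A_Mlim C_Mlim Good_def total_graph_def by eventually_elim auto

lemma pa_iff: "\<omega> \<in> Good \<Longrightarrow> pa \<omega> v = w \<longleftrightarrow> (v, w) \<in> Ma \<omega>"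
  by (simp add: Good_def pa_def perm_of_iff inj_Ma)

lemma pc_iff: "\<omega> \<in> Good \<Longrightarrow> pc \<omega> v = w \<longleftrightarrow> (v, w) \<in> Mc \<omega>"
  by (simp add: Good_def pc_def perm_of_iff inj_Mc)

lemma bij_pa: "bij (pa \<omega>)" and bij_pc: "bij (pc \<omega>)"
  by (simp_all add: pa_def pc_def bij_perm_of inj_Ma inj_Mc)

lemma pa_sft: "pa (sft l \<omega>) (l + v) = l + pa \<omega> v"
  by (simp add: pa_def Ma_sft perm_of_translate inj_Ma)

lemma pc_sft: "pc (sft l \<omega>) (l + v) = l + pc \<omega> v"
  by (simp add: pc_def Mc_sft perm_of_translate inj_Mc)

lemma pred_pa[measurable]: "Measurable.pred P (\<lambda>\<omega>. pa \<omega> u = v)"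
  unfolding pa_def by (intro pred_perm_of inj_Ma) measurable

lemma pred_pc[measurable]: "Measurable.pred P (\<lambda>\<omega>. pc \<omega> u = v)"
  unfolding pc_def by (intro pred_perm_of inj_Mc) measurable

lemma pa_pc_free:
  assumes "\<omega> \<in> Good" "reduced_word w" "w \<noteq> []"
  shows "word_act UNIV (pa \<omega>) (pc \<omega>) w v \<noteq> v"
proof (rule reduced_word_acts_freely[OF bij_pa bij_pc _ _ assms(2,3)])
  have "{(v, pa \<omega> v) |v. True} = Ma \<omega>" "{(v, pc \<omega> v) |v. True} = Mc \<omega>"
    using pa_iff[OF assms(1)] pc_iff[OF assms(1)] by (auto, metis+)
  then show "forest ({(v, pa \<omega> v) |v. True} \<union> {(v, pc \<omega> v) |v. True})"
    using forest_Ma_Mc by simp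
  show "pa \<omega> v \<noteq> pc \<omega> v" for v
  proof
    assume eq: "pa \<omega> v = pc \<omega> v"
    have "(v, pa \<omega> v) \<in> Ma \<omega>" "(v, pc \<omega> v) \<in> Mc \<omega>" using pa_iff[OF assms(1)] pc_iff[OF assms(1)] by blast+
    then have "(v, pa \<omega> v) \<in> Ma \<omega> \<inter> Mc \<omega>" by (simp add: eq)
    then show False using Ma_Mc_disjoint by blast
  qed
qed

section \<open>The orbit of the origin under the first generator\<close>

definition orb where "orb n \<omega> = (pa \<omega> ^^ n) 0"

text \<open>Freeness applied to a positive power of the first generator.\<close>

lemma orb_inj:
  assumes "\<omega> \<in> Good" "m < n" shows "orb m \<omega> \<noteq> orb n \<omega>"
proof -
  let ?w = "replicate (n - m) (True, True)"
  have w: "word_act UNIV f g (replicate k (True, True)) x = (f ^^ k) x" for f g :: "'g \<Rightarrow> 'g" and k x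
    by (induction k) (auto simp: letter_act_def)
  have "reduced_word (replicate k (True, True))" for k
    by (induction k rule: induct_nat_012) auto
  then have "word_act UNIV (pa \<omega>) (pc \<omega>) ?w (orb m \<omega>) \<noteq> orb m \<omega>"
    using assms by (intro pa_pc_free) auto
  moreover have "(pa \<omega> ^^ (n - m)) (orb m \<omega>) = orb n \<omega>"
    using assms(2) by (simp add: orb_def funpow_add[THEN fun_cong, symmetric, unfolded comp_def])
  ultimately show ?thesis by (metis w)
qed

lemma bij_pa_pow: "bij (pa \<omega> ^^ n)"
  by (induction n) (simp_all only: funpow.simps bij_id bij_comp bij_pa)

lemma pa_pow_sft: "(pa (sft l \<omega>) ^^ n) (l + v) = l + (pa \<omega> ^^ n) v"
  by (induction n) (auto simp: pa_sft)

lemma pred_pa_pow[measurable]: "Measurable.pred P (\<lambda>\<omega>. (pa \<omega> ^^ n) u = v)"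
proof (induction n arbitrary: v)
  case (Suc n)
  note [measurable] = Suc
  have "(\<lambda>\<omega>. (pa \<omega> ^^ Suc n) u = v) = (\<lambda>\<omega>. \<exists>w. (pa \<omega> ^^ n) u = w \<and> pa \<omega> w = v)"
    by auto
  then show ?case by (simp only:) measurable
qed simp

lemma pred_orb[measurable]: "Measurable.pred P (\<lambda>\<omega>. orb n \<omega> = v)"
  unfolding orb_def by measurable

text \<open>Powers of an equivariant permutation are equivariant permutations, so re-rooting along
  the orbit preserves the measure.\<close>

lemma
  shows measurable_orb_act[measurable]: "(\<lambda>\<omega>. sft (- orb n \<omega>) \<omega>) \<in> P \<rightarrow>\<^sub>M P"
    and distr_orb_act: "distr P P (\<lambda>\<omega>. sft (- orb n \<omega>) \<omega>) = P"
proof -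
  have s: "{\<omega> \<in> space P. (pa \<omega> ^^ n) u = v} \<in> sets P" for u v
    by measurable
  note * = equivariant_permutation_measure_preserving[of sft P "\<lambda>\<omega>. pa \<omega> ^^ n",
      OF measurable_sft distr_sft _ s pa_pow_sft bij_pa_pow]
  show "(\<lambda>\<omega>. sft (- orb n \<omega>) \<omega>) \<in> P \<rightarrow>\<^sub>M P" "distr P P (\<lambda>\<omega>. sft (- orb n \<omega>) \<omega>) = P"
    unfolding orb_def using * by (auto simp: sft_sft)
qed

text \<open>On \<open>Good\<close> the orbit visits \<open>g\<close> at most once, so the events
  \<open>orb n \<omega> = g\<close> are disjoint in \<open>n\<close> and have summable
  probabilities.\<close>

lemma orb_escapes:
  assumes "finite F" shows "(\<lambda>n. measure P {\<omega>. orb n \<omega> \<in> F}) \<longlonglongrightarrow> 0"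
proof -
  have s: "{\<omega> \<in> space P. orb n \<omega> = g} \<in> sets P" for n g by measurable
  have one: "(\<lambda>n. measure P {\<omega>. orb n \<omega> = g}) \<longlonglongrightarrow> 0" for g
  proof -
    have eq: "measure P {\<omega>. orb n \<omega> = g} = measure P ({\<omega>. orb n \<omega> = g} \<inter> Good)" for n
      by (intro P.finite_measure_eq_AE) (use AE_Good s in auto)
    have "(\<lambda>n. measure P ({\<omega>. orb n \<omega> = g} \<inter> Good)) sums measure P (\<Union>n. {\<omega>. orb n \<omega> = g} \<inter> Good)"
    proof (rule P.finite_measure_UNION)
      show "disjoint_family (\<lambda>n. {\<omega>. orb n \<omega> = g} \<inter> Good)"
        unfolding disjoint_family_on_def using orb_inj by (fastforce simp: nat_neq_iff)
    qed (use s in auto)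
    then show ?thesis unfolding eq by (intro summable_LIMSEQ_zero sums_summable)
  qed
  have lim: "(\<lambda>n. \<Sum>g\<in>F. measure P {\<omega>. orb n \<omega> = g}) \<longlonglongrightarrow> 0"
    using tendsto_sum[OF one, of "\<lambda>g. g" F] by simp
  have le: "measure P {\<omega>. orb n \<omega> \<in> F} \<le> (\<Sum>g\<in>F. measure P {\<omega>. orb n \<omega> = g})" for n
  proof -
    have "{\<omega>. orb n \<omega> \<in> F} = (\<Union>g\<in>F. {\<omega>. orb n \<omega> = g})" by auto
    then show ?thesis using assms s by (auto intro!: P.finite_measure_subadditive_finite)
  qed
  show ?thesis
    by (rule tendsto_sandwich[OF _ _ tendsto_const lim]) (use le in auto)
qed

end

context percolation
begin

section \<open>Invariant sets\<close>

definition I1 :: "('g \<times> (bool \<times> nat \<times> 'g)) set" where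
  "I1 = {(v, k). \<not> fst k}"

lemma Ma_cong_I1: "(\<And>i. i \<in> I1 \<Longrightarrow> \<omega> i = \<omega>' i) \<Longrightarrow> Ma \<omega> = Ma \<omega>'"
  by (rule Ma_cong) (simp add: I1_def)

lemma orb_cong_I1: "(\<And>i. i \<in> I1 \<Longrightarrow> \<omega> i = \<omega>' i) \<Longrightarrow> orb n \<omega> = orb n \<omega>'"
proof -
  assume "\<And>i. i \<in> I1 \<Longrightarrow> \<omega> i = \<omega>' i"
  then have "Ma \<omega> = Ma \<omega>'" by (rule Ma_cong_I1)
  then show ?thesis by (simp add: orb_def pa_def)
qed

lemma orb_mix: "orb n (mix I1 \<omega> \<omega>') = orb n \<omega>"
  by (rule orb_cong_I1) (simp add: mix_def)

lemma sft_mix_I1: "sft l (mix I1 \<omega> \<omega>') = mix I1 (sft l \<omega>) (sft l \<omega>')"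
  by (auto simp: sft_def mix_def I1_def fun_eq_iff)

text \<open>\<open>cplX\<close> couples the field with its image under the \<open>n\<close>-th power of the first generator; \<open>cplY\<close> does the
  same after resampling all coins of the second generator. The displacements \<open>orb n\<close> escape to
  infinity, so the two couplings agree asymptotically; a set invariant under the first generator
  therefore ignores the resampled coins.\<close>

definition cplX where "cplX n B C = B \<inter> {\<omega>. sft (- orb n \<omega>) \<omega> \<in> C}"
definition cplY where "cplY n B C = {x. fst x \<in> B \<and> sft (- orb n (fst x)) (mix I1 (fst x) (snd x)) \<in> C}"

lemma sets_cplX[measurable]: "B \<in> sets P \<Longrightarrow> C \<in> sets P \<Longrightarrow> cplX n B C \<in> sets P"
  unfolding cplX_def using measurable_sets[OF measurable_orb_act, of C n] by (simp add: vimage_def)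

lemma sets_orb_act: "C \<in> sets P \<Longrightarrow> {\<omega>. sft (- orb n \<omega>) \<omega> \<in> C} \<in> sets P"
  using measurable_sets[OF measurable_orb_act, of C n] by (simp add: vimage_def)

lemma measure_orb_act: "C \<in> sets P \<Longrightarrow> measure P {\<omega>. sft (- orb n \<omega>) \<omega> \<in> C} = measure P C"
  by (subst (2) distr_orb_act[of n, symmetric], subst measure_distr) (auto simp: vimage_def)

text \<open>The orbit reads only coins in \<open>I1\<close>, which \<open>mix I1\<close> retains;
  hence the second condition concerns the mixed field alone.\<close>

lemma cplY_eq: "cplY n B C = {x. fst x \<in> B} \<inter> {x. mix I1 (fst x) (snd x) \<in> {\<omega>. sft (- orb n \<omega>) \<omega> \<in> C}}"
  by (auto simp: cplY_def orb_mix)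

lemma sets_fst: "B \<in> sets P \<Longrightarrow> {x. fst x \<in> B} \<in> sets (P \<Otimes>\<^sub>M P)"
  using measurable_sets[OF measurable_fst, of B P P] by (simp add: vimage_def space_pair_measure)

lemma sets_mix: "B \<in> sets P \<Longrightarrow> {x. mix S (fst x) (snd x) \<in> B} \<in> sets (P \<Otimes>\<^sub>M P)"
  using measurable_sets[OF measurable_mix, of B S] by (simp add: vimage_def space_pair_measure)

lemma sets_cplY[measurable]: "B \<in> sets P \<Longrightarrow> C \<in> sets P \<Longrightarrow> cplY n B C \<in> sets (P \<Otimes>\<^sub>M P)"
  unfolding cplY_eq by (intro sets.Int sets_fst sets_mix sets_orb_act)

lemma measure_fst: "B \<in> sets P \<Longrightarrow> measure (P \<Otimes>\<^sub>M P) {x. fst x \<in> B} = measure P B"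
proof -
  assume B: "B \<in> sets P"
  have "{x. fst x \<in> B} = B \<times> (UNIV :: ('g \<times> (bool \<times> nat \<times> 'g) \<Rightarrow> 'v) set)" by auto
  moreover have "UNIV \<in> sets P" using sets.top[of P] by simp
  ultimately show ?thesis using measure_pair_Times[OF B, of UNIV] P.prob_space by simp
qed

definition cpl where "cpl n B C = measure P (cplX n B C) - measure (P \<Otimes>\<^sub>M P) (cplY n B C)"

text \<open>Both couplings have both marginals equal to \<open>P\<close>. This is the domination
  that \<open>set_function_tendsto_0\<close> asks for.\<close>

lemma cpl_bound:
  assumes "B \<in> sets P" "C \<in> sets P"
  shows "\<bar>cpl n B C\<bar> \<le> 1 * measure P B" "\<bar>cpl n B C\<bar> \<le> 1 * measure P C"
proof -
  have "measure P (cplX n B C) \<le> measure P B"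
    using assms by (intro P.finite_measure_mono) (auto simp: cplX_def)
  moreover have "measure (P \<Otimes>\<^sub>M P) (cplY n B C) \<le> measure (P \<Otimes>\<^sub>M P) {x. fst x \<in> B}"
    using assms by (intro PP.finite_measure_mono sets_fst) (auto simp: cplY_def)
  moreover have "measure P (cplX n B C) \<le> measure P {\<omega>. sft (- orb n \<omega>) \<omega> \<in> C}"
    using assms by (intro P.finite_measure_mono sets_orb_act) (auto simp: cplX_def)
  moreover have "measure (P \<Otimes>\<^sub>M P) (cplY n B C) \<le> measure (P \<Otimes>\<^sub>M P) {x. mix I1 (fst x) (snd x) \<in> {\<omega>. sft (- orb n \<omega>) \<omega> \<in> C}}"
    unfolding cplY_eq using assms by (intro PP.finite_measure_mono sets_mix sets_orb_act) auto
  moreover have "measure (P \<Otimes>\<^sub>M P) {x. mix I1 (fst x) (snd x) \<in> {\<omega>. sft (- orb n \<omega>) \<omega> \<in> C}} = measure P C"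
    using measure_mix[OF sets_orb_act[OF assms(2), of n], where S = I1] measure_orb_act[OF assms(2)] by simp
  ultimately have le: "measure P (cplX n B C) \<le> measure P B" "measure (P \<Otimes>\<^sub>M P) (cplY n B C) \<le> measure P B"
    "measure P (cplX n B C) \<le> measure P C" "measure (P \<Otimes>\<^sub>M P) (cplY n B C) \<le> measure P C"
    using measure_fst[OF assms(1)] measure_orb_act[OF assms(2), of n] by simp_all
  show "\<bar>cpl n B C\<bar> \<le> 1 * measure P B" "\<bar>cpl n B C\<bar> \<le> 1 * measure P C"
    using le measure_nonneg[of P "cplX n B C"] measure_nonneg[of "P \<Otimes>\<^sub>M P" "cplY n B C"]
    unfolding cpl_def mult_1 by linarith+
qed

lemma cpl_add1:
  assumes "disjoint_family B" "range B \<subseteq> sets P" "C \<in> sets P"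
  shows "(\<lambda>i. cpl n (B i) C) sums cpl n (\<Union>i. B i) C"
proof -
  have eq: "cplX n (\<Union>i. B i) C = (\<Union>i. cplX n (B i) C)" "cplY n (\<Union>i. B i) C = (\<Union>i. cplY n (B i) C)"
    by (auto simp: cplX_def cplY_def)
  have "(\<lambda>i. measure P (cplX n (B i) C)) sums measure P (\<Union>i. cplX n (B i) C)"
    using assms by (intro P.finite_measure_UNION) (auto simp: disjoint_family_on_def cplX_def intro!: sets_cplX[unfolded cplX_def])
  moreover have "(\<lambda>i. measure (P \<Otimes>\<^sub>M P) (cplY n (B i) C)) sums measure (P \<Otimes>\<^sub>M P) (\<Union>i. cplY n (B i) C)"
    using assms by (intro PP.finite_measure_UNION) (auto simp: disjoint_family_on_def cplY_def intro!: sets_cplY[unfolded cplY_def])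
  ultimately show ?thesis unfolding cpl_def eq by (rule sums_diff)
qed

lemma cpl_add2:
  assumes "disjoint_family C" "range C \<subseteq> sets P" "B \<in> sets P"
  shows "(\<lambda>i. cpl n B (C i)) sums cpl n B (\<Union>i. C i)"
proof -
  have eq: "cplX n B (\<Union>i. C i) = (\<Union>i. cplX n B (C i))" "cplY n B (\<Union>i. C i) = (\<Union>i. cplY n B (C i))"
    by (auto simp: cplX_def cplY_def)
  have "(\<lambda>i. measure P (cplX n B (C i))) sums measure P (\<Union>i. cplX n B (C i))"
    using assms by (intro P.finite_measure_UNION) (auto simp: disjoint_family_on_def cplX_def intro!: sets_cplX[unfolded cplX_def])
  moreover have "(\<lambda>i. measure (P \<Otimes>\<^sub>M P) (cplY n B (C i))) sums measure (P \<Otimes>\<^sub>M P) (\<Union>i. cplY n B (C i))"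
    using assms by (intro PP.finite_measure_UNION) (auto simp: disjoint_family_on_def cplY_def intro!: sets_cplY[unfolded cplY_def])
  ultimately show ?thesis unfolding cpl_def eq by (rule sums_diff)
qed

lemma cpl_UNIV:
  assumes "B \<in> sets P" shows "cpl n B UNIV = 0" "cpl n UNIV B = 0"
proof -
  show "cpl n B UNIV = 0" using measure_fst[OF assms] by (simp add: cpl_def cplX_def cplY_def)
  show "cpl n UNIV B = 0"
    using measure_mix[OF sets_orb_act[OF assms, of n], where S = I1] by (simp add: cpl_def cplX_def cplY_eq)
qed

text \<open>Once the orbit has left a finite set \<open>G\<close>, the second-generator coins read
  by \<open>C\<close> around \<open>orb n \<omega>\<close> are unrelated to those read by
  \<open>B\<close>, so replacing them by fresh ones changes nothing. The error is at most the
  probability of still being in \<open>G\<close>.\<close>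

lemma cpl_cylinders:
  assumes B: "B \<in> cylinders" and C: "C \<in> cylinders"
  shows "(\<lambda>n. cpl n B C) \<longlonglongrightarrow> 0"
proof -
  obtain I F J F' where I: "B = cyl I F" "finite I" "\<forall>j\<in>I. F j \<in> sets V" and J: "C = cyl J F'" "finite J" "\<forall>j\<in>J. F' j \<in> sets V"
    using B C unfolding cylinders_def by blast
  obtain G where G: "finite G" "\<And>g. g \<notin> G \<Longrightarrow> I \<inter> (\<lambda>(v, k). (g + v, k)) ` J = {}"
    using cyl_disjoint_shift[OF I(2) J(2)] by blast
  define C1 C2 where "C1 = cyl (J \<inter> I1) F'" and "C2 = cyl (J - I1) F'"
  have C12: "C = C1 \<inter> C2" by (auto simp: C1_def C2_def J(1) cyl_def)
  have BC[measurable]: "B \<in> sets P" "C \<in> sets P" "C1 \<in> sets P" "C2 \<in> sets P"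
    using I J by (auto simp: C1_def C2_def intro!: sets_cyl)
  have so: "{\<omega>. orb n \<omega> = g} \<in> sets P" for n g
  proof -
    have "{\<omega> \<in> space P. orb n \<omega> = g} \<in> sets P" by measurable
    then show ?thesis by simp
  qed
  have bound: "\<bar>cpl n B C\<bar> \<le> measure P {\<omega>. orb n \<omega> \<in> G}" for n
  proof -
    define N where "N = {\<omega>. orb n \<omega> \<in> G}"
    \<comment> \<open>For a fixed position \<open>g\<close> of the orbit, \<open>Vg\<close> collects
      everything decided by \<open>I \<union> I1\<close>, and \<open>Wg\<close> collects the
      second-generator conditions around \<open>g\<close>.\<close>
    define Vg where "Vg g = B \<inter> {\<omega>. orb n \<omega> = g} \<inter> {\<omega>. sft (- g) \<omega> \<in> C1}" for g
    define Wg where "Wg g = {\<omega>. sft (- g) \<omega> \<in> C2}" for g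
    have sV: "Vg g \<in> sets P" and sW: "Wg g \<in> sets P" for g
      unfolding Vg_def Wg_def using so sets_sft BC by auto
    have "{\<omega> \<in> space P. \<exists>g\<in>G. orb n \<omega> = g} \<in> sets P" using G(1) by measurable
    then have sN[measurable]: "N \<in> sets P" by (simp add: N_def)
    have X: "cplX n B C - N = (\<Union>g\<in>- G. Vg g \<inter> Wg g)"
      by (auto simp: cplX_def N_def Vg_def Wg_def C12)
    have m1: "sft (- g) (mix I1 \<omega> \<omega>') \<in> C1 \<longleftrightarrow> sft (- g) \<omega> \<in> C1" "sft (- g) (mix I1 \<omega> \<omega>') \<in> C2 \<longleftrightarrow> sft (- g) \<omega>' \<in> C2" for g \<omega> \<omega>'
      unfolding sft_mix_I1 C1_def C2_def by (auto simp: cyl_def mix_def)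
    have Y: "cplY n B C - {x. fst x \<in> N} = (\<Union>g\<in>- G. Vg g \<times> Wg g)"
      by (auto simp: cplY_def N_def Vg_def Wg_def C12 m1)
    have ind: "measure P (Vg g \<inter> Wg g) = measure P (Vg g) * measure P (Wg g)" if "g \<notin> G" for g
    proof (rule depends_on_indep[OF sV sW])
      let ?T = "(\<lambda>(v, k). (g + v, k)) ` (J - I1)"
      show "depends_on ?T (Wg g)"
        unfolding Wg_def using depends_on_sft[OF depends_on_cyl, of "- g" "J - I1" F'] by (simp add: C2_def)
      have "depends_on I1 {\<omega>. orb n \<omega> = g}" unfolding depends_on_def using orb_cong_I1 by (metis mem_Collect_eq)
      moreover have "depends_on ((\<lambda>(v, k). (g + v, k)) ` (J \<inter> I1)) {\<omega>. sft (- g) \<omega> \<in> C1}"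
        using depends_on_sft[OF depends_on_cyl, of "- g" "J \<inter> I1" F'] by (simp add: C1_def)
      moreover have "depends_on I B" unfolding I(1) by (rule depends_on_cyl)
      ultimately show "depends_on (I \<union> I1) (Vg g)"
        unfolding Vg_def by (intro depends_on_Int) (erule depends_on_mono, force simp: I1_def)+
      show "(I \<union> I1) \<inter> ?T = {}"
        using G(2)[OF that] by (auto simp: I1_def)
    qed
    have "emeasure P (cplX n B C - N) = (\<integral>\<^sup>+g. emeasure P (Vg g \<inter> Wg g) \<partial>count_space (- G))"
      unfolding X by (intro emeasure_UN_countable) (use sV sW in \<open>auto simp: disjoint_family_on_def Vg_def\<close>)
    also have "\<dots> = (\<integral>\<^sup>+g. emeasure (P \<Otimes>\<^sub>M P) (Vg g \<times> Wg g) \<partial>count_space (- G))"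
      by (intro nn_integral_cong) (simp add: P.emeasure_eq_measure PP.emeasure_eq_measure ind measure_pair_Times sV sW)
    also have "\<dots> = emeasure (P \<Otimes>\<^sub>M P) (cplY n B C - {x. fst x \<in> N})"
      unfolding Y by (intro emeasure_UN_countable[symmetric]) (use sV sW in \<open>auto simp: disjoint_family_on_def Vg_def\<close>)
    finally have eq: "measure P (cplX n B C - N) = measure (P \<Otimes>\<^sub>M P) (cplY n B C - {x. fst x \<in> N})"
      by (simp add: measure_def)
    have "measure P (cplX n B C) = measure P (cplX n B C - N) + measure P (cplX n B C \<inter> N)"
      by (subst P.finite_measure_Union[symmetric]) (auto intro!: arg_cong[where f = "measure P"])
    moreover have "measure (P \<Otimes>\<^sub>M P) (cplY n B C) = measure (P \<Otimes>\<^sub>M P) (cplY n B C - {x. fst x \<in> N})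
        + measure (P \<Otimes>\<^sub>M P) (cplY n B C \<inter> {x. fst x \<in> N})"
      using sets_fst[OF sN] by (subst PP.finite_measure_Union[symmetric]) (auto intro!: arg_cong[where f = "measure (P \<Otimes>\<^sub>M P)"])
    moreover have "measure P (cplX n B C \<inter> N) \<le> measure P N"
      by (intro P.finite_measure_mono) auto
    moreover have "measure (P \<Otimes>\<^sub>M P) (cplY n B C \<inter> {x. fst x \<in> N}) \<le> measure P N"
      unfolding measure_fst[OF sN, symmetric] by (intro PP.finite_measure_mono sets_fst) auto
    ultimately show ?thesis
      using eq unfolding cpl_def N_def[symmetric] by (smt (verit) measure_nonneg)
  qed
  show ?thesis
    by (rule tendsto_0_le[OF orb_escapes[OF G(1)], of _ 1]) (use bound in \<open>auto intro!: always_eventually\<close>)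
qed

lemma cpl_tendsto:
  assumes B: "B \<in> sets P" and C: "C \<in> sets P"
  shows "(\<lambda>n. cpl n B C) \<longlonglongrightarrow> 0"
proof -
  have sub: "cylinders \<subseteq> Pow (space P)" "cylinders \<subseteq> sets P" by (auto simp: cylinders_def intro: sets_cyl)
  have fin: "finite_measure P" by (rule P.finite_measure_axioms)
  have step: "(\<lambda>n. cpl n B C) \<longlonglongrightarrow> 0" if "B \<in> sets P" "C \<in> cylinders" for B C
    by (rule set_function_tendsto_0[OF fin Int_stable_cylinders sub(1) sets_P_cylinders, where \<phi> = "\<lambda>n B. cpl n B C" and K = 1])
      (use that sub cpl_add1 cpl_bound cpl_cylinders cpl_UNIV in \<open>auto simp del: mult_1\<close>)
  show ?thesis
    by (rule set_function_tendsto_0[OF fin Int_stable_cylinders sub(1) sets_P_cylinders, where \<phi> = "\<lambda>n C. cpl n B C" and K = 1])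
      (use assms sub cpl_add2 cpl_bound step cpl_UNIV in \<open>auto simp del: mult_1\<close>)
qed

lemma orbit_invariant:
  assumes "AE \<omega> in P. \<omega> \<in> A \<longleftrightarrow> sft (- pa \<omega> 0) \<omega> \<in> A"
  shows "AE \<omega> in P. \<forall>v. sft (- v) \<omega> \<in> A \<longleftrightarrow> sft (- pa \<omega> v) \<omega> \<in> A"
  using AE_sft[OF assms]
proof (rule AE_mp, intro AE_I2 impI allI)
  fix \<omega> v assume "\<forall>l. sft l \<omega> \<in> A \<longleftrightarrow> sft (- pa (sft l \<omega>) 0) (sft l \<omega>) \<in> A"
  then have "sft (- v) \<omega> \<in> A \<longleftrightarrow> sft (- pa (sft (- v) \<omega>) 0) (sft (- v) \<omega>) \<in> A" by blast
  moreover have "pa (sft (- v) \<omega>) 0 = - v + pa \<omega> v" using pa_sft[of "- v" \<omega> v] by simp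
  moreover have "- (- v + pa \<omega> v) + - v = - pa \<omega> v" by (simp only: minus_add minus_minus add.assoc right_minus add_0_right)
  ultimately show "sft (- v) \<omega> \<in> A \<longleftrightarrow> sft (- pa \<omega> v) \<omega> \<in> A" by (simp add: sft_sft)
qed

text \<open>For an invariant \<open>A\<close> both couplings are constant in \<open>n\<close> up to
  null sets. Their asymptotic agreement shows that \<open>\<omega>\<close> and its resampling lie in
  \<open>A\<close> simultaneously, almost surely.\<close>

lemma invariant_reduces_to_I1:
  assumes A[measurable]: "A \<in> sets P" and inv: "AE \<omega> in P. \<omega> \<in> A \<longleftrightarrow> sft (- pa \<omega> 0) \<omega> \<in> A"
  obtains A1 where "A1 \<in> sets P" "depends_on I1 A1" "AE \<omega> in P. \<omega> \<in> A \<longleftrightarrow> \<omega> \<in> A1"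
proof -
  have orbinv: "AE \<omega> in P. \<forall>n. \<omega> \<in> A \<longleftrightarrow> sft (- orb n \<omega>) \<omega> \<in> A"
    using orbit_invariant[OF inv]
  proof (rule AE_mp, intro AE_I2 impI allI)
    fix \<omega> n assume *: "\<forall>v. sft (- v) \<omega> \<in> A \<longleftrightarrow> sft (- pa \<omega> v) \<omega> \<in> A"
    show "\<omega> \<in> A \<longleftrightarrow> sft (- orb n \<omega>) \<omega> \<in> A"
      by (induction n) (use * in \<open>auto simp: orb_def\<close>)
  qed
  let ?Y = "{x. fst x \<in> A \<and> mix I1 (fst x) (snd x) \<in> A}"
  have sY: "?Y \<in> sets (P \<Otimes>\<^sub>M P)"
    using sets.Int[OF sets_fst[OF A] sets_mix[OF A, of I1]] by (simp add: Collect_conj_eq)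
  have X: "measure P (cplX n A A) = measure P A" for n
  proof (rule P.finite_measure_eq_AE)
    show "AE \<omega> in P. \<omega> \<in> cplX n A A \<longleftrightarrow> \<omega> \<in> A"
      using orbinv by eventually_elim (auto simp: cplX_def)
  qed auto
  have "AE x in P \<Otimes>\<^sub>M P. \<forall>n. mix I1 (fst x) (snd x) \<in> A \<longleftrightarrow> sft (- orb n (mix I1 (fst x) (snd x))) (mix I1 (fst x) (snd x)) \<in> A"
    by (rule AE_distrD[OF measurable_mix]) (unfold distr_mix, rule orbinv)
  then have AEY: "AE x in P \<Otimes>\<^sub>M P. x \<in> cplY n A A \<longleftrightarrow> x \<in> ?Y" for n
    by eventually_elim (auto simp: cplY_def orb_mix)
  have Y: "measure (P \<Otimes>\<^sub>M P) (cplY n A A) = measure (P \<Otimes>\<^sub>M P) ?Y" for n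
    by (rule PP.finite_measure_eq_AE[OF AEY]) (use sY in auto)
  have "(\<lambda>n :: nat. measure P A - measure (P \<Otimes>\<^sub>M P) ?Y) \<longlonglongrightarrow> 0"
    using cpl_tendsto[OF A A] unfolding cpl_def X Y .
  then have eq: "measure (P \<Otimes>\<^sub>M P) ?Y = measure P A" by (simp add: LIMSEQ_const_iff)
  have "measure (P \<Otimes>\<^sub>M P) ({x. fst x \<in> A} - ?Y) = 0"
    using eq measure_fst[OF A] by (subst PP.finite_measure_Diff) (auto intro: sets_fst sY)
  moreover have "measure (P \<Otimes>\<^sub>M P) ({x. mix I1 (fst x) (snd x) \<in> A} - ?Y) = 0"
    using eq measure_mix[OF A, where S = I1] by (subst PP.finite_measure_Diff) (auto intro: sets_mix sY)
  ultimately have "AE x in P \<Otimes>\<^sub>M P. x \<notin> {x. fst x \<in> A} - ?Y" "AE x in P \<Otimes>\<^sub>M P. x \<notin> {x. mix I1 (fst x) (snd x) \<in> A} - ?Y"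
    by (intro AE_not_in null_setsI sets.Diff sets_fst sets_mix sY A; simp add: PP.emeasure_eq_measure)+
  then have "AE x in P \<Otimes>\<^sub>M P. fst x \<in> A \<longleftrightarrow> mix I1 (fst x) (snd x) \<in> A"
    by eventually_elim auto
  then have "AE \<omega> in P. AE \<omega>' in P. \<omega> \<in> A \<longleftrightarrow> mix I1 \<omega> \<omega>' \<in> A"
    using PP.AE_pair by force
  then have "AE \<omega>' in P. AE \<omega> in P. \<omega> \<in> A \<longleftrightarrow> mix I1 \<omega> \<omega>' \<in> A"
  proof (subst (asm) PP.AE_commute)
    have [measurable]: "{x. fst x \<in> A} \<in> sets (P \<Otimes>\<^sub>M P)" "{x. mix I1 (fst x) (snd x) \<in> A} \<in> sets (P \<Otimes>\<^sub>M P)"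
      by (intro sets_fst sets_mix A)+
    have "{x \<in> space (P \<Otimes>\<^sub>M P). x \<in> {x. fst x \<in> A} \<longleftrightarrow> x \<in> {x. mix I1 (fst x) (snd x) \<in> A}} \<in> sets (P \<Otimes>\<^sub>M P)"
      by measurable
    then show "{x \<in> space (P \<Otimes>\<^sub>M P). (fst x \<in> A) = (mix I1 (fst x) (snd x) \<in> A)} \<in> sets (P \<Otimes>\<^sub>M P)"
      by simp
  qed
  \<comment> \<open>By Fubini one resampled field serves almost every \<open>\<omega>\<close>.
    Freezing it yields a version of \<open>A\<close> that depends on \<open>I1\<close> exactly, not
    just up to null sets.\<close>
  then obtain \<omega>' where \<omega>': "AE \<omega> in P. \<omega> \<in> A \<longleftrightarrow> mix I1 \<omega> \<omega>' \<in> A"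
    using eventually_happens'[OF P.ae_filter_bot] by blast
  let ?A1 = "{\<omega>. mix I1 \<omega> \<omega>' \<in> A}"
  have "?A1 \<in> sets P" using measurable_sets[OF measurable_mix2[of I1 \<omega>'] A] by (simp add: vimage_def)
  moreover have "depends_on I1 ?A1"
    unfolding depends_on_def
  proof (intro allI impI)
    fix \<omega>1 \<omega>2 :: "'g \<times> (bool \<times> nat \<times> 'g) \<Rightarrow> 'v" assume "\<forall>i\<in>I1. \<omega>1 i = \<omega>2 i"
    then have "mix I1 \<omega>1 \<omega>' = mix I1 \<omega>2 \<omega>'" by (auto simp: mix_def fun_eq_iff)
    then show "(\<omega>1 \<in> ?A1) = (\<omega>2 \<in> ?A1)" by simp
  qed
  moreover have "AE \<omega> in P. \<omega> \<in> A \<longleftrightarrow> \<omega> \<in> ?A1" using \<omega>' by simp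
  ultimately show ?thesis by (rule that)
qed

end

section \<open>Displacements by the second generator and ergodicity\<close>

context percolation
begin

interpretation C: percolation_stage V P p \<rho> K On True Ma
  by (rule stage_c)

text \<open>Borel-Cantelli over trails. Their total weight from \<open>g\<close> is finite because
  \<open>g\<close> has positive weight in the finite sum of \<open>p_Ztot\<close>.\<close>

lemma finite_trails:
  assumes pos: "0 < p (K + j) g"
  shows "AE \<omega> in P. finite {\<gamma>. endp el g \<gamma> = 0 \<and> distinct (coords el g \<gamma>) \<and> set (coords el g \<gamma>) \<subseteq> onset \<omega>}"
proof -
  define T where "T \<gamma> = (if endp el g \<gamma> = 0 \<and> distinct (coords el g \<gamma>) then {\<omega>. set (coords el g \<gamma>) \<subseteq> onset \<omega>} else {})" for \<gamma>
  define A where "A n = (\<Union>\<gamma>\<in>{\<gamma>. to_nat \<gamma> = n}. T \<gamma>)" for n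
  have A_to_nat: "A (to_nat \<gamma>) = T \<gamma>" for \<gamma> by (auto simp: A_def)
  have A_empty: "n \<notin> range (to_nat :: ((bool \<times> nat \<times> 'g) \<times> bool) list \<Rightarrow> nat) \<Longrightarrow> A n = {}" for n by (auto simp: A_def)
  have sT: "T \<gamma> \<in> sets P" for \<gamma> by (auto simp: T_def intro!: sets_onset)
  have sA: "A n \<in> sets P" for n
    by (cases "n \<in> range (to_nat :: ((bool \<times> nat \<times> 'g) \<times> bool) list \<Rightarrow> nat)") (auto simp: A_to_nat sT A_empty)
  have "Ztot g < \<top>"
  proof (rule ccontr)
    assume "\<not> Ztot g < \<top>"
    then have "Ztot g = \<top>" by (simp add: less_top[symmetric])
    then have top: "ennreal (p (K + j) g) * Ztot g = \<top>" using pos by (simp add: ennreal_mult_top)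
    have "ennreal (p (K + j) g) * Ztot g = (\<Sum>\<^sup>+h. ennreal (p (K + j) g) * Ztot g * indicator {g} h)"
      by (simp add: nn_integral_cmult_indicator)
    also have "\<dots> \<le> (\<Sum>\<^sup>+h. ennreal (p (K + j) h) * Ztot h)"
      by (intro nn_integral_mono) (auto split: split_indicator)
    also have "\<dots> \<le> ennreal (2 * \<rho> ^ (K + j))" by (rule p_Ztot)
    finally show False unfolding top by (simp add: top_unique)
  qed
  have "(\<Sum>n. ennreal (measure P (A n))) = (\<Sum>\<^sup>+n. emeasure P (A n))"
    by (simp add: nn_integral_count_space_nat P.emeasure_eq_measure)
  also have "\<dots> = (\<integral>\<^sup>+n. emeasure P (A n) \<partial>count_space (range (to_nat :: ((bool \<times> nat \<times> 'g) \<times> bool) list \<Rightarrow> nat)))"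
    by (intro nn_integral_count_space_eq) (auto simp: A_empty)
  also have "\<dots> = (\<Sum>\<^sup>+\<gamma>. emeasure P (A (to_nat (\<gamma> :: ((bool \<times> nat \<times> 'g) \<times> bool) list))))"
    by (rule nn_integral_bij_count_space[symmetric]) (simp add: bij_betw_def)
  also have "\<dots> \<le> Ztot g"
    unfolding Ztot_def
  proof (intro nn_integral_mono)
    fix \<gamma>
    show "emeasure P (A (to_nat \<gamma>)) \<le> wt \<gamma> * indicator {\<gamma>. endp el g \<gamma> = 0} \<gamma>"
      by (auto simp: A_to_nat T_def emeasure_coords)
  qed
  also have "\<dots> < \<top>" by fact
  finally have "summable (\<lambda>n. measure P (A n))" by (intro summable_suminf_not_top) auto
  then have "AE \<omega> in P. eventually (\<lambda>n. \<omega> \<in> space P - A n) sequentially"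
    by (intro borel_cantelli_AE1 sA) (auto simp: P.emeasure_eq_measure)
  then show ?thesis
  proof (rule AE_mp, intro AE_I2 impI)
    fix \<omega> assume "eventually (\<lambda>n. \<omega> \<in> space P - A n) sequentially"
    then obtain N where N: "\<And>n. n \<ge> N \<Longrightarrow> \<omega> \<notin> A n" by (auto simp: eventually_sequentially)
    have "{\<gamma>. endp el g \<gamma> = 0 \<and> distinct (coords el g \<gamma>) \<and> set (coords el g \<gamma>) \<subseteq> onset \<omega>} \<subseteq> to_nat -` {..<N}"
    proof
      fix \<gamma> assume "\<gamma> \<in> {\<gamma>. endp el g \<gamma> = 0 \<and> distinct (coords el g \<gamma>) \<and> set (coords el g \<gamma>) \<subseteq> onset \<omega>}"
      then have "\<omega> \<in> A (to_nat \<gamma>)" by (auto simp: A_to_nat T_def)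
      then show "\<gamma> \<in> to_nat -` {..<N}" using N by (force simp: not_le[symmetric])
    qed
    then show "finite {\<gamma>. endp el g \<gamma> = 0 \<and> distinct (coords el g \<gamma>) \<and> set (coords el g \<gamma>) \<subseteq> onset \<omega>}"
      by (rule finite_subset) (simp add: finite_vimageI)
  qed
qed

text \<open>The graph that remains when the coins in \<open>U\<close> are ignored. Almost surely only finitely many trails
  join two given vertices, so a finite \<open>U\<close> cuts all those that use a coin of the second generator.\<close>

definition off_graph where
  "off_graph U \<omega> = Ma \<omega> \<union> {(u, v). \<exists>s. v = u + snd s \<and> (u, (True, s)) \<in> onset \<omega> \<and> (u, (True, s)) \<notin> U}"

text \<open>\<open>U\<close> collects the second-generator coins of all trails that are on. A
  connection surviving without them would run through first-generator edges alone, against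
  \<open>nc\<close>.\<close>

lemma off_graph_separates:
  assumes fin: "finite {\<gamma>. endp el g \<gamma> = 0 \<and> distinct (coords el g \<gamma>) \<and> set (coords el g \<gamma>) \<subseteq> onset \<omega>}"
    and nc: "(g, 0) \<notin> conn (Ma \<omega>)" and U0: "finite U0"
  obtains U where "finite U" "U0 \<subseteq> U" "U \<inter> I1 \<subseteq> U0" "(g, 0) \<notin> conn (off_graph U \<omega>)"
proof -
  let ?T = "{\<gamma>. endp el g \<gamma> = 0 \<and> distinct (coords el g \<gamma>) \<and> set (coords el g \<gamma>) \<subseteq> onset \<omega>}"
  define U where "U = U0 \<union> (\<Union>\<gamma>\<in>?T. set (coords el g \<gamma>) - I1)"
  have "(g, 0) \<notin> conn (off_graph U \<omega>)"
  proof
    assume c: "(g, 0) \<in> conn (off_graph U \<omega>)"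
    \<comment> \<open>A first-generator coin is retained only if its edge was accepted, so a trail
      in \<open>W\<close> without second-generator coins is a path in
      \<open>Ma \<omega>\<close>.\<close>
    define W where "W = {(u, k) \<in> onset \<omega>. if fst k then (u, k) \<notin> U else (u, u + el k) \<in> Ma \<omega>}"
    have "\<exists>k. v = u + el k \<and> (u, k) \<in> W" if uv: "(u, v) \<in> off_graph U \<omega>" for u v
    proof (cases "(u, v) \<in> Ma \<omega>")
      case True
      then obtain k where "fst k = False" "v = u + el k" "(u, k) \<in> onset \<omega>" using Ma_edges by blast
      then show ?thesis using True by (intro exI[of _ k]) (simp add: W_def)
    next
      case False
      then obtain s where "v = u + snd s" "(u, (True, s)) \<in> onset \<omega>" "(u, (True, s)) \<notin> U"
        using uv by (auto simp: off_graph_def)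
      then show ?thesis by (intro exI[of _ "(True, s)"]) (auto simp: W_def el_def)
    qed
    with c obtain \<gamma> where \<gamma>: "endp el g \<gamma> = 0" "distinct (coords el g \<gamma>)" "set (coords el g \<gamma>) \<subseteq> W"
      by (rule trail_exists) blast+
    have "\<gamma> \<in> ?T" using \<gamma> by (auto simp: W_def)
    then have "set (coords el g \<gamma>) - I1 \<subseteq> U" by (auto simp: U_def)
    then have sub: "(u, u + el k) \<in> Ma \<omega>" if "(u, k) \<in> set (coords el g \<gamma>)" for u k
      using that \<gamma>(3) by (fastforce simp: W_def I1_def split: if_splits)
    have "(x, endp el x \<gamma>) \<in> conn (Ma \<omega>)" if "\<And>u k. (u, k) \<in> set (coords el x \<gamma>) \<Longrightarrow> (u, u + el k) \<in> Ma \<omega>" for x \<gamma>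
      using that
    proof (induction \<gamma> arbitrary: x)
      case (Cons l \<gamma>)
      obtain v k where vk: "src el x l = (v, k)" by (cases "src el x l")
      have "(v, v + el k) \<in> Ma \<omega>" using Cons.prems vk by simp
      then have "(x, nxt el x l) \<in> conn (Ma \<omega>)"
        using src_ends[OF vk] by (auto simp: doubleton_eq_iff intro: conn_edge conn_sym[OF conn_edge])
      moreover have "(nxt el x l, endp el x (l # \<gamma>)) \<in> conn (Ma \<omega>)"
        using Cons.IH[of "nxt el x l"] Cons.prems by simp
      ultimately show ?case by (rule conn_trans)
    qed simp
    then show False using sub \<gamma>(1) nc by metis
  qed
  moreover have "finite U" unfolding U_def using fin U0 by auto
  ultimately show ?thesis using that[of U] by (auto simp: U_def)
qed

lemma pred_off_graph[measurable]: "Measurable.pred P (\<lambda>\<omega>. (x, y) \<in> conn (off_graph U \<omega>))"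
  by (rule pred_conn) (simp add: off_graph_def)

text \<open>With \<open>U\<close> off, earlier slots can occupy neither 0 as a source nor
  \<open>g\<close> as a target, and everything present at time \<open>to_nat (j, g)\<close> apart
  from the edge itself lies in the off graph, where 0 and \<open>g\<close> are separated.\<close>

lemma accepted_edge:
  assumes good: "\<omega> \<in> Good" and nc: "(g, 0) \<notin> conn (off_graph (insert (0, (True, (j, g))) U) \<omega>)"
    and on: "(0, (True, (j, g))) \<in> onset \<omega>" and off: "U \<inter> onset \<omega> = {}"
    and U: "\<And>s. to_nat s < to_nat (j, g) \<Longrightarrow> (0, (True, s)) \<in> U \<and> (g - snd s, (True, s)) \<in> U"
  shows "pc \<omega> 0 = g"
proof -
  let ?n = "to_nat (j, g)" and ?R = "off_graph (insert (0, (True, (j, g))) U) \<omega>"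
  have M: "(u, v) \<in> ?R" if uv: "(u, v) \<in> C.M ?n \<omega>" for u v
  proof -
    obtain s where s: "to_nat s < ?n" "v = u + snd s" "(u, (True, s)) \<in> onset \<omega>"
      using C.M_edges[OF uv] by blast
    then have "(u, (True, s)) \<notin> insert (0, (True, (j, g))) U" using off by auto
    then show ?thesis using s(2,3) unfolding off_graph_def by blast
  qed
  have E: "(u, v) \<in> ?R" if uv: "(u, v) \<in> C.E ?n \<omega>" "(u, v) \<noteq> (0, g)" for u v
  proof -
    obtain s where s: "to_nat s = ?n" "v = u + snd s" "(u, (True, s)) \<in> onset \<omega>"
      using uv(1) unfolding C.mem_E by blast
    then have [simp]: "s = (j, g)" by simp
    have "(u, (True, s)) \<notin> insert (0, (True, (j, g))) U" using off s uv(2) by auto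
    then show ?thesis using s unfolding off_graph_def by blast
  qed
  have "(0, g) \<in> C.Acc ?n \<omega>"
    unfolding C.mem_Acc
  proof (intro conjI allI)
    show "(0, g) \<in> C.E ?n \<omega>" unfolding C.mem_E using on by (intro exI[of _ "(j, g)"]) auto
    show "(0, w) \<notin> C.M ?n \<omega>" for w
      using C.M_edges[of 0 w ?n \<omega>] U off by blast
    show "(w, g) \<notin> C.M ?n \<omega>" for w
    proof
      assume "(w, g) \<in> C.M ?n \<omega>"
      then obtain s where s: "to_nat s < ?n" "g = w + snd s" "(w, (True, s)) \<in> onset \<omega>" using C.M_edges by blast
      then have "g - snd s = w" by simp
      then show False using U[OF s(1)] s(3) off by auto
    qed
    have "(g, 0) \<in> conn ?R" if "(0, g) \<in> Ma \<omega>"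
      by (rule conn_sym[OF conn_edge]) (use that in \<open>simp add: off_graph_def\<close>)
    then show "(0, g) \<notin> Ma \<omega>" using nc by blast
    have sub: "Ma \<omega> \<union> C.M ?n \<omega> \<union> C.E ?n \<omega> - {(0, g)} \<subseteq> ?R"
      using M E by (auto simp: off_graph_def)
    show "(0, g) \<notin> conn (Ma \<omega> \<union> C.M ?n \<omega> \<union> C.E ?n \<omega> - {(0, g)})"
    proof
      assume "(0, g) \<in> conn (Ma \<omega> \<union> C.M ?n \<omega> \<union> C.E ?n \<omega> - {(0, g)})"
      from conn_sym[OF conn_mono[OF this sub]] show False using nc by blast
    qed
  qed
  then have "(0, g) \<in> C.M (Suc ?n) \<omega>" by (simp add: C.M_Suc)
  then have "(0, g) \<in> C.Mlim \<omega>" unfolding C.Mlim_eq by blast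
  then have "(0, g) \<in> Mc \<omega>" by (simp add: C.Mlim_def Mc_def)
  then show ?thesis using pc_iff[OF good] by blast
qed

text \<open>Whether \<open>U\<close> cuts does not depend on the coins in \<open>U\<close>: with positive conditional probability they are
  all off while the coin of the edge from \<open>0\<close> to \<open>g\<close> is on, and then the second generator maps \<open>0\<close> to \<open>g\<close>.\<close>

lemma invariant_null:
  assumes A[measurable]: "A \<in> sets P" and inva: "AE \<omega> in P. \<omega> \<in> A \<longleftrightarrow> sft (- pa \<omega> 0) \<omega> \<in> A"
    and invc: "AE \<omega> in P. \<omega> \<in> A \<longleftrightarrow> sft (- pc \<omega> 0) \<omega> \<in> A"
    and A1[measurable]: "A1 \<in> sets P" and dep: "depends_on I1 A1" and AA1: "AE \<omega> in P. \<omega> \<in> A \<longleftrightarrow> \<omega> \<in> A1"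
    and pos: "0 < p (K + j) g"
  shows "measure P (A1 - {\<omega>. sft (- g) \<omega> \<in> A1}) = 0"
proof (rule ccontr)
  define Y where "Y = A1 - {\<omega>. sft (- g) \<omega> \<in> A1}"
  define i0 where "i0 = (0 :: 'g, (True, (j, g)))"
  assume "measure P (A1 - {\<omega>. sft (- g) \<omega> \<in> A1}) \<noteq> 0"
  then have posY: "measure P Y \<noteq> 0" by (simp add: Y_def)
  have sY[measurable]: "Y \<in> sets P" unfolding Y_def by auto
  have AE: "AE \<omega> in P. \<omega> \<in> Good \<and> (\<omega> \<in> A \<longleftrightarrow> sft (- pc \<omega> 0) \<omega> \<in> A) \<and> (\<forall>l. sft l \<omega> \<in> A \<longleftrightarrow> sft l \<omega> \<in> A1) \<and>
      (\<forall>v. sft (- v) \<omega> \<in> A \<longleftrightarrow> sft (- pa \<omega> v) \<omega> \<in> A)"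
    using AE_Good invc AE_sft[OF AA1] orbit_invariant[OF inva] by eventually_elim auto
  \<comment> \<open>Earlier proposals that leave 0 or arrive at \<open>g\<close>; they must be off
    to keep both ends free.\<close>
  define U0 where "U0 = (\<lambda>s. (0 :: 'g, (True, s))) ` {s. to_nat s < to_nat (j, g)} \<union> (\<lambda>s. (g - snd s, (True, s))) ` {s :: nat \<times> 'g. to_nat s < to_nat (j, g)}"
  have "finite {s :: nat \<times> 'g. to_nat s < to_nat (j, g)}"
    using finite_vimageI[of "{..<to_nat (j, g)}" "to_nat :: nat \<times> 'g \<Rightarrow> nat"] by (simp add: vimage_def)
  then have U0: "finite U0" "U0 \<inter> I1 = {}" "i0 \<notin> U0" by (auto simp: U0_def I1_def i0_def)
  \<comment> \<open>Only countably many candidates, so one deterministic \<open>U\<close> works with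
    positive probability. First-generator coins are excluded because \<open>Y\<close> reads them,
    and \<open>i0\<close> because it is to be on.\<close>
  define Us where "Us = {U. finite U \<and> U0 \<subseteq> U \<and> U \<inter> I1 = {} \<and> i0 \<notin> U}"
  have "countable Us"
    by (rule countable_subset[of _ "{U. finite U}"]) (auto simp: Us_def intro: countable_Collect_finite)
  define Q where "Q U = {\<omega>. (g, 0) \<notin> conn (off_graph (insert i0 U) \<omega>)}" for U
  have sQ[measurable]: "Q U \<in> sets P" for U
  proof -
    have "{\<omega> \<in> space P. (g, 0) \<notin> conn (off_graph (insert i0 U) \<omega>)} \<in> sets P" by measurable
    then show ?thesis by (simp add: Q_def)
  qed
  have "AE \<omega> in P. \<omega> \<in> Y \<longrightarrow> (\<exists>U\<in>Us. \<omega> \<in> Q U)"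
    using AE finite_trails[OF pos]
  proof eventually_elim
    case (elim \<omega>)
    show ?case
    proof
      assume Y: "\<omega> \<in> Y"
      \<comment> \<open>Membership in \<open>A\<close> is constant along orbits of the first
        generator; as it differs at 0 and \<open>g\<close> on \<open>Y\<close>, these two lie on
        different orbits.\<close>
      have cA: "(sft (- x) \<omega> \<in> A) = (sft (- y) \<omega> \<in> A)" if "(x, y) \<in> conn (Ma \<omega>)" for x y
        using that unfolding conn_def
      proof (induction rule: rtrancl_induct)
        case (step y z)
        have "\<omega> \<in> Good" using elim(1) by blast
        then have "pa \<omega> y = z \<or> pa \<omega> z = y" using step(2) pa_iff by auto
        moreover have "(sft (- v) \<omega> \<in> A) = (sft (- pa \<omega> v) \<omega> \<in> A)" for v using elim(1) by blast
        ultimately show ?case using step(3) by metis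
      qed simp
      have nc: "(g, 0) \<notin> conn (Ma \<omega>)"
      proof
        assume "(g, 0) \<in> conn (Ma \<omega>)"
        then have "sft (- g) \<omega> \<in> A \<longleftrightarrow> sft 0 \<omega> \<in> A" using cA by fastforce
        moreover have "sft l \<omega> \<in> A \<longleftrightarrow> sft l \<omega> \<in> A1" for l using elim(1) by blast
        ultimately have "sft (- g) \<omega> \<in> A1 \<longleftrightarrow> \<omega> \<in> A1" by (metis sft_0)
        then show False using Y by (simp add: Y_def)
      qed
      obtain U where U: "finite U" "U0 \<subseteq> U" "U \<inter> I1 \<subseteq> U0" "(g, 0) \<notin> conn (off_graph U \<omega>)"
        using off_graph_separates[OF elim(2) nc U0(1)] by blast
      have "U - {i0} \<in> Us" using U U0 by (auto simp: Us_def)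
      moreover have "off_graph (insert i0 (U - {i0})) \<omega> \<subseteq> off_graph U \<omega>" by (auto simp: off_graph_def)
      then have "\<omega> \<in> Q (U - {i0})" using U(4) conn_mono[of g 0 _ "off_graph U \<omega>"] unfolding Q_def by blast
      ultimately show "\<exists>U\<in>Us. \<omega> \<in> Q U" by blast
    qed
  qed
  then have "measure P Y \<le> measure P (\<Union>U\<in>Us. Y \<inter> Q U)"
    using \<open>countable Us\<close> by (intro P.finite_measure_mono_AE sets.countable_UN'') auto
  then have "measure P (\<Union>U\<in>Us. Y \<inter> Q U) \<noteq> 0" using posY measure_nonneg[of P Y] by linarith
  then obtain U where U: "U \<in> Us" "measure P (Y \<inter> Q U) \<noteq> 0"
  proof -
    have "\<exists>U\<in>Us. measure P (Y \<inter> Q U) \<noteq> 0"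
    proof (rule ccontr)
      assume "\<not> ?thesis"
      then have "(\<Union>U\<in>Us. Y \<inter> Q U) \<in> null_sets P"
        using \<open>countable Us\<close> by (intro null_sets_UN') (auto intro!: null_setsI simp: P.emeasure_eq_measure)
      then show False using \<open>measure P (\<Union>U\<in>Us. Y \<inter> Q U) \<noteq> 0\<close> by (simp add: null_setsD1 measure_def)
    qed
    then show ?thesis using that by blast
  qed
  \<comment> \<open>Only the edge from 0 to \<open>g\<close> is on and all of \<open>U\<close> is
    off: a cylinder of positive measure, independent of \<open>Y \<inter> Q U\<close>.\<close>
  define T where "T = cyl (insert i0 U) (\<lambda>i. if i = i0 then On (snd i) else - On (snd i))"
  have finU: "finite U" and i0U: "i0 \<notin> U" using U(1) by (auto simp: Us_def)
  have cO: "- On k \<in> sets V" for k using sets.compl_sets[OF sets_On[of k]] by (simp add: Compl_eq_Diff_UNIV)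
  have sT: "T \<in> sets P" unfolding T_def using finU cO by (intro sets_cyl) auto
  have mO: "measure V (- On k) = 1 - q k" for k
    using prob_compl[OF sets_On[of k]] measure_On_q[of k] by (simp add: Compl_eq_Diff_UNIV)
  have "measure P T = (\<Prod>i\<in>insert i0 U. measure V (if i = i0 then On (snd i) else - On (snd i)))"
    unfolding T_def using finU cO by (intro measure_cyl) auto
  also have "\<dots> > 0"
  proof (rule prod_pos)
    fix i assume "i \<in> insert i0 U"
    show "0 < measure V (if i = i0 then On (snd i) else - On (snd i))"
      using q_less_1[of "snd i"] pos by (auto simp: mO measure_On_q i0_def q_def)
  qed
  finally have posT: "measure P T > 0" .
  have "measure P ((Y \<inter> Q U) \<inter> T) = measure P (Y \<inter> Q U) * measure P T"
  proof (rule depends_on_indep)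
    show "depends_on (insert i0 U) T" unfolding T_def by (rule depends_on_cyl)
    have I1: "I1 \<subseteq> - insert i0 U" using U(1) by (auto simp: Us_def i0_def I1_def)
    have "depends_on ((\<lambda>(v, k). (- (- g) + v, k)) ` I1) {\<omega>. sft (- g) \<omega> \<in> A1}" by (rule depends_on_sft[OF dep])
    then have "depends_on I1 {\<omega>. sft (- g) \<omega> \<in> A1}" by (rule depends_on_mono) (auto simp: I1_def)
    then have "depends_on I1 Y" unfolding Y_def Diff_eq by (intro depends_on_Int dep depends_on_Compl)
    moreover have "depends_on (- insert i0 U) (Q U)"
      unfolding depends_on_def
    proof (intro allI impI)
      fix \<omega> \<omega>' :: "'g \<times> (bool \<times> nat \<times> 'g) \<Rightarrow> 'v"
      assume eq: "\<forall>i\<in>- insert i0 U. \<omega> i = \<omega>' i"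
      then have "Ma \<omega> = Ma \<omega>'" using I1 by (intro Ma_cong_I1) auto
      moreover have "(u, k) \<in> onset \<omega> \<longleftrightarrow> (u, k) \<in> onset \<omega>'" if "(u, k) \<notin> insert i0 U" for u k
        using eq that by (auto simp: onset_def)
      ultimately have "off_graph (insert i0 U) \<omega> = off_graph (insert i0 U) \<omega>'"
        unfolding off_graph_def by blast
      then show "(\<omega> \<in> Q U) = (\<omega>' \<in> Q U)" by (simp add: Q_def)
    qed
    ultimately show "depends_on (- insert i0 U) (Y \<inter> Q U)"
      using I1 by (intro depends_on_Int) (auto elim: depends_on_mono)
  qed (use sT in auto)
  then have ne: "measure P (Y \<inter> Q U \<inter> T) \<noteq> 0" using U(2) posT by simp
  have "AE \<omega> in P. \<omega> \<notin> Y \<inter> Q U \<inter> T"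
    using AE
  proof eventually_elim
    case (elim \<omega>)
    show ?case
    proof
      assume w: "\<omega> \<in> Y \<inter> Q U \<inter> T"
      have "pc \<omega> 0 = g"
      proof (rule accepted_edge)
        show "\<omega> \<in> Good" using elim by simp
        show "(g, 0) \<notin> conn (off_graph (insert (0, (True, (j, g))) U) \<omega>)"
          using w by (simp add: Q_def i0_def)
        show "(0, (True, (j, g))) \<in> onset \<omega>" using w by (auto simp: T_def cyl_def onset_def i0_def)
        have "\<omega> i \<notin> On (snd i)" if i: "i \<in> U" for i
        proof -
          have "i \<noteq> i0" using i i0U by blast
          moreover have "\<omega> i \<in> (if i = i0 then On (snd i) else - On (snd i))"
            using w i unfolding T_def cyl_def by blast
          ultimately show ?thesis by simp
        qed
        then show "U \<inter> onset \<omega> = {}" by (force simp: onset_def)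
        show "(0, (True, s)) \<in> U \<and> (g - snd s, (True, s)) \<in> U" if "to_nat s < to_nat (j, g)" for s
          using that U(1) by (auto simp: Us_def U0_def)
      qed
      then have "(\<omega> \<in> A1) = (sft (- g) \<omega> \<in> A1)" using elim by (metis sft_0)
      then show False using w by (auto simp: Y_def)
    qed
  qed
  then have "measure P (Y \<inter> Q U \<inter> T) = 0"
    using sT by (subst (asm) AE_iff_measurable[of "Y \<inter> Q U \<inter> T"]) (auto simp: measure_def)
  then show False using ne by simp
qed

text \<open>Mass one with at most \<open>\<rho> ^ (K + j)\<close> at each point needs more and more
  points as \<open>j\<close> grows.\<close>

lemma infinite_support: "infinite {g. \<exists>j. 0 < p (K + j) g}"
proof
  let ?S = "{g. \<exists>j. 0 < p (K + j) g}"
  assume fin: "finite ?S"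
  have "1 \<le> real (card ?S) * \<rho> ^ (K + j)" for j
  proof -
    have "1 = (\<Sum>\<^sup>+g. ennreal (p (K + j) g))" by (simp add: p_sum)
    also have "\<dots> = (\<Sum>g\<in>?S. ennreal (p (K + j) g))"
      using fin p_nonneg by (intro nn_integral_count_space') (auto simp: not_less ennreal_neg)
    also have "\<dots> \<le> (\<Sum>g\<in>?S. ennreal (\<rho> ^ (K + j)))" by (intro sum_mono ennreal_leI p_le)
    also have "\<dots> = ennreal (real (card ?S) * \<rho> ^ (K + j))"
      using \<rho> by (simp add: ennreal_mult ennreal_of_nat_eq_real_of_nat)
    finally show ?thesis by simp
  qed
  moreover have "(\<lambda>j. real (card ?S) * \<rho> ^ (K + j)) \<longlonglongrightarrow> real (card ?S) * 0"
    using \<rho> by (intro tendsto_mult tendsto_const LIMSEQ_ignore_initial_segment[of "\<lambda>n. \<rho> ^ n" 0 K, unfolded add.commute[of _ K]] LIMSEQ_power_zero) auto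
  ultimately have "1 \<le> real (card ?S) * (0::real)" by (intro LIMSEQ_le_const) auto
  then show False by simp
qed

text \<open>For infinitely many \<open>g\<close>, \<open>A1\<close> is contained in its translate up
  to a null set, so the correlation equals \<open>measure P A1\<close>. Mixing says that it tends to
  the square of this number.\<close>

theorem ergodic:
  assumes A: "A \<in> sets P" and inva: "AE \<omega> in P. \<omega> \<in> A \<longleftrightarrow> sft (- pa \<omega> 0) \<omega> \<in> A"
    and invc: "AE \<omega> in P. \<omega> \<in> A \<longleftrightarrow> sft (- pc \<omega> 0) \<omega> \<in> A"
  shows "measure P A = 0 \<or> measure P A = 1"
proof -
  obtain A1 where A1: "A1 \<in> sets P" "depends_on I1 A1" "AE \<omega> in P. \<omega> \<in> A \<longleftrightarrow> \<omega> \<in> A1"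
    using invariant_reduces_to_I1[OF A inva] by blast
  have eq: "measure P A = measure P A1"
    by (rule P.finite_measure_eq_AE[OF A1(3) A A1(1)])
  let ?S = "{g. \<exists>j. 0 < p (K + j) g}"
  have const: "measure P (A1 \<inter> {\<omega>. sft (- g) \<omega> \<in> A1}) = measure P A1" if gS: "g \<in> ?S" for g
  proof -
    obtain j where "0 < p (K + j) g" using gS by blast
    from invariant_null[OF A inva invc A1 this]
    show ?thesis
      using P.finite_measure_Diff'[OF A1(1) sets_sft[OF A1(1), of "- g"]] by simp
  qed
  have "measure P A1 = measure P A1 * measure P A1"
  proof (rule ccontr)
    assume ne: "measure P A1 \<noteq> measure P A1 * measure P A1"
    have "eventually (\<lambda>g. measure P (A1 \<inter> {\<omega>. sft (- g) \<omega> \<in> A1}) \<noteq> measure P A1) cofinite"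
      using mixing[OF A1(1,1)] ne by (intro tendsto_imp_eventually_ne) auto
    then have "finite {g. measure P (A1 \<inter> {\<omega>. sft (- g) \<omega> \<in> A1}) = measure P A1}"
      by (simp add: eventually_cofinite)
    then have "finite ?S" by (rule finite_subset[rotated]) (use const in blast)
    then show False using infinite_support by simp
  qed
  then show ?thesis unfolding eq by simp
qed

end

section \<open>Coin flips inside the unit interval\<close>

definition coin :: "bool measure" where "coin = measure_pmf (bernoulli_pmf (1/2))"

definition coin_seq :: "(nat \<Rightarrow> bool) measure" where "coin_seq = PiM UNIV (\<lambda>_. coin)"

definition unit_lebesgue :: "real measure" where "unit_lebesgue = restrict_space lborel {0..1}"

text \<open>All digits of 1 are \<open>False\<close>, so binary expansions are recovered on
  \<open>[0, 1)\<close> only; the endpoint is a null set.\<close>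

definition digit :: "real \<Rightarrow> nat \<Rightarrow> bool" where "digit u i = odd \<lfloor>2 ^ Suc i * u\<rfloor>"

definition of_bits :: "(nat \<Rightarrow> bool) \<Rightarrow> real" where "of_bits b = (\<Sum>i. of_bool (b i) / 2 ^ Suc i)"

interpretation coin: iid_space coin coin_seq
  unfolding iid_space_def iid_space_axioms_def coin_seq_def by (auto simp: coin_def prob_space_measure_pmf)

lemma sets_coin[simp]: "A \<in> sets coin"
  by (simp add: coin_def)

lemma emeasure_coin_singleton: "emeasure coin {x} = ennreal (1/2)"
  by (simp add: coin_def emeasure_pmf_single)

lemma space_unit_lebesgue[simp]: "space unit_lebesgue = {0..1}"
  by (simp add: unit_lebesgue_def)

lemma prob_unit_lebesgue: "prob_space unit_lebesgue"
  by (rule prob_spaceI) (simp add: unit_lebesgue_def emeasure_restrict_space)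

lemma digit_sums:
  assumes "0 \<le> u" "u < 1" shows "(\<lambda>i. of_bool (digit u i) / 2 ^ Suc i) sums u"
proof -
  \<comment> \<open>The partial sums truncate \<open>u\<close> after \<open>n\<close> binary
    places.\<close>
  have part: "(\<Sum>i<n. of_bool (digit u i) / 2 ^ Suc i) = of_int \<lfloor>2 ^ n * u\<rfloor> / (2 ^ n :: real)" for n
  proof (induction n)
    case 0
    have "\<lfloor>u\<rfloor> = 0" using assms by (simp add: floor_eq_iff)
    then show ?case by simp
  next
    case (Suc n)
    have "\<lfloor>2 ^ n * u\<rfloor> = \<lfloor>2 ^ Suc n * u\<rfloor> div 2"
      using floor_divide_real_eq_div[of 2 "2 ^ Suc n * u"] by simp
    then have "\<lfloor>2 ^ Suc n * u\<rfloor> = 2 * \<lfloor>2 ^ n * u\<rfloor> + of_bool (digit u n)"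
      unfolding digit_def by (simp add: mod_2_eq_odd[symmetric])
    then have "(of_int \<lfloor>2 ^ Suc n * u\<rfloor> :: real) = 2 * of_int \<lfloor>2 ^ n * u\<rfloor> + of_bool (digit u n)"
      by (simp only: of_int_add of_int_mult of_int_numeral of_int_of_bool)
    then show ?case using Suc by (simp add: field_simps)
  qed
  have "(\<lambda>n. of_int \<lfloor>2 ^ n * u\<rfloor> / (2 ^ n :: real)) \<longlonglongrightarrow> u"
  proof (rule tendsto_sandwich)
    show "eventually (\<lambda>n. u - (1/2) ^ n \<le> of_int \<lfloor>2 ^ n * u\<rfloor> / (2 ^ n :: real)) sequentially"
    proof (intro always_eventually allI)
      fix n
      have "2 ^ n * u - 1 \<le> of_int \<lfloor>2 ^ n * u\<rfloor>" by linarith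
      then have "(2 ^ n * u - 1) / 2 ^ n \<le> of_int \<lfloor>2 ^ n * u\<rfloor> / (2 ^ n :: real)" by (intro divide_right_mono) auto
      then show "u - (1/2) ^ n \<le> of_int \<lfloor>2 ^ n * u\<rfloor> / (2 ^ n :: real)" by (simp add: diff_divide_distrib power_one_over)
    qed
    show "eventually (\<lambda>n. of_int \<lfloor>2 ^ n * u\<rfloor> / (2 ^ n :: real) \<le> u) sequentially"
      by (intro always_eventually allI) (simp add: divide_le_eq mult.commute)
    have "(\<lambda>n. u - (1/2) ^ n) \<longlonglongrightarrow> u - 0"
      by (intro tendsto_diff tendsto_const LIMSEQ_power_zero) simp
    then show "(\<lambda>n. u - (1/2) ^ n) \<longlonglongrightarrow> u" by simp
  qed simp
  then show ?thesis unfolding sums_def part .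
qed

lemma of_bits_digit: "0 \<le> u \<Longrightarrow> u < 1 \<Longrightarrow> of_bits (digit u) = u"
  unfolding of_bits_def by (rule sums_unique[OF digit_sums, symmetric])

lemma of_bits_range: "of_bits b \<in> {0..1}"
proof -
  have geo: "(\<lambda>i. 1 / 2 ^ Suc i :: real) sums 1" by (rule power_half_series[unfolded power_one_over])
  have sm: "summable (\<lambda>i. of_bool (b i) / 2 ^ Suc i :: real)"
    by (rule summable_comparison_test'[OF sums_summable[OF geo], of 0]) auto
  have "of_bits b \<le> (\<Sum>i. 1 / 2 ^ Suc i)"
    unfolding of_bits_def by (intro suminf_le sm sums_summable[OF geo]) auto
  moreover have "0 \<le> of_bits b" unfolding of_bits_def by (intro suminf_nonneg sm) auto
  ultimately show ?thesis using sums_unique[OF geo] by simp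
qed

lemma measurable_of_bits[measurable]: "of_bits \<in> coin_seq \<rightarrow>\<^sub>M borel"
proof -
  have [measurable]: "(\<lambda>b. b i) \<in> coin_seq \<rightarrow>\<^sub>M count_space UNIV" for i
  proof -
    have "sets coin = sets (count_space UNIV)" by auto
    then show ?thesis using coin.measurable_coord[of i] measurable_cong_sets[OF refl, of coin "count_space UNIV"] by blast
  qed
  show ?thesis unfolding of_bits_def[abs_def] by measurable
qed

lemma measurable_of_bits_unit: "of_bits \<in> coin_seq \<rightarrow>\<^sub>M unit_lebesgue"
  unfolding unit_lebesgue_def by (intro measurable_restrict_space2) (use of_bits_range in \<open>auto simp: Pi_iff\<close>)

lemma pred_digit[measurable]: "Measurable.pred borel (\<lambda>u. digit u i)"
  unfolding digit_def by measurable

lemma measurable_digit: "digit \<in> borel \<rightarrow>\<^sub>M coin_seq"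
  by (rule coin.measurable_into_P) (simp add: coin_def measurable_pmf_measure2 pred_def[symmetric])

lemma measurable_digit_unit: "digit \<in> unit_lebesgue \<rightarrow>\<^sub>M coin_seq"
  unfolding unit_lebesgue_def by (intro measurable_restrict_space1) (simp add: measurable_digit cong: measurable_cong_sets)

lemma digit_halves:
  assumes "0 \<le> x" "x < 1"
  shows "digit (x / 2) 0 = False" "digit (x / 2) (Suc i) = digit x i"
    "digit ((x + 1) / 2) 0 = True" "digit ((x + 1) / 2) (Suc i) = digit x i"
proof -
  have fl: "\<lfloor>x\<rfloor> = 0" using assms by (simp add: floor_eq_iff)
  show "digit (x / 2) 0 = False" "digit (x / 2) (Suc i) = digit x i"
    by (simp_all add: digit_def fl mult_ac)
  have "2 ^ Suc 0 * ((x + 1) / 2) = x + of_int 1" by (simp add: field_simps)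
  then have "\<lfloor>2 ^ Suc 0 * ((x + 1) / 2)\<rfloor> = \<lfloor>x\<rfloor> + 1" by (simp only: floor_add_int)
  then show "digit ((x + 1) / 2) 0 = True" by (simp add: digit_def fl)
  have "2 ^ Suc (Suc i) * ((x + 1) / 2) = 2 ^ Suc i * x + of_int (2 ^ Suc i)"
    by (simp add: field_simps)
  then have "\<lfloor>2 ^ Suc (Suc i) * ((x + 1) / 2)\<rfloor> = \<lfloor>2 ^ Suc i * x\<rfloor> + 2 ^ Suc i"
    by (simp only: floor_add_int)
  then show "digit ((x + 1) / 2) (Suc i) = digit x i" by (simp add: digit_def)
qed

text \<open>The first digit cuts the interval into two copies at half scale, on which the remaining
  digits are those of the rescaled point.\<close>

lemma emeasure_bits:
  "emeasure lborel {u \<in> {0..<1}. \<forall>i<n. digit u i \<in> F i} = (\<Prod>i<n. emeasure coin (F i))"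
proof (induction n arbitrary: F)
  case 0
  have "{u :: real. 0 \<le> u \<and> u < 1} = {0..<1}" by auto
  then show ?case by simp
next
  case (Suc n)
  define S where "S = {u \<in> {0..<1}. \<forall>i<n. digit u i \<in> F (Suc i)}"
  have image_half: "(\<lambda>x. (x + t) / 2) ` S = {x. - t + 2 * x \<in> S}" for t
  proof (intro set_eqI iffI)
    fix x assume "x \<in> {x. - t + 2 * x \<in> S}"
    then show "x \<in> (\<lambda>x. (x + t) / 2) ` S" by (intro image_eqI[of _ _ "- t + 2 * x"]) auto
  next
    fix x assume "x \<in> (\<lambda>x. (x + t) / 2) ` S"
    then obtain y where "y \<in> S" "x = (y + t) / 2" by blast
    moreover from this have "- t + 2 * x = y" by (simp add: field_simps)
    ultimately show "x \<in> {x. - t + 2 * x \<in> S}" by simp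
  qed
  have half: "emeasure lborel ((\<lambda>x. (x + t) / 2) ` S) = ennreal (1/2) * emeasure lborel S" for t
  proof -
    have [measurable]: "S \<in> sets borel" unfolding S_def by measurable
    note image_half[of t]
    moreover have "emeasure lborel S = ennreal 2 * emeasure lborel {x. - t + 2 * x \<in> S}"
    proof -
      have [measurable]: "{x. - t + 2 * x \<in> S} \<in> sets borel"
        using measurable_sets[of "\<lambda>x. - t + 2 * x" borel borel S] by (simp add: vimage_def)
      have "emeasure lborel S = (\<integral>\<^sup>+x. indicator S x \<partial>lborel)" by simp
      also have "\<dots> = ennreal 2 * (\<integral>\<^sup>+x. indicator S (- t + 2 * x) \<partial>lborel)"
        using nn_integral_real_affine[of "indicator S" 2 "- t"] by simp
      also have "(\<integral>\<^sup>+x. indicator S (- t + 2 * x) \<partial>lborel) = (\<integral>\<^sup>+x. indicator {x. - t + 2 * x \<in> S} x \<partial>lborel)"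
        by (intro nn_integral_cong) (simp add: indicator_def)
      finally show ?thesis by simp
    qed
    moreover have "ennreal (1/2) * (ennreal 2 * e) = e" for e
    proof -
      have "ennreal (1/2) * ennreal 2 = ennreal (1/2 * 2)" by (rule ennreal_mult[symmetric]) auto
      then show ?thesis by (simp only: mult.assoc[symmetric]) simp
    qed
    ultimately show ?thesis by simp
  qed
  have split: "{u \<in> {0..<1}. \<forall>i<Suc n. digit u i \<in> F i} =
      (if False \<in> F 0 then (\<lambda>x. (x + 0) / 2) ` S else {}) \<union> (if True \<in> F 0 then (\<lambda>x. (x + 1) / 2) ` S else {})" (is "?L = ?R")
  proof (intro set_eqI iffI)
    fix u assume u: "u \<in> ?L"
    have all: "digit u 0 \<in> F 0" "\<forall>i<n. digit u (Suc i) \<in> F (Suc i)" using u by auto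
    show "u \<in> ?R"
    proof (cases "u < 1/2")
      case True
      then have x: "0 \<le> 2 * u" "2 * u < 1" using u by auto
      have "2 * u \<in> S" using all digit_halves(2)[OF x] x by (simp add: S_def)
      moreover have "u = (2 * u + 0) / 2" by simp
      ultimately have "u \<in> (\<lambda>x. (x + 0) / 2) ` S" by blast
      moreover have "False \<in> F 0" using all digit_halves(1)[OF x] by simp
      ultimately show ?thesis by simp
    next
      case False
      then have x: "0 \<le> 2 * u - 1" "2 * u - 1 < 1" using u by auto
      have "2 * u - 1 \<in> S" using all digit_halves(4)[OF x] x by (simp add: S_def)
      moreover have "u = ((2 * u - 1) + 1) / 2" by simp
      ultimately have "u \<in> (\<lambda>x. (x + 1) / 2) ` S" by blast
      moreover have "True \<in> F 0" using all digit_halves(3)[OF x] by simp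
      ultimately show ?thesis by simp
    qed
  next
    fix u assume "u \<in> ?R"
    then consider x where "x \<in> S" "u = x / 2" "False \<in> F 0" | x where "x \<in> S" "u = (x + 1) / 2" "True \<in> F 0"
      by (auto split: if_splits)
    then show "u \<in> ?L"
    proof cases
      case 1
      then have "0 \<le> x" "x < 1" by (auto simp: S_def)
      then show ?thesis using 1 digit_halves[of x] by (auto simp: S_def less_Suc_eq_0_disj)
    next
      case 2
      then have x: "0 \<le> x" "x < 1" by (auto simp: S_def)
      have "(x + 1) / 2 \<in> ?L" using x 2(1,3) digit_halves[of x] by (auto simp: S_def less_Suc_eq_0_disj)
      then show ?thesis by (simp only: 2(2))
    qed
  qed
  have F0: "emeasure coin (F 0) = (if False \<in> F 0 then ennreal (1/2) else 0) + (if True \<in> F 0 then ennreal (1/2) else 0)"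
  proof -
    have "F 0 = (if False \<in> F 0 then {False} else {}) \<union> (if True \<in> F 0 then {True} else {})"
      by auto (metis (full_types))+
    moreover have "emeasure coin ((if False \<in> F 0 then {False} else {}) \<union> (if True \<in> F 0 then {True} else {}))
      = emeasure coin (if False \<in> F 0 then {False} else {}) + emeasure coin (if True \<in> F 0 then {True} else {})"
      by (rule plus_emeasure[symmetric]) auto
    ultimately show ?thesis by (simp add: emeasure_coin_singleton)
  qed
  have SB: "(\<lambda>x. (x + t) / 2) ` S \<in> sets borel" for t
  proof -
    have "S \<in> sets borel" unfolding S_def by measurable
    then show ?thesis using measurable_sets[of "\<lambda>x. - t + 2 * x" borel borel S]
      unfolding image_half by (simp add: vimage_def)
  qed
  have "emeasure lborel {u \<in> {0..<1}. \<forall>i<Suc n. digit u i \<in> F i} =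
     emeasure lborel (if False \<in> F 0 then (\<lambda>x. (x + 0) / 2) ` S else {}) + emeasure lborel (if True \<in> F 0 then (\<lambda>x. (x + 1) / 2) ` S else {})"
    unfolding split by (rule plus_emeasure[symmetric]) (use SB[of 0] SB[of 1] in \<open>auto simp: S_def\<close>)
  also have "\<dots> = emeasure coin (F 0) * emeasure lborel S"
    unfolding F0 by (auto simp: half[of 0, simplified] half distrib_right[symmetric])
  also have "emeasure lborel S = (\<Prod>i<n. emeasure coin (F (Suc i)))"
    unfolding S_def by (rule Suc)
  also have "emeasure coin (F 0) * (\<Prod>i<n. emeasure coin (F (Suc i))) = (\<Prod>i<Suc n. emeasure coin (F i))"
    by (rule prod.lessThan_Suc_shift[symmetric])
  finally show ?case .
qed

lemma emeasure_unit_lebesgue: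
  assumes "A \<in> sets borel" shows "emeasure unit_lebesgue (A \<inter> {0..1}) = emeasure lborel (A \<inter> {0..<1})"
proof -
  have "emeasure unit_lebesgue (A \<inter> {0..1}) = emeasure lborel (A \<inter> {0..1})"
    unfolding unit_lebesgue_def by (rule emeasure_restrict_space) (use assms in auto)
  also have "\<dots> = emeasure lborel (A \<inter> {0..<1})"
  proof (rule emeasure_eq_AE)
    have "AE x in lborel. x \<noteq> (1::real)" by (rule AE_lborel_singleton)
    then show "AE x in lborel. x \<in> A \<inter> {0..1} \<longleftrightarrow> x \<in> A \<inter> {0..<1::real}" by eventually_elim auto
  qed (use assms in auto)
  finally show ?thesis .
qed

lemma distr_digit: "distr unit_lebesgue coin_seq digit = coin_seq"
proof (rule coin.P_eqI)
  fix J :: "nat set" and F :: "nat \<Rightarrow> bool set" assume J: "finite J"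
  obtain n where n: "J \<subseteq> {..<n}" using J by (metis finite_nat_iff_bounded)
  define F' where "F' i = (if i \<in> J then F i else UNIV)" for i
  have eq: "(\<forall>i<n. b i \<in> F' i) \<longleftrightarrow> b \<in> cyl J F" for b
    using n by (auto simp: F'_def cyl_def)
  have c: "cyl J F \<in> sets coin_seq" using J by (intro coin.sets_cyl) auto
  have "emeasure (distr unit_lebesgue coin_seq digit) (cyl J F) = emeasure unit_lebesgue (digit -` cyl J F \<inter> {0..1})"
    using emeasure_distr[OF measurable_digit_unit c] by simp
  also have "\<dots> = emeasure lborel (digit -` cyl J F \<inter> {0..<1})"
    using measurable_sets[OF measurable_digit c] by (intro emeasure_unit_lebesgue) simp
  also have "digit -` cyl J F \<inter> {0..<1} = {u \<in> {0..<1}. \<forall>i<n. digit u i \<in> F' i}" using eq by auto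
  also have "emeasure lborel \<dots> = (\<Prod>i<n. emeasure coin (F' i))" by (rule emeasure_bits)
  also have "\<dots> = (\<Prod>i\<in>J. emeasure coin (F i))"
  proof (rule prod.mono_neutral_cong_right)
    show "\<forall>i\<in>{..<n} - J. emeasure coin (F' i) = 1"
      using coin.emeasure_space_1 by (auto simp: F'_def)
  qed (use n in \<open>auto simp: F'_def\<close>)
  finally show "emeasure (distr unit_lebesgue coin_seq digit) (cyl J F) = (\<Prod>i\<in>J. emeasure coin (F i))" .
qed simp

lemma prob_coin_seq: "prob_space coin_seq"
  by (rule coin.P.prob_space_axioms)

lemma AE_unit_lebesgue: "AE u in unit_lebesgue. 0 \<le> u \<and> u < 1"
proof -
  have "AE u in lborel. u \<noteq> (1::real)" by (rule AE_lborel_singleton)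
  then have "AE u in lborel. u \<in> {0..1} \<longrightarrow> 0 \<le> u \<and> u < (1::real)" by eventually_elim auto
  then show ?thesis unfolding unit_lebesgue_def by (subst AE_restrict_space_iff) auto
qed

text \<open>A bit sequence is a uniform number in disguise, so a threshold produces a coin of any
  prescribed bias.\<close>

lemma measure_of_bits_less:
  assumes "0 \<le> r" "r \<le> 1" shows "measure coin_seq {b. of_bits b < r} = r"
proof -
  have s: "{b. of_bits b < r} \<in> sets coin_seq"
  proof -
    have "{b \<in> space coin_seq. of_bits b < r} \<in> sets coin_seq" by measurable
    then show ?thesis by simp
  qed
  have "emeasure coin_seq {b. of_bits b < r} = emeasure unit_lebesgue (digit -` {b. of_bits b < r} \<inter> {0..1})"
    by (subst distr_digit[symmetric], subst emeasure_distr[OF measurable_digit_unit]) (use s in auto)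
  also have "\<dots> = emeasure lborel (digit -` {b. of_bits b < r} \<inter> {0..<1})"
    using measurable_sets[OF measurable_digit s] by (intro emeasure_unit_lebesgue) simp
  also have "digit -` {b. of_bits b < r} \<inter> {0..<1} = {0..<r}"
    using assms by (auto simp: of_bits_digit)
  finally show ?thesis using assms by (simp add: measure_def)
qed

text \<open>Splits one bit sequence into independent ones indexed by the slots.
  \<open>to_nat_on\<close> is a bijection, so no bit is lost and the sequence can be
  reassembled.\<close>

definition row :: "'k::countable \<Rightarrow> (nat \<Rightarrow> bool) \<Rightarrow> nat \<Rightarrow> bool" where
  "row k b i = b (to_nat_on (UNIV :: ('k \<times> nat) set) (k, i))"

lemma bij_to_nat_on_prod: "bij_betw (to_nat_on (UNIV :: ('k::countable \<times> nat) set)) UNIV UNIV"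
  by (rule to_nat_on_infinite) (auto simp: finite_prod)

lemma row_inverse: "row (fst (from_nat_into (UNIV :: ('k::countable \<times> nat) set) n)) b (snd (from_nat_into (UNIV :: ('k \<times> nat) set) n)) = b n"
proof -
  have "to_nat_on (UNIV :: ('k \<times> nat) set) (from_nat_into UNIV n) = n"
    by (rule to_nat_on_from_nat_into_infinite) (auto simp: finite_prod)
  then show ?thesis by (simp add: row_def)
qed

lemma measurable_row[measurable]: "row k \<in> coin_seq \<rightarrow>\<^sub>M coin_seq"
  by (rule coin.measurable_into_P) (simp add: row_def)

lemma distr_row: "distr coin_seq coin_seq (row (k :: 'k::countable)) = coin_seq"
proof -
  have inj: "inj (\<lambda>i. to_nat_on (UNIV :: ('k \<times> nat) set) (k, i))"
    using bij_betw_imp_inj_on[OF bij_to_nat_on_prod[where 'k = 'k]] by (auto simp: inj_on_def)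
  have "distr (PiM UNIV (\<lambda>_. coin)) (\<Pi>\<^sub>M i\<in>UNIV. coin) (\<lambda>b :: nat \<Rightarrow> bool. \<lambda>n\<in>UNIV. b (to_nat_on (UNIV :: ('k \<times> nat) set) (k, n))) = (\<Pi>\<^sub>M i\<in>UNIV. coin)"
    using inj by (intro distr_PiM_reindex) (auto intro: coin.prob_space_axioms)
  moreover have "(\<lambda>b :: nat \<Rightarrow> bool. \<lambda>n\<in>UNIV. b (to_nat_on (UNIV :: ('k \<times> nat) set) (k, n))) = row k"
    by (auto simp: fun_eq_iff row_def)
  ultimately show ?thesis unfolding coin_seq_def by (simp only:)
qed

lemma measure_row: "F \<in> sets coin_seq \<Longrightarrow> measure coin_seq {b. row k b \<in> F} = measure coin_seq F"
  by (subst (2) distr_row[of k, symmetric], subst measure_distr) (auto simp: vimage_def)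

lemma sets_row: "F \<in> sets coin_seq \<Longrightarrow> {b. row k b \<in> F} \<in> sets coin_seq"
  using measurable_sets[OF measurable_row, of F k] by (simp add: vimage_def)

lemma measure_rows:
  fixes J :: "'k::countable set"
  assumes "finite J" "\<And>k. k \<in> J \<Longrightarrow> F k \<in> sets coin_seq"
  shows "{b. \<forall>k\<in>J. row k b \<in> F k} \<in> sets coin_seq \<and> measure coin_seq {b. \<forall>k\<in>J. row k b \<in> F k} = (\<Prod>k\<in>J. measure coin_seq (F k))"
  using assms
proof (induction J rule: finite_induct)
  case empty
  show ?case using coin.P.prob_space sets.top[of coin_seq] by simp
next
  case (insert k J)
  let ?e = "to_nat_on (UNIV :: ('k \<times> nat) set)"
  have inj: "inj ?e" using bij_to_nat_on_prod[where 'k = 'k] by (rule bij_betw_imp_inj_on)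
  have IH: "{b. \<forall>k\<in>J. row k b \<in> F k} \<in> sets coin_seq" "measure coin_seq {b. \<forall>k\<in>J. row k b \<in> F k} = (\<Prod>k\<in>J. measure coin_seq (F k))"
    using insert by auto
  have s: "{b. row k b \<in> F k} \<in> sets coin_seq" using insert by (intro sets_row) auto
  have eq: "{b. \<forall>k\<in>insert k J. row k b \<in> F k} = {b. row k b \<in> F k} \<inter> {b. \<forall>k\<in>J. row k b \<in> F k}" by auto
  have r: "row k' b = row k' b'" if "\<forall>i\<in>?e ` ({k'} \<times> UNIV). b i = b' i" for k' b b'
    using that by (auto simp: row_def fun_eq_iff)
  have "measure coin_seq ({b. row k b \<in> F k} \<inter> {b. \<forall>k\<in>J. row k b \<in> F k})
      = measure coin_seq {b. row k b \<in> F k} * measure coin_seq {b. \<forall>k\<in>J. row k b \<in> F k}"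
  proof (rule coin.depends_on_indep[OF s IH(1)])
    show "depends_on (?e ` ({k} \<times> UNIV)) {b. row k b \<in> F k}"
      unfolding depends_on_def using r[of k] by (metis mem_Collect_eq)
    show "depends_on (?e ` (J \<times> UNIV)) {b. \<forall>k\<in>J. row k b \<in> F k}"
      unfolding depends_on_def
    proof (intro allI impI)
      fix b b' :: "nat \<Rightarrow> bool" assume "\<forall>i\<in>?e ` (J \<times> UNIV). b i = b' i"
      then have "row k b = row k b'" if "k \<in> J" for k by (intro r) (use that in auto)
      then show "(b \<in> {b. \<forall>k\<in>J. row k b \<in> F k}) = (b' \<in> {b. \<forall>k\<in>J. row k b \<in> F k})" by simp
    qed
    show "?e ` ({k} \<times> UNIV) \<inter> ?e ` (J \<times> UNIV) = {}"
      using insert(2) inj by (auto dest: injD)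
  qed
  then show ?case unfolding eq using s IH insert measure_row[of "F k" k] by (auto intro: sets.Int)
qed

text \<open>Works vertex by vertex, distributing the digits of \<open>x v\<close> among the slots at
  \<open>v\<close>; hence it commutes with the shift.\<close>

definition encode :: "('g \<Rightarrow> real) \<Rightarrow> 'g \<times> 'k::countable \<Rightarrow> nat \<Rightarrow> bool" where
  "encode x = (\<lambda>(v, k). row k (digit (x v)))"

definition decode :: "('g \<times> 'k::countable \<Rightarrow> nat \<Rightarrow> bool) \<Rightarrow> 'g \<Rightarrow> real" where
  "decode \<omega> v = of_bits (\<lambda>n. \<omega> (v, fst (from_nat_into (UNIV :: ('k \<times> nat) set) n)) (snd (from_nat_into (UNIV :: ('k \<times> nat) set) n)))"

lemma decode_encode: "0 \<le> x v \<Longrightarrow> x v < 1 \<Longrightarrow> decode (encode x :: 'g \<times> 'k::countable \<Rightarrow> nat \<Rightarrow> bool) v = x v"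
  by (simp add: decode_def encode_def row_inverse of_bits_digit)

lemma encode_bshift: "encode (bshift l x) = sft l (encode x)"
  by (auto simp: encode_def bshift_def sft_def fun_eq_iff)

abbreviation coin_field :: "('g \<times> 'k \<Rightarrow> nat \<Rightarrow> bool) measure" where
  "coin_field \<equiv> PiM UNIV (\<lambda>_. coin_seq)"

lemma iid_coin_field: "iid_space coin_seq coin_field"
  unfolding iid_space_def iid_space_axioms_def using prob_coin_seq by simp

lemma bern_space_eq: "bern_space TYPE('g) = PiM UNIV (\<lambda>_ :: 'g. unit_lebesgue)"
  by (simp add: bern_space_def unit_lebesgue_def)

lemma space_bern_space: "x \<in> space (bern_space TYPE('g)) \<longleftrightarrow> (\<forall>v. x v \<in> {0..1})"
  by (auto simp: bern_space_eq space_PiM PiE_iff)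

lemma prob_bern_space: "prob_space (bern_space TYPE('g))"
  unfolding bern_space_eq by (rule prob_space_PiM) (rule prob_unit_lebesgue)

lemma measurable_bern_coord[measurable]: "(\<lambda>x. x v) \<in> bern_space TYPE('g) \<rightarrow>\<^sub>M unit_lebesgue"
  unfolding bern_space_eq by (rule measurable_component_singleton) simp

lemma measurable_encode: "(encode :: _ \<Rightarrow> 'g \<times> 'k::countable \<Rightarrow> _) \<in> bern_space TYPE('g) \<rightarrow>\<^sub>M coin_field"
proof (rule iid_space.measurable_into_P[OF iid_coin_field])
  fix i :: "'g \<times> 'k"
  have "(\<lambda>x. row (snd i) (digit (x (fst i)))) \<in> bern_space TYPE('g) \<rightarrow>\<^sub>M coin_seq"
    using measurable_compose[OF measurable_compose[OF measurable_bern_coord measurable_digit_unit] measurable_row] .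
  then show "(\<lambda>x. encode x i) \<in> bern_space TYPE('g) \<rightarrow>\<^sub>M coin_seq"
    by (simp add: encode_def split_beta)
qed

lemma measurable_decode: "decode \<in> (coin_field :: ('g \<times> 'k::countable \<Rightarrow> _) measure) \<rightarrow>\<^sub>M bern_space TYPE('g)"
  unfolding bern_space_eq decode_def[abs_def]
proof (rule measurable_abs_UNIV)
  fix v :: 'g
  have "(\<lambda>\<omega> :: 'g \<times> 'k \<Rightarrow> nat \<Rightarrow> bool. \<lambda>n. \<omega> (v, fst (from_nat_into (UNIV :: ('k \<times> nat) set) n)) (snd (from_nat_into (UNIV :: ('k \<times> nat) set) n))) \<in> coin_field \<rightarrow>\<^sub>M coin_seq"
  proof (rule coin.measurable_into_P)
    fix n
    show "(\<lambda>\<omega> :: 'g \<times> 'k \<Rightarrow> nat \<Rightarrow> bool. \<omega> (v, fst (from_nat_into (UNIV :: ('k \<times> nat) set) n)) (snd (from_nat_into (UNIV :: ('k \<times> nat) set) n))) \<in> coin_field \<rightarrow>\<^sub>M coin"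
    proof -
      have "(\<lambda>\<omega> :: 'g \<times> 'k \<Rightarrow> nat \<Rightarrow> bool. \<omega> i) \<in> coin_field \<rightarrow>\<^sub>M coin_seq" for i
        by (rule measurable_component_singleton) simp
      from measurable_compose[OF this coin.measurable_coord] show ?thesis .
    qed
  qed
  from measurable_compose[OF this measurable_of_bits_unit]
  show "(\<lambda>\<omega> :: 'g \<times> 'k \<Rightarrow> nat \<Rightarrow> bool. of_bits (\<lambda>n. \<omega> (v, fst (from_nat_into (UNIV :: ('k \<times> nat) set) n)) (snd (from_nat_into (UNIV :: ('k \<times> nat) set) n)))) \<in> coin_field \<rightarrow>\<^sub>M unit_lebesgue" .
qed

text \<open>A cylinder is sorted by vertices: over one vertex the rows are independent by
  \<open>measure_rows\<close>, and different vertices use different coordinates of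
  \<open>x\<close>.\<close>

lemma distr_encode: "distr (bern_space TYPE('g)) coin_field (encode :: _ \<Rightarrow> 'g \<times> 'k::countable \<Rightarrow> _) = coin_field"
proof (rule iid_space.P_eqI[OF iid_coin_field])
  interpret U: prob_space unit_lebesgue by (rule prob_unit_lebesgue)
  interpret X: product_prob_space "\<lambda>_. unit_lebesgue" "UNIV :: 'g set" ..
  fix J :: "('g \<times> 'k) set" and F assume J: "finite J" and F: "\<And>j. j \<in> J \<Longrightarrow> F j \<in> sets coin_seq"
  define Jv where "Jv v = {k. (v, k) \<in> J}" for v
  have fin: "finite (fst ` J)" "finite (Jv v)" for v
    using J finite_vimageI[of J "Pair v"] by (auto simp: Jv_def vimage_def inj_on_def)
  define R where "R v = {b. \<forall>k\<in>Jv v. row k b \<in> F (v, k)}" for v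
  have R: "R v \<in> sets coin_seq" "emeasure coin_seq (R v) = (\<Prod>k\<in>Jv v. emeasure coin_seq (F (v, k)))" for v
    using measure_rows[OF fin(2)[of v], of "\<lambda>k. F (v, k)"] F
    by (auto simp: Jv_def R_def coin.P.emeasure_eq_measure prod_ennreal)
  have c: "cyl J F \<in> sets coin_field" using J F by (intro iid_space.sets_cyl[OF iid_coin_field]) auto
  have G: "digit -` R v \<inter> {0..1} \<in> sets unit_lebesgue" for v
    using measurable_sets[OF measurable_digit_unit R(1)] by simp
  have "emeasure (distr (bern_space TYPE('g)) coin_field encode) (cyl J F) = emeasure (bern_space TYPE('g)) (encode -` cyl J F \<inter> space (bern_space TYPE('g)))"
    by (rule emeasure_distr[OF measurable_encode c])
  also have "encode -` cyl J F \<inter> space (bern_space TYPE('g)) = {x \<in> space (PiM UNIV (\<lambda>_ :: 'g. unit_lebesgue)). \<forall>v\<in>fst ` J. x v \<in> digit -` R v \<inter> {0..1}}"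
    by (fastforce simp: cyl_def encode_def R_def Jv_def bern_space_eq space_PiM PiE_iff)
  also have "emeasure (bern_space TYPE('g)) \<dots> = (\<Prod>v\<in>fst ` J. emeasure unit_lebesgue (digit -` R v \<inter> {0..1}))"
    unfolding bern_space_eq by (rule X.emeasure_PiM_Collect) (use fin G in auto)
  also have "\<dots> = (\<Prod>v\<in>fst ` J. \<Prod>k\<in>Jv v. emeasure coin_seq (F (v, k)))"
  proof (rule prod.cong[OF refl])
    fix v
    have "emeasure unit_lebesgue (digit -` R v \<inter> {0..1}) = emeasure (distr unit_lebesgue coin_seq digit) (R v)"
      using emeasure_distr[OF measurable_digit_unit R(1)] by simp
    then show "emeasure unit_lebesgue (digit -` R v \<inter> {0..1}) = (\<Prod>k\<in>Jv v. emeasure coin_seq (F (v, k)))"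
      by (simp add: distr_digit R(2))
  qed
  also have "\<dots> = (\<Prod>i\<in>(SIGMA v:fst ` J. Jv v). emeasure coin_seq (F i))"
    using fin by (subst prod.Sigma) (auto intro!: prod.cong)
  also have "(SIGMA v:fst ` J. Jv v) = J" by (force simp: Jv_def)
  finally show "emeasure (distr (bern_space TYPE('g)) coin_field encode) (cyl J F) = (\<Prod>i\<in>J. emeasure coin_seq (F i))" .
qed simp

lemma bshift_bshift: "bshift a (bshift b x) = bshift (a + b) x"
  by (auto simp: bshift_def fun_eq_iff minus_add add.assoc[symmetric])

lemma bshift_0[simp]: "bshift 0 x = x"
  by (simp add: bshift_def)

lemma measurable_bshift[measurable]: "bshift l \<in> bern_space TYPE('g::group_add) \<rightarrow>\<^sub>M bern_space TYPE('g)"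
proof -
  have "(\<lambda>x :: 'g \<Rightarrow> real. \<lambda>g. x (- l + g)) \<in> bern_space TYPE('g) \<rightarrow>\<^sub>M PiM UNIV (\<lambda>_. unit_lebesgue)"
    by (rule measurable_abs_UNIV) (rule measurable_bern_coord)
  then show ?thesis by (simp add: bern_space_eq bshift_def[abs_def])
qed

lemma distr_bshift: "distr (bern_space TYPE('g::group_add)) (bern_space TYPE('g)) (bshift l) = bern_space TYPE('g)"
proof -
  have "distr (PiM UNIV (\<lambda>_ :: 'g. unit_lebesgue)) (\<Pi>\<^sub>M i\<in>UNIV. unit_lebesgue) (\<lambda>x :: 'g \<Rightarrow> real. \<lambda>n\<in>UNIV. x (- l + n)) = (\<Pi>\<^sub>M i\<in>UNIV. unit_lebesgue)"
    by (intro distr_PiM_reindex) (auto simp: inj_on_def intro: prob_unit_lebesgue)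
  moreover have "(\<lambda>x :: 'g \<Rightarrow> real. \<lambda>n\<in>UNIV. x (- l + n)) = bshift l"
    by (auto simp: fun_eq_iff bshift_def)
  ultimately show ?thesis unfolding bern_space_eq by (simp only:)
qed

text \<open>A fixed point of the shift by \<open>l\<close> has equal values at \<open>- l\<close>
  and 0. The diagonal of the square is covered by \<open>N\<close> squares of side
  \<open>1 / N\<close>, so it has measure at most \<open>1 / N\<close>.\<close>

lemma AE_bshift_free: "AE x in bern_space TYPE('g::{countable,group_add}). \<forall>l. l \<noteq> 0 \<longrightarrow> bshift l x \<noteq> x"
proof (subst AE_all_countable, rule allI)
  fix l :: 'g
  interpret U: prob_space unit_lebesgue by (rule prob_unit_lebesgue)
  interpret X: product_prob_space "\<lambda>_. unit_lebesgue" "UNIV :: 'g set" ..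
  interpret PX: prob_space "bern_space TYPE('g)" by (rule prob_bern_space)
  let ?X = "bern_space TYPE('g)"
  show "AE x in ?X. l \<noteq> 0 \<longrightarrow> bshift l x \<noteq> x"
  proof (cases "l = 0")
    case False
    define D where "D = {x \<in> space ?X. x (- l) = x 0}"
    have sI: "{a..b} \<inter> {0..1} \<in> sets unit_lebesgue" and mI: "measure unit_lebesgue ({a..b} \<inter> {0..1}) \<le> b - a" if "a \<le> b" for a b :: real
    proof -
      show "{a..b} \<inter> {0..1} \<in> sets unit_lebesgue" by (auto simp: unit_lebesgue_def sets_restrict_space)
      have "emeasure unit_lebesgue ({a..b} \<inter> {0..1}) = emeasure lborel ({a..b} \<inter> {0..1})"
        unfolding unit_lebesgue_def by (rule emeasure_restrict_space) auto
      also have "\<dots> \<le> emeasure lborel {a..b}" by (rule emeasure_mono) auto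
      finally have "emeasure unit_lebesgue ({a..b} \<inter> {0..1}) \<le> ennreal (b - a)" using that by simp
      then show "measure unit_lebesgue ({a..b} \<inter> {0..1}) \<le> b - a"
        using that by (simp add: U.emeasure_eq_measure)
    qed
    have bound: "measure ?X D \<le> 1 / real N" if N: "N > 0" for N :: nat
    proof -
      define B where "B m = {real m / N..(real m + 1) / N} \<inter> {0..1}" for m :: nat
      have B: "B m \<in> sets unit_lebesgue" "measure unit_lebesgue (B m) \<le> 1 / N" for m
        using sI[of "real m / N" "(real m + 1) / N"] mI[of "real m / N" "(real m + 1) / N"] N
        by (auto simp: B_def divide_right_mono diff_divide_distrib[symmetric])
      define S where "S m = {x \<in> space ?X. \<forall>i\<in>{- l, 0}. x i \<in> B m}" for m
      have "emeasure ?X (S m) = (\<Prod>i\<in>{- l, 0}. emeasure unit_lebesgue (B m))" for m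
        unfolding S_def bern_space_eq by (rule X.emeasure_PiM_Collect) (use B in auto)
      then have mS: "measure ?X (S m) = measure unit_lebesgue (B m) * measure unit_lebesgue (B m)" for m
        using False by (simp add: PX.emeasure_eq_measure U.emeasure_eq_measure ennreal_mult[symmetric])
      have sS: "S m \<in> sets ?X" for m
      proof -
        have "(\<lambda>x. x (- l)) -` B m \<inter> space ?X \<inter> ((\<lambda>x. x 0) -` B m \<inter> space ?X) \<in> sets ?X"
          using B by (intro sets.Int measurable_sets[OF measurable_bern_coord]) auto
        also have "(\<lambda>x. x (- l)) -` B m \<inter> space ?X \<inter> ((\<lambda>x. x 0) -` B m \<inter> space ?X) = S m" by (auto simp: S_def)
        finally show ?thesis .
      qed
      have "measure ?X D \<le> measure ?X (\<Union>m<N. S m)"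
      proof -
        have "D \<subseteq> (\<Union>m<N. S m)"
        proof
          fix x assume x: "x \<in> D"
          then have x01: "0 \<le> x 0" "x 0 \<le> 1" by (auto simp: D_def space_bern_space)
          \<comment> \<open>The minimum with \<open>N - 1\<close> puts the endpoint
            \<open>x 0 = 1\<close> into the last interval.\<close>
          define m where "m = min (N - 1) (nat \<lfloor>x 0 * N\<rfloor>)"
          have fl: "real (nat \<lfloor>x 0 * N\<rfloor>) \<le> x 0 * N" "x 0 * N \<le> real (nat \<lfloor>x 0 * N\<rfloor>) + 1"
            using x01 N by auto
          have "x 0 * N \<le> N" using x01 N by (simp add: mult_left_le_one_le)
          then have m: "real m \<le> x 0 * N" "x 0 * N \<le> real m + 1"
            using fl N by (auto simp: m_def min_def of_nat_diff)
          moreover have "m < N" using N by (simp add: m_def min_less_iff_disj)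
          moreover have "x \<in> S m"
            using x x01 m N by (auto simp: S_def B_def D_def field_simps)
          ultimately show "x \<in> (\<Union>m<N. S m)" by blast
        qed
        then show ?thesis using sS by (intro PX.finite_measure_mono) auto
      qed
      also have "\<dots> \<le> (\<Sum>m<N. measure ?X (S m))"
        using sS by (intro PX.finite_measure_subadditive_finite) auto
      also have "\<dots> \<le> (\<Sum>m<N. 1 / N * (1 / N))"
        unfolding mS using B(2) by (intro sum_mono mult_mono) auto
      also have "\<dots> = 1 / N" using N by simp
      finally show ?thesis .
    qed
    have D0: "measure ?X D \<le> 0"
    proof (rule LIMSEQ_le_const)
      show "(\<lambda>N. 1 / real (Suc N)) \<longlonglongrightarrow> 0" by (rule LIMSEQ_Suc[OF lim_1_over_n])
      show "\<exists>N. \<forall>n\<ge>N. measure ?X D \<le> 1 / real (Suc n)" using bound by blast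
    qed
    have sD: "D \<in> sets ?X"
    proof -
      have [measurable]: "(\<lambda>x. x v) \<in> ?X \<rightarrow>\<^sub>M borel" for v
        by (rule measurable_compose[OF measurable_bern_coord[of v], of "\<lambda>x. x"])
          (simp add: unit_lebesgue_def measurable_restrict_space1)
      show ?thesis unfolding D_def by measurable
    qed
    have "AE x in ?X. x \<notin> D"
      using sD D0 by (intro AE_not_in null_setsI) (auto simp: PX.emeasure_eq_measure measure_le_0_iff)
    then have "AE x in ?X. bshift l x \<noteq> x"
    proof (rule AE_mp, intro AE_I2 impI notI)
      fix x assume x: "x \<in> space ?X" "x \<notin> D" and eq: "bshift l x = x"
      have "x (- l) = bshift l x 0" by (simp add: bshift_def)
      also have "\<dots> = x 0" by (simp only: eq)
      finally show False using x by (simp add: D_def)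
    qed
    then show ?thesis by eventually_elim simp
  qed simp
qed

section \<open>The action on the Bernoulli space\<close>

locale bernoulli_percolation = percolation coin_seq "coin_field :: ('g::{countable,group_add} \<times> (bool \<times> nat \<times> 'g) \<Rightarrow> nat \<Rightarrow> bool) measure" p \<rho> K On
  for p :: "nat \<Rightarrow> 'g::{countable,group_add} \<Rightarrow> real" and \<rho> K On
begin

abbreviation X :: "('g \<Rightarrow> real) measure" where "X \<equiv> bern_space TYPE('g)"

abbreviation enc :: "('g \<Rightarrow> real) \<Rightarrow> 'g \<times> (bool \<times> nat \<times> 'g) \<Rightarrow> nat \<Rightarrow> bool" where "enc \<equiv> encode"

definition orbit_perm :: "(('g \<times> (bool \<times> nat \<times> 'g) \<Rightarrow> nat \<Rightarrow> bool) \<Rightarrow> 'g \<Rightarrow> 'g) \<Rightarrow> bool" where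
  "orbit_perm \<pi> \<longleftrightarrow> (\<forall>\<omega>. bij (\<pi> \<omega>)) \<and> (\<forall>l \<omega> v. \<pi> (sft l \<omega>) (l + v) = l + \<pi> \<omega> v) \<and>
     (\<forall>u v. Measurable.pred coin_field (\<lambda>\<omega>. \<pi> \<omega> u = v))"

text \<open>Re-rooting: \<open>x\<close> is viewed from the vertex to which the permutation sends
  0.\<close>

definition act :: "(('g \<times> (bool \<times> nat \<times> 'g) \<Rightarrow> nat \<Rightarrow> bool) \<Rightarrow> 'g \<Rightarrow> 'g) \<Rightarrow> ('g \<Rightarrow> real) \<Rightarrow> 'g \<Rightarrow> real" where
  "act \<pi> x = bshift (- \<pi> (enc x) 0) x"

lemma orbit_perm_pa: "orbit_perm pa"
  unfolding orbit_perm_def using bij_pa pa_sft pred_pa by blast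

lemma orbit_perm_pc: "orbit_perm pc"
  unfolding orbit_perm_def using bij_pc pc_sft pred_pc by blast

lemma orbit_perm_inv:
  assumes "orbit_perm \<pi>" shows "orbit_perm (\<lambda>\<omega>. inv (\<pi> \<omega>))"
proof -
  have bij: "bij (\<pi> \<omega>)" for \<omega> using assms by (simp add: orbit_perm_def)
  have eq: "inv (\<pi> \<omega>) u = v \<longleftrightarrow> \<pi> \<omega> v = u" for \<omega> u v
    using bij[of \<omega>] by (metis bij_inv_eq_iff)
  have "inv (\<pi> (sft l \<omega>)) (l + v) = l + inv (\<pi> \<omega>) v" for l \<omega> v
    unfolding eq using assms bij[of \<omega>] by (simp add: orbit_perm_def bij_is_surj surj_f_inv_f)
  then show ?thesis
    using assms bij by (simp add: orbit_perm_def eq bij_imp_bij_inv)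
qed

lemma act_mp:
  assumes "orbit_perm \<pi>" shows "mp_map X (act \<pi>)"
proof -
  have s: "{x \<in> space X. \<pi> (enc x) u = v} \<in> sets X" for u v
  proof -
    have "Measurable.pred coin_field (\<lambda>\<omega>. \<pi> \<omega> u = v)" using assms by (simp add: orbit_perm_def)
    from measurable_compose[OF measurable_encode this] show ?thesis by (simp add: pred_def)
  qed
  have "\<pi> (enc (bshift l x)) (l + v) = l + \<pi> (enc x) v" "bij (\<pi> (enc x))" for l x v
    using assms by (simp_all add: orbit_perm_def encode_bshift)
  then have "(\<lambda>x. bshift (- \<pi> (enc x) 0) x) \<in> X \<rightarrow>\<^sub>M X \<and> distr X X (\<lambda>x. bshift (- \<pi> (enc x) 0) x) = X"
    using equivariant_permutation_measure_preserving[of bshift X "\<lambda>x. \<pi> (enc x)", OF measurable_bshift distr_bshift _ s]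
    by (simp add: bshift_bshift)
  then show ?thesis by (simp add: mp_map_def act_def[abs_def])
qed

text \<open>Viewed from \<open>v\<close>, acting means passing to the vertex
  \<open>\<pi> (enc x) v\<close> of the same field. Compositions can therefore be followed inside
  one fixed permutation.\<close>

lemma act_bshift:
  assumes "orbit_perm \<pi>" shows "act \<pi> (bshift (- v) x) = bshift (- \<pi> (enc x) v) x"
proof -
  have "\<pi> (sft (- v) (enc x)) (- v + v) = - v + \<pi> (enc x) v" using assms unfolding orbit_perm_def by blast
  then have "\<pi> (enc (bshift (- v) x)) 0 = - v + \<pi> (enc x) v" by (simp add: encode_bshift)
  moreover have "- (- v + \<pi> (enc x) v) + - v = - \<pi> (enc x) v" by (simp only: minus_add minus_minus add.assoc right_minus add_0_right)
  ultimately show ?thesis by (simp add: act_def bshift_bshift)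
qed

lemma act_inverse:
  assumes "orbit_perm \<pi>"
  shows "act (\<lambda>\<omega>. inv (\<pi> \<omega>)) (act \<pi> x) = x" "act \<pi> (act (\<lambda>\<omega>. inv (\<pi> \<omega>)) x) = x"
proof -
  have bij: "bij (\<pi> (enc x))" using assms by (simp add: orbit_perm_def)
  have "act (\<lambda>\<omega>. inv (\<pi> \<omega>)) (bshift (- \<pi> (enc x) 0) x) = bshift (- inv (\<pi> (enc x)) (\<pi> (enc x) 0)) x"
    by (rule act_bshift[OF orbit_perm_inv[OF assms]])
  then show "act (\<lambda>\<omega>. inv (\<pi> \<omega>)) (act \<pi> x) = x"
    using bij by (simp add: act_def[of \<pi>] bij_is_inj)
  have "act \<pi> (bshift (- inv (\<pi> (enc x)) 0) x) = bshift (- \<pi> (enc x) (inv (\<pi> (enc x)) 0)) x"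
    by (rule act_bshift[OF assms])
  then show "act \<pi> (act (\<lambda>\<omega>. inv (\<pi> \<omega>)) x) = x"
    using bij by (simp add: act_def[of "\<lambda>\<omega>. inv (\<pi> \<omega>)"] bij_is_surj surj_f_inv_f)
qed

lemma act_space: "x \<in> space X \<Longrightarrow> act \<pi> x \<in> space X"
  by (simp add: act_def space_bern_space bshift_def)

lemma act_bij: "orbit_perm \<pi> \<Longrightarrow> bij_betw (act \<pi>) (space X) (space X)"
  by (rule bij_betw_byWitness[where f' = "act (\<lambda>\<omega>. inv (\<pi> \<omega>))"]) (auto simp: act_inverse act_space)

lemma inv_into_act:
  assumes "orbit_perm \<pi>" "x \<in> space X"
  shows "inv_into (space X) (act \<pi>) x = act (\<lambda>\<omega>. inv (\<pi> \<omega>)) x"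
  using act_bij[OF assms(1)] act_space[OF assms(2)] act_inverse(2)[OF assms(1)]
  by (intro inv_into_f_eq) (auto simp: bij_betw_def)

lemma inv_into_mp:
  assumes "orbit_perm \<pi>" shows "mp_map X (inv_into (space X) (act \<pi>))"
proof -
  have mp: "mp_map X (act (\<lambda>\<omega>. inv (\<pi> \<omega>)))" by (rule act_mp[OF orbit_perm_inv[OF assms]])
  have "inv_into (space X) (act \<pi>) \<in> X \<rightarrow>\<^sub>M X"
    using mp measurable_cong[of X "inv_into (space X) (act \<pi>)" "act (\<lambda>\<omega>. inv (\<pi> \<omega>))" X] inv_into_act[OF assms]
    by (simp add: mp_map_def)
  moreover have "distr X X (inv_into (space X) (act \<pi>)) = distr X X (act (\<lambda>\<omega>. inv (\<pi> \<omega>)))"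
    by (rule distr_cong) (auto simp: inv_into_act[OF assms])
  ultimately show ?thesis using mp by (simp add: mp_map_def)
qed

lemma action: "f2_mp_action X (act pa) (act pc)"
  unfolding f2_mp_action_def
  using act_bij[OF orbit_perm_pa] act_bij[OF orbit_perm_pc] act_mp[OF orbit_perm_pa] act_mp[OF orbit_perm_pc]
    inv_into_mp[OF orbit_perm_pa] inv_into_mp[OF orbit_perm_pc] by simp

text \<open>Orbit containment is visible here, and freeness is reduced to words in two permutations
  of the group.\<close>

lemma word_act_eq:
  assumes x: "x \<in> space X"
  shows "word_act (space X) (act pa) (act pc) w x = bshift (- word_act UNIV (pa (enc x)) (pc (enc x)) w 0) x"
proof (induction w)
  case (Cons l w)
  let ?v = "word_act UNIV (pa (enc x)) (pc (enc x)) w 0"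
  have sp: "bshift (- ?v) x \<in> space X" using x by (simp add: space_bern_space bshift_def)
  have "letter_act (space X) (act pa) (act pc) l (bshift (- ?v) x) = bshift (- letter_act UNIV (pa (enc x)) (pc (enc x)) l ?v) x"
    using act_bshift[OF orbit_perm_pa] act_bshift[OF orbit_perm_pc]
      act_bshift[OF orbit_perm_inv[OF orbit_perm_pa]] act_bshift[OF orbit_perm_inv[OF orbit_perm_pc]]
      inv_into_act[OF orbit_perm_pa sp] inv_into_act[OF orbit_perm_pc sp]
    by (simp add: letter_act_def Let_def)
  then show ?case using Cons by simp
qed simp

lemma AE_enc:
  assumes "AE \<omega> in coin_field. Q \<omega>" shows "AE x in X. Q (enc x)"
  by (rule AE_distrD[OF measurable_encode]) (unfold distr_encode, rule assms)

text \<open>The word moves the vertex 0, and the shift by a nonzero group element moves almost every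
  point.\<close>

lemma ess_free: "f2_ess_free X (act pa) (act pc)"
  unfolding f2_ess_free_def
  using AE_enc[OF AE_Good] AE_bshift_free AE_space
proof eventually_elim
  case (elim x)
  show ?case
  proof (intro allI impI)
    fix w assume w: "reduced_word w \<and> w \<noteq> []"
    then have "word_act UNIV (pa (enc x)) (pc (enc x)) w 0 \<noteq> 0"
      using pa_pc_free elim(1) by blast
    then have "- word_act UNIV (pa (enc x)) (pc (enc x)) w 0 \<noteq> 0" by simp
    then show "word_act (space X) (act pa) (act pc) w x \<noteq> x"
      unfolding word_act_eq[OF elim(3)] using elim(2) by blast
  qed
qed

text \<open>Only coordinates equal to 1 obstruct decoding; these are countably many null events, and
  shifts merely permute the coordinates.\<close>

lemma AE_decode: "AE x in X. \<forall>l. decode (enc (bshift l x)) = bshift l x"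
proof -
  interpret U: prob_space unit_lebesgue by (rule prob_unit_lebesgue)
  have "AE x in X. 0 \<le> x v \<and> x v < 1" for v
    unfolding bern_space_eq by (rule AE_PiM_component) (rule U.prob_space_axioms, simp, rule AE_unit_lebesgue)
  then have "AE x in X. \<forall>v. 0 \<le> x v \<and> x v < 1" by (subst AE_all_countable) simp
  then show ?thesis
    by eventually_elim (auto intro!: ext decode_encode simp: bshift_def)
qed

lemma act_invariant:
  assumes "orbit_perm \<pi>" "act \<pi> ` A = A" "A \<in> sets X" "x \<in> space X"
  shows "act \<pi> x \<in> A \<longleftrightarrow> x \<in> A"
proof
  assume "act \<pi> x \<in> A"
  then obtain y where "y \<in> A" "act \<pi> x = act \<pi> y" using assms(2) by (metis imageE)
  then show "x \<in> A" using act_inverse(1)[OF assms(1)] by metis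
qed (use assms(2) in blast)

text \<open>\<open>encode\<close> is measure preserving and almost surely inverted by
  \<open>decode\<close>, so the preimage of an invariant set under \<open>decode\<close> is almost
  surely invariant in the coin field, where \<open>ergodic\<close> applies.\<close>

lemma ergodic_X: "f2_ergodic X (act pa) (act pc)"
  unfolding f2_ergodic_def
proof (intro ballI impI)
  fix A assume A: "A \<in> sets X" and inv: "\<forall>w. word_act (space X) (act pa) (act pc) w ` A = A"
  have "word_act (space X) (act pa) (act pc) [(True, True)] = act pa" "word_act (space X) (act pa) (act pc) [(False, True)] = act pc"
    by (simp_all add: letter_act_def)
  then have im: "act pa ` A = A" "act pc ` A = A" using inv by metis+
  define A' where "A' = decode -` A \<inter> space (coin_field :: ('g \<times> (bool \<times> nat \<times> 'g) \<Rightarrow> nat \<Rightarrow> bool) measure)"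
  have A'[measurable]: "A' \<in> sets coin_field" unfolding A'_def by (rule measurable_sets[OF measurable_decode A])
  have mem: "\<omega> \<in> A' \<longleftrightarrow> decode \<omega> \<in> A" for \<omega> by (simp add: A'_def)
  have AEinv: "AE \<omega> in coin_field. \<omega> \<in> A' \<longleftrightarrow> sft (- \<pi> \<omega> 0) \<omega> \<in> A'" if \<pi>: "orbit_perm \<pi>" "act \<pi> ` A = A" for \<pi>
  proof -
    have [measurable]: "Measurable.pred coin_field (\<lambda>\<omega>. \<pi> \<omega> u = v)" for u v
      using \<pi> by (simp add: orbit_perm_def)
    have eq: "(\<lambda>\<omega>. sft (- \<pi> \<omega> 0) \<omega> \<in> A') = (\<lambda>\<omega>. \<exists>g. \<pi> \<omega> 0 = g \<and> sft (- g) \<omega> \<in> A')" by auto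
    have [measurable]: "Measurable.pred coin_field (\<lambda>\<omega>. sft (- g) \<omega> \<in> A')" for g
      using sets_sft[OF A'] by (simp add: pred_def)
    have [measurable]: "Measurable.pred coin_field (\<lambda>\<omega>. sft (- \<pi> \<omega> 0) \<omega> \<in> A')"
      unfolding eq by measurable
    have "AE x in X. enc x \<in> A' \<longleftrightarrow> sft (- \<pi> (enc x) 0) (enc x) \<in> A'"
      using AE_decode AE_space
    proof eventually_elim
      case (elim x)
      have "enc x \<in> A' \<longleftrightarrow> x \<in> A" using elim(1)[rule_format, of 0] by (simp add: mem)
      moreover have "sft (- \<pi> (enc x) 0) (enc x) \<in> A' \<longleftrightarrow> act \<pi> x \<in> A"
        using elim(1)[rule_format, of "- \<pi> (enc x) 0"] by (simp add: mem act_def encode_bshift)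
      ultimately show ?case using act_invariant[OF \<pi> A elim(2)] by simp
    qed
    then have "AE \<omega> in distr X coin_field enc. \<omega> \<in> A' \<longleftrightarrow> sft (- \<pi> \<omega> 0) \<omega> \<in> A'"
      by (subst AE_distr_iff[OF measurable_encode]) measurable
    then show ?thesis unfolding distr_encode .
  qed
  have "measure coin_field A' = measure X (enc -` A' \<inter> space X)"
    by (subst distr_encode[symmetric], rule measure_distr[OF measurable_encode]) simp
  also have "\<dots> = measure X A"
  proof (rule measure_eq_AE)
    show "AE x in X. x \<in> enc -` A' \<inter> space X \<longleftrightarrow> x \<in> A"
      using AE_decode AE_space
    proof eventually_elim
      case (elim x)
      then show ?case using elim(1)[rule_format, of 0] by (simp add: mem)
    qed
  qed (use A measurable_sets[OF measurable_encode A'] in auto)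
  finally show "measure X A = 0 \<or> measure X A = 1"
    using ergodic[OF A' AEinv[OF orbit_perm_pa im(1)] AEinv[OF orbit_perm_pc im(2)]] by simp
qed

lemma f2_action_in_bernoulli_shift: "\<exists>a b. f2_mp_action X a b \<and> f2_ergodic X a b \<and> f2_ess_free X a b \<and>
    (AE x in X. \<forall>w. \<exists>l. word_act (space X) a b w x = bshift l x)"
proof (intro exI conjI)
  show "AE x in X. \<forall>w. \<exists>l. word_act (space X) (act pa) (act pc) w x = bshift l x"
    using word_act_eq by (intro AE_I2) blast
qed (fact action ergodic_X ess_free)+

end

theorem theorem1:
  assumes "\<not> amenable_group TYPE('g::{countable, group_add})"
  shows "\<exists>a b. f2_mp_action (bern_space TYPE('g)) a b
           \<and> f2_ergodic (bern_space TYPE('g)) a b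
           \<and> f2_ess_free (bern_space TYPE('g)) a b
           \<and> (AE x in bern_space TYPE('g).
                \<forall>w. \<exists>l::'g. word_act (space (bern_space TYPE('g))) a b w x = bshift l x)"
proof -
  obtain p :: "nat \<Rightarrow> 'g \<Rightarrow> real" and \<rho> where p: "0 < \<rho>" "\<rho> < 1"
    "\<And>k g. 0 \<le> p k g" "\<And>k g. p k g \<le> \<rho> ^ k" "\<And>k g. p k (- g) = p k g"
    "\<And>k. (\<Sum>\<^sup>+g. ennreal (p k g)) = 1"
    "\<And>k l g. (\<Sum>\<^sup>+h. ennreal (p k h) * ennreal (p l (- h + g))) = ennreal (p (k + l) g)"
    by (rule nonamenable_walk[OF assms]) blast
  have "(\<lambda>n. \<rho> ^ n) \<longlonglongrightarrow> 0" using p by (intro LIMSEQ_power_zero) simp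
  then have "eventually (\<lambda>n. \<rho> ^ n < (1 - \<rho>) / 8) sequentially"
    using p by (intro order_tendstoD(2)) auto
  then have "eventually (\<lambda>n. \<rho> ^ n < (1 - \<rho>) / 8 \<and> 0 < n) sequentially"
    using eventually_gt_at_top[of 0] by eventually_elim simp
  \<comment> \<open>Makes the geometric series starting at \<open>\<rho> ^ K\<close> at most 1 / 8,
    as \<open>small\<close> demands.\<close>
  then obtain K where K: "\<rho> ^ K < (1 - \<rho>) / 8" "0 < K"
    by (auto dest: eventually_happens)
  have "(\<Sum>\<^sup>+j. ennreal (\<rho> ^ (K + j))) = (\<Sum>j. ennreal (\<rho> ^ K * \<rho> ^ j))"
    by (simp add: nn_integral_count_space_nat power_add)
  also have "\<dots> = ennreal (\<Sum>j. \<rho> ^ K * \<rho> ^ j)"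
    using p by (intro suminf_ennreal2 summable_mult summable_geometric) auto
  also have "(\<Sum>j. \<rho> ^ K * \<rho> ^ j) = \<rho> ^ K * (1 / (1 - \<rho>))"
    using p by (subst suminf_mult) (auto intro!: summable_geometric simp: suminf_geometric)
  also have "ennreal \<dots> \<le> ennreal (1 / 8)"
    using K p by (intro ennreal_leI) (simp add: field_simps)
  finally have small: "(\<Sum>\<^sup>+j. ennreal (\<rho> ^ (K + j))) \<le> ennreal (1 / 8)" .
  \<comment> \<open>The bit sequence attached to a vertex and a slot is compared with the prescribed
    probability; both flags use the same threshold.\<close>
  define On where "On k = {b. of_bits b < p (K + fst (snd k)) (snd (snd k))}" for k :: "bool \<times> nat \<times> 'g"
  have le1: "p k g \<le> 1" for k g
    using p(4)[of k g] power_le_one[of \<rho> k] p(1,2) by linarith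
  have sOn: "On k \<in> sets coin_seq" for k
  proof -
    have "{b \<in> space coin_seq. of_bits b < p (K + fst (snd k)) (snd (snd k))} \<in> sets coin_seq" by measurable
    then show ?thesis by (simp add: On_def)
  qed
  have mOn: "measure coin_seq (On (b, j, g)) = p (K + j) g" for b j g
    using measure_of_bits_less[of "p (K + j) g"] p(3) le1 by (simp add: On_def)
  interpret iid_space coin_seq "coin_field :: ('g \<times> (bool \<times> nat \<times> 'g) \<Rightarrow> nat \<Rightarrow> bool) measure"
    by (rule iid_coin_field)
  interpret bernoulli_percolation p \<rho> K On
    by unfold_locales (use p K small sOn mOn in auto)
  show ?thesis by (rule f2_action_in_bernoulli_shift)
qed

end
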